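(* Let $\mathcal{D}$ be the generating class of a decomposable model for $I_1\times\cdots\times I_m$ contingency tables, and let $G_{I_1,\dots,I_m}=S_{I_1}\times\cdots\times S_{I_m}$. (1) For each $\mathbf{b}\in\mathcal{B}^0_{\mathrm{nd}}$, a $G_{\mathbf{b}}$-invariant set $\mathcal{M}_{G_{\mathbf{b}}}$ of moves in the fiber $\mathcal{F}^0_{\mathbf{b}}=\mathcal{F}_{\mathbf{b}}$ is a minimal $G_{\mathbf{b}}$-invariant set of moves that connects $\mathcal{F}^0_{\mathbf{b}}$ if and only if there is a basis $\{\mathbf{v}_2,\dots,\mathbf{v}_{c(\mathbf{b})}\}$ of $\mathcal{V}^{c(\mathbf{b})-1}$ such that $\mathbf{z}^{\mathbf{b}}_{\mathbf{v}_k}$, $k=2,\dots,c(\mathbf{b})$, are representative moves of the $G_{\mathbf{b}}$-orbits in $\mathcal{M}_{G_{\mathbf{b}}}$. Hence the number $\kappa(\mathbf{b})$ of $G_{\mathbf{b}}$-orbits in such a minimal set is $c(\mathbf{b})-1$. (2) For any choice, for each $\mathbf{b}\in\mathcal{B}^0_{\mathrm{nd}}$, of a basis $\{\mathbf{v}_2,\dots,\mathbf{v}_{c(\mathbf{b})}\}$ of $\mathcal{V}^{c(\mathbf{b})-1}$ (depending on $\mathbf{b}$), the set $$\mathcal{M}_G=\bigcup_{\mathbf{b}\in\mathcal{B}^0_{\mathrm{nd}}}\ \bigcup_{k=2}^{c(\mathbf{b})}G_{I_1,\dots,I_m}(\mathbf{z}^{\mathbf{b}}_{\mathbf{v}_k})$$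 is a minimal $G_{I_1,\dots,I_m}$-invariant Markov basis, where $G_{I_1,\dots,I_m}(\mathbf{z})$ denotes the $G_{I_1,\dots,I_m}$-orbit of $\mathbf{z}$. (3) Conversely, every minimal $G_{I_1,\dots,I_m}$-invariant Markov basis can be written in this form.
   Context: Let $\Delta=\{1,\dots,m\}$ be the set of variables; variable $\delta$ has level set $\mathcal{I}_\delta=\{0,1,\dots,I_\delta-1\}$ with $I_\delta\ge2$, and the cells are $i=(i_1,\dots,i_m)\in\mathcal{I}=\prod_{\delta\in\Delta}\mathcal{I}_\delta$. A contingency table is a nonnegative integer array $\mathbf{n}=\{n(i)\}_{i\in\mathcal{I}}$; its sample size is $\sum_in(i)$. For distinct cells $i,j$, $(i)(j)$ denotes the table with frequency $1$ at $i$ and at $j$ and $0$ elsewhere. For $D\subset\Delta$, the $D$-marginal table has entries $n_D(i_D)=\sum_{i_{D^C}}n(i_D,i_{D^C})$. The generating class $\mathcal{D}=\{D_1,\dots,D_r\}$ is the set of facets of a simplicial complex with $\bigcup_jD_j=\Delta$. The independence graph $\mathcal{G}^{\mathcal{D}}$ has vertex set $\Delta$, with distinct $\delta,\delta'$ adjacent iff $\delta,\delta'\in D$ for some $D\in\mathcal{D}$. The model is decomposable if $\mathcal{D}$ is the set of maximal cliques of $\mathcal{G}^{\mathcal{D}}$ and $\mathcal{G}^{\mathcal{D}}$ is chordal. The marginal frequencies of $\mathbf{n}$ are $\mathbf{b}=A\mathbf{n}$, the collection of all entries of the $D_j$-marginal tables, $j=1,\dots,r$; the fiber is $\mathcal{F}_{\mathbf{b}}=\{\mathbf{n}\ge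 0\mid A\mathbf{n}=\mathbf{b}\}$; $\deg\mathbf{b}$ is the common sample size of its elements. A move is an integer array $\mathbf{z}$ with $A\mathbf{z}=\mathbf{0}$; a move in a degree two fiber $\mathcal{F}_{\mathbf{b}}$ means $\mathbf{n}-\mathbf{n}'$ with $\mathbf{n}\ne\mathbf{n}'$ in $\mathcal{F}_{\mathbf{b}}$. Moves are considered up to sign ($\mathbf{z}$ is identified with $-\mathbf{z}$). A set $\mathcal{M}$ of moves connects a fiber if any two elements of the fiber are joined by a finite sequence of elements of the fiber with consecutive differences $\pm\mathbf{z}$, $\mathbf{z}\in\mathcal{M}$. A finite set of moves is a Markov basis if it connects every fiber. A set $\mathcal{M}$ of moves is invariant under a group $G$ if for $g\in G$, $\mathbf{z}\in\mathcal{M}$ one has $g(\mathbf{z})\in\mathcal{M}$ or $-g(\mathbf{z})\in\mathcal{M}$. A $G$-invariant Markov basis (resp. $G$-invariant set connecting a fiber) is minimal if no proper $G$-invariant subset is a Markov basis (resp. connects that fiber). $G_{I_1,\dots,I_m}$ acts on cells by permuting the levels of each variable, and hence on tables and moves. For $\deg\mathbf{b}=2$, a variable $\delta$ is non-degenerate if two different levels of $\delta$ have one-dimensional marginal frequency $1$ (otherwise one level has marginal frequency $2$); $\bar\Delta_{\mathbf{b}}$ is the set of non-degenerate variables, $\mathcal{G}(\bar\Delta_{\mathbf{b}})$ the subgraph of $\mathcal{G}^{\mathcal{D}}$ induced by it, and $\Gamma_1,\dots,\Gamma_{c(\mathbf{b})}$ (in some fixed order) the vertex sets of its connected components. Let $\mathcal{B}_{\mathrm{nd}}=\{\mathbf{b}\mid\deg\mathbf{b}=2,|\mathcal{F}_{\mathbf{b}}|\ge2\}$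 and let $\mathcal{B}^0_{\mathrm{nd}}$ be the set of those $\mathbf{b}\in\mathcal{B}_{\mathrm{nd}}$ for which $\mathbf{n}^{\mathbf{b}}_0\in\mathcal{F}_{\mathbf{b}}$, where $\mathbf{n}^{\mathbf{b}}_0=(i)(j)$ with $i$ the all-zero cell and $j$ the cell with $j_\delta=1$ for $\delta\in\bar\Delta_{\mathbf{b}}$ and $j_\delta=0$ for $\delta\notin\bar\Delta_{\mathbf{b}}$. For $\mathbf{b}\in\mathcal{B}^0_{\mathrm{nd}}$ the fiber is written $\mathcal{F}^0_{\mathbf{b}}$. $\mathcal{V}^{c-1}=\{0,1\}^{c-1}$ is the vector space over $\mathrm{GF}(2)$ with coordinates indexed by $2,\dots,c$. For $\mathbf{b}\in\mathcal{B}^0_{\mathrm{nd}}$ and $\mathbf{v}=(v_2,\dots,v_{c(\mathbf{b})})\in\mathcal{V}^{c(\mathbf{b})-1}$, let $\mathbf{n}^{\mathbf{b}}_{\mathbf{v}}=(i)(j)$ where $i_\delta=0,\ j_\delta=1$ for $\delta\in\Gamma_1$; $i_\delta=v_l,\ j_\delta=1-v_l$ for $\delta\in\Gamma_l$, $l\ge2$; and $i_\delta=j_\delta=0$ for $\delta\notin\bar\Delta_{\mathbf{b}}$. Put $\mathbf{z}^{\mathbf{b}}_{\mathbf{v}}=\mathbf{n}^{\mathbf{b}}_0-\mathbf{n}^{\mathbf{b}}_{\mathbf{v}}$. The group $G_{\mathbf{b}}=G^{\Gamma_2}\times\cdots\times G^{\Gamma_{c(\mathbf{b})}}\cong S_2^{c(\mathbf{b})-1}$,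 where $G^{\Gamma_l}=\{(g,\dots,g)\mid g\in S_2\}\subset S_2^{|\Gamma_l|}$ is the diagonal subgroup, acts on $\mathcal{F}^0_{\mathbf{b}}$ (and on its moves): the $l$-th factor applies $g\in S_2$ (a permutation of the levels $\{0,1\}$) simultaneously to the levels of all variables in $\Gamma_l$ in both cells; the levels of variables in $\Gamma_1$ and of degenerate variables are left unchanged. *)

theory Defs
  imports
    Complex_Main
    "HOL-Library.FuncSet"
    "HOL-Library.Function_Algebras"
    "HOL-Library.Z2"
    "HOL-Combinatorics.Permutations"
begin

subsection \<open>Contingency tables and marginals\<close>

type_synonym cell = "nat \<Rightarrow> nat"
type_synonym arr = "cell \<Rightarrow> int"
type_synonym marginals = "nat set \<Rightarrow> cell \<Rightarrow> int"

abbreviation (input) vars :: "nat \<Rightarrow> nat set"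
  where "vars m \<equiv> {1..m}"

text \<open>Throughout, \<open>I \<delta>\<close> is the number of levels of the variable \<open>\<delta>\<close> and \<open>\<D>\<close> is the
  generating class. Arrays indexed by the cells are functions that vanish outside the set of cells.\<close>

definition cells :: "nat \<Rightarrow> (nat \<Rightarrow> nat) \<Rightarrow> cell set"
  where "cells m I = (\<Pi>\<^sub>E \<delta>\<in>vars m. {..<I \<delta>})"

definition arrays :: "nat \<Rightarrow> (nat \<Rightarrow> nat) \<Rightarrow> arr set"
  where "arrays m I = {z. \<forall>i. i \<notin> cells m I \<longrightarrow> z i = 0}"

definition tables :: "nat \<Rightarrow> (nat \<Rightarrow> nat) \<Rightarrow> arr set"
  where "tables m I = {n \<in> arrays m I. \<forall>i. 0 \<le> n i}"

definition sample_size :: "nat \<Rightarrow> (nat \<Rightarrow> nat) \<Rightarrow> arr \<Rightarrow> int"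
  where "sample_size m I n = (\<Sum>i\<in>cells m I. n i)"

definition marginal :: "nat \<Rightarrow> (nat \<Rightarrow> nat) \<Rightarrow> nat set \<Rightarrow> arr \<Rightarrow> cell \<Rightarrow> int"
  where "marginal m I D n k = (\<Sum>i | i \<in> cells m I \<and> restrict i D = k. n i)"

text \<open>The linear map \<open>A\<close>: all marginal tables belonging to the generators.\<close>

definition margins :: "nat \<Rightarrow> (nat \<Rightarrow> nat) \<Rightarrow> nat set set \<Rightarrow> arr \<Rightarrow> marginals"
  where "margins m I \<D> n = (\<lambda>D. if D \<in> \<D> then marginal m I D n else 0)"

definition fiber :: "nat \<Rightarrow> (nat \<Rightarrow> nat) \<Rightarrow> nat set set \<Rightarrow> marginals \<Rightarrow> arr set"
  where "fiber m I \<D> b = {n \<in> tables m I. margins m I \<D> n = b}"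

text \<open>Meaningful for nonempty fibers only.\<close>

definition deg :: "nat \<Rightarrow> (nat \<Rightarrow> nat) \<Rightarrow> nat set set \<Rightarrow> marginals \<Rightarrow> int"
  where "deg m I \<D> b = (THE s. \<forall>n\<in>fiber m I \<D> b. sample_size m I n = s)"

text \<open>The table with frequency 1 at each of the two distinct cells \<open>i\<close> and \<open>j\<close>.\<close>

definition two_cells :: "cell \<Rightarrow> cell \<Rightarrow> arr"
  where "two_cells i j = (\<lambda>k. of_bool (k = i) + of_bool (k = j))"

subsection \<open>Decomposable models\<close>

definition simplicial_complex :: "nat set \<Rightarrow> nat set set \<Rightarrow> bool"
  where "simplicial_complex V K \<longleftrightarrow> K \<noteq> {} \<and> K \<subseteq> Pow V \<and> (\<forall>F\<in>K. \<forall>F'. F' \<subseteq> F \<longrightarrow> F' \<in> K)"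

definition facets :: "nat set set \<Rightarrow> nat set set"
  where "facets K = {F \<in> K. \<forall>F'\<in>K. F \<subseteq> F' \<longrightarrow> F' = F}"

definition generating_class :: "nat \<Rightarrow> nat set set \<Rightarrow> bool"
  where "generating_class m \<D> \<longleftrightarrow>
    (\<exists>K. simplicial_complex (vars m) K \<and> \<D> = facets K) \<and> \<Union>\<D> = vars m"

definition indep_graph :: "nat set set \<Rightarrow> nat rel"
  where "indep_graph \<D> = {(x, y). x \<noteq> y \<and> (\<exists>D\<in>\<D>. x \<in> D \<and> y \<in> D)}"

definition clique :: "nat set \<Rightarrow> nat rel \<Rightarrow> nat set \<Rightarrow> bool"
  where "clique V E C \<longleftrightarrow> C \<subseteq> V \<and> (\<forall>x\<in>C. \<forall>y\<in>C. x \<noteq> y \<longrightarrow> (x, y) \<in> E)"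

definition maximal_cliques :: "nat set \<Rightarrow> nat rel \<Rightarrow> nat set set"
  where "maximal_cliques V E = {C. clique V E C \<and> (\<forall>C'. clique V E C' \<and> C \<subseteq> C' \<longrightarrow> C' = C)}"

definition is_cycle :: "nat rel \<Rightarrow> nat list \<Rightarrow> bool"
  where "is_cycle E xs \<longleftrightarrow> 3 \<le> length xs \<and> distinct xs \<and>
    (\<forall>k<length xs. (xs ! k, xs ! (Suc k mod length xs)) \<in> E)"

definition has_chord :: "nat rel \<Rightarrow> nat list \<Rightarrow> bool"
  where "has_chord E xs \<longleftrightarrow> (\<exists>k<length xs. \<exists>l<length xs. k \<noteq> l \<and> (xs ! k, xs ! l) \<in> E \<and>
    l \<noteq> Suc k mod length xs \<and> k \<noteq> Suc l mod length xs)"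

definition chordal :: "nat rel \<Rightarrow> bool"
  where "chordal E \<longleftrightarrow> (\<forall>xs. is_cycle E xs \<and> 4 \<le> length xs \<longrightarrow> has_chord E xs)"

definition decomposable :: "nat \<Rightarrow> nat set set \<Rightarrow> bool"
  where "decomposable m \<D> \<longleftrightarrow>
    \<D> = maximal_cliques (vars m) (indep_graph \<D>) \<and> chordal (indep_graph \<D>)"

definition components :: "nat rel \<Rightarrow> nat set \<Rightarrow> nat set set"
  where "components E S = S // ((E \<inter> S \<times> S)\<^sup>* \<inter> S \<times> S)"

subsection \<open>Moves up to sign\<close>

text \<open>A move up to sign is the set \<open>{z, - z}\<close>; accordingly a set of moves has type
  \<^typ>\<open>arr set set\<close>.\<close>

definition up_to_sign :: "arr \<Rightarrow> arr set"
  where "up_to_sign z = {z, - z}"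

definition moves :: "nat \<Rightarrow> (nat \<Rightarrow> nat) \<Rightarrow> nat set set \<Rightarrow> arr set set"
  where "moves m I \<D> = up_to_sign ` {z \<in> arrays m I. margins m I \<D> z = 0}"

definition fiber_moves :: "nat \<Rightarrow> (nat \<Rightarrow> nat) \<Rightarrow> nat set set \<Rightarrow> marginals \<Rightarrow> arr set set"
  where "fiber_moves m I \<D> b =
    {up_to_sign (n - n') | n n'. n \<in> fiber m I \<D> b \<and> n' \<in> fiber m I \<D> b \<and> n \<noteq> n'}"

definition connects :: "arr set set \<Rightarrow> arr set \<Rightarrow> bool"
  where "connects M F \<longleftrightarrow>
    (\<forall>n\<in>F. \<forall>n'\<in>F. (n, n') \<in> {(x, y). x \<in> F \<and> y \<in> F \<and> up_to_sign (y - x) \<in> M}\<^sup>*)"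

definition markov_basis :: "nat \<Rightarrow> (nat \<Rightarrow> nat) \<Rightarrow> nat set set \<Rightarrow> arr set set \<Rightarrow> bool"
  where "markov_basis m I \<D> M \<longleftrightarrow>
    M \<subseteq> moves m I \<D> \<and> finite M \<and> (\<forall>b. connects M (fiber m I \<D> b))"

subsection \<open>Group actions\<close>

definition level_perms :: "nat \<Rightarrow> (nat \<Rightarrow> nat) \<Rightarrow> (nat \<Rightarrow> nat \<Rightarrow> nat) set"
  where "level_perms m I = (\<Pi>\<^sub>E \<delta>\<in>vars m. {p. p permutes {..<I \<delta>}})"

text \<open>The action on arrays induced by \<open>(i\<^sub>\<delta>)\<^sub>\<delta> \<mapsto> (g\<^sub>\<delta>(i\<^sub>\<delta>))\<^sub>\<delta>\<close>, i.e. \<open>(g n)(i) = n(g\<^sup>-\<^sup>1 i)\<close>; in particular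
  \<open>g\<close> maps \<open>(i)(j)\<close> to \<open>(g i)(g j)\<close>.\<close>

definition act :: "nat \<Rightarrow> (nat \<Rightarrow> nat) \<Rightarrow> (nat \<Rightarrow> nat \<Rightarrow> nat) \<Rightarrow> arr \<Rightarrow> arr"
  where "act m I g n =
    (\<lambda>i. if i \<in> cells m I then n (\<lambda>\<delta>\<in>vars m. inv (g \<delta>) (i \<delta>)) else 0)"

text \<open>As \<^term>\<open>act m I g\<close> commutes with negation, the image of \<open>{z, - z}\<close> is \<open>{g z, - g z}\<close>.\<close>

definition act_move :: "nat \<Rightarrow> (nat \<Rightarrow> nat) \<Rightarrow> (nat \<Rightarrow> nat \<Rightarrow> nat) \<Rightarrow> arr set \<Rightarrow> arr set"
  where "act_move m I g Z = act m I g ` Z"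

definition orbit :: "nat \<Rightarrow> (nat \<Rightarrow> nat) \<Rightarrow> (nat \<Rightarrow> nat \<Rightarrow> nat) set \<Rightarrow> arr set \<Rightarrow> arr set set"
  where "orbit m I G Z = (\<lambda>g. act_move m I g Z) ` G"

definition invariant :: "nat \<Rightarrow> (nat \<Rightarrow> nat) \<Rightarrow> (nat \<Rightarrow> nat \<Rightarrow> nat) set \<Rightarrow> arr set set \<Rightarrow> bool"
  where "invariant m I G M \<longleftrightarrow> (\<forall>g\<in>G. \<forall>Z\<in>M. act_move m I g Z \<in> M)"

definition orbits :: "nat \<Rightarrow> (nat \<Rightarrow> nat) \<Rightarrow> (nat \<Rightarrow> nat \<Rightarrow> nat) set \<Rightarrow> arr set set \<Rightarrow> arr set set set"
  where "orbits m I G M = orbit m I G ` M"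

definition minimal_invariant_connecting ::
    "nat \<Rightarrow> (nat \<Rightarrow> nat) \<Rightarrow> (nat \<Rightarrow> nat \<Rightarrow> nat) set \<Rightarrow> arr set \<Rightarrow> arr set set \<Rightarrow> bool"
  where "minimal_invariant_connecting m I G F M \<longleftrightarrow>
    invariant m I G M \<and> connects M F \<and>
    (\<forall>M'. M' \<subset> M \<and> invariant m I G M' \<longrightarrow> \<not> connects M' F)"

definition minimal_invariant_markov_basis ::
    "nat \<Rightarrow> (nat \<Rightarrow> nat) \<Rightarrow> nat set set \<Rightarrow> (nat \<Rightarrow> nat \<Rightarrow> nat) set \<Rightarrow> arr set set \<Rightarrow> bool"
  where "minimal_invariant_markov_basis m I \<D> G M \<longleftrightarrow>
    invariant m I G M \<and> markov_basis m I \<D> M \<and>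
    (\<forall>M'. M' \<subset> M \<and> invariant m I G M' \<longrightarrow> \<not> markov_basis m I \<D> M')"

subsection \<open>Fibers of degree two\<close>

text \<open>All tables of a fiber have the same one-dimensional marginals, because every variable lies in
  some generator.\<close>

definition nondegenerate :: "nat \<Rightarrow> (nat \<Rightarrow> nat) \<Rightarrow> nat set set \<Rightarrow> marginals \<Rightarrow> nat set"
  where "nondegenerate m I \<D> b = {\<delta> \<in> vars m. \<exists>n\<in>fiber m I \<D> b. \<exists>k<I \<delta>. \<exists>l<I \<delta>. k \<noteq> l \<and>
    marginal m I {\<delta>} n (\<lambda>_\<in>{\<delta>}. k) = 1 \<and> marginal m I {\<delta>} n (\<lambda>_\<in>{\<delta>}. l) = 1}"

definition nd_components :: "nat \<Rightarrow> (nat \<Rightarrow> nat) \<Rightarrow> nat set set \<Rightarrow> marginals \<Rightarrow> nat set set"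
  where "nd_components m I \<D> b = components (indep_graph \<D>) (nondegenerate m I \<D> b)"

definition num_comps :: "nat \<Rightarrow> (nat \<Rightarrow> nat) \<Rightarrow> nat set set \<Rightarrow> marginals \<Rightarrow> nat"
  where "num_comps m I \<D> b = card (nd_components m I \<D> b)"

definition Bnd :: "nat \<Rightarrow> (nat \<Rightarrow> nat) \<Rightarrow> nat set set \<Rightarrow> marginals set"
  where "Bnd m I \<D> = {b. deg m I \<D> b = 2 \<and> 2 \<le> card (fiber m I \<D> b)}"

definition n0 :: "nat \<Rightarrow> (nat \<Rightarrow> nat) \<Rightarrow> nat set set \<Rightarrow> marginals \<Rightarrow> arr"
  where "n0 m I \<D> b = two_cells
    (\<lambda>\<delta>\<in>vars m. 0)
    (\<lambda>\<delta>\<in>vars m. if \<delta> \<in> nondegenerate m I \<D> b then 1 else 0)"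

definition Bnd0 :: "nat \<Rightarrow> (nat \<Rightarrow> nat) \<Rightarrow> nat set set \<Rightarrow> marginals set"
  where "Bnd0 m I \<D> = {b \<in> Bnd m I \<D>. n0 m I \<D> b \<in> fiber m I \<D> b}"

text \<open>In what follows \<open>\<Gamma>\<close> enumerates, for a fixed marginal \<open>b\<close>, the components as
  \<open>\<Gamma> 1, \<dots>, \<Gamma> c\<close>. A vector over GF(2) with coordinates indexed by \<open>2, \<dots>, c\<close>
  is a function vanishing outside \<open>{2..c}\<close>.\<close>

definition nv :: "nat \<Rightarrow> nat \<Rightarrow> (nat \<Rightarrow> nat set) \<Rightarrow> (nat \<Rightarrow> bit) \<Rightarrow> arr"
  where "nv m c \<Gamma> v = two_cells
    (\<lambda>\<delta>\<in>vars m. if \<exists>l\<in>{2..c}. \<delta> \<in> \<Gamma> l \<and> v l = 1 then 1 else 0)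
    (\<lambda>\<delta>\<in>vars m. if \<delta> \<in> \<Gamma> 1 \<or> (\<exists>l\<in>{2..c}. \<delta> \<in> \<Gamma> l \<and> v l = 0) then 1 else 0)"

definition zv :: "nat \<Rightarrow> (nat \<Rightarrow> nat) \<Rightarrow> nat set set \<Rightarrow> (nat \<Rightarrow> nat set) \<Rightarrow> marginals \<Rightarrow> (nat \<Rightarrow> bit) \<Rightarrow> arr"
  where "zv m I \<D> \<Gamma> b v = n0 m I \<D> b - nv m (num_comps m I \<D> b) \<Gamma> v"

text \<open>The group \<open>G\<^sub>b\<close>, realised as a subgroup of \<^term>\<open>level_perms m I\<close>: a permutation of
  \<open>{0, 1}\<close> is regarded as one of \<open>{..<I \<delta>}\<close> fixing the remaining levels, which do not occur in the
  fibers on which \<open>G\<^sub>b\<close> acts.\<close>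

definition Gb :: "nat \<Rightarrow> (nat \<Rightarrow> nat) \<Rightarrow> nat \<Rightarrow> (nat \<Rightarrow> nat set) \<Rightarrow> (nat \<Rightarrow> nat \<Rightarrow> nat) set"
  where "Gb m I c \<Gamma> = {g \<in> level_perms m I. \<exists>s. (\<forall>l\<in>{2..c}. s l permutes {0, 1}) \<and>
    (\<forall>l\<in>{2..c}. \<forall>\<delta>\<in>\<Gamma> l. g \<delta> = s l) \<and>
    (\<forall>\<delta>\<in>vars m - (\<Union>l\<in>{2..c}. \<Gamma> l). g \<delta> = id)}"

interpretation gf2: vector_space "\<lambda>(a::bit) (v::nat \<Rightarrow> bit) l. a * v l"
  by unfold_locales (simp_all only: fun_eq_iff plus_fun_apply distrib_left distrib_right mult.assoc mult_1_left simp_thms)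

definition gf2_space :: "nat \<Rightarrow> (nat \<Rightarrow> bit) set"
  where "gf2_space c = {v. \<forall>l. l \<notin> {2..c} \<longrightarrow> v l = 0}"

definition gf2_basis :: "nat \<Rightarrow> (nat \<Rightarrow> bit) set \<Rightarrow> bool"
  where "gf2_basis c B \<longleftrightarrow>
    B \<subseteq> gf2_space c \<and> gf2.independent B \<and> gf2.span B = gf2_space c"

text \<open>The union of the \<open>G\<close>-orbits of the moves given by a choice \<open>B\<close> of bases, where \<open>G\<close> is the
  full group of level permutations.\<close>

definition basis_moves ::
    "nat \<Rightarrow> (nat \<Rightarrow> nat) \<Rightarrow> nat set set \<Rightarrow> (marginals \<Rightarrow> nat \<Rightarrow> nat set) \<Rightarrow>
     (marginals \<Rightarrow> (nat \<Rightarrow> bit) set) \<Rightarrow> arr set set"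
  where "basis_moves m I \<D> \<Gamma> B =
    (\<Union>b\<in>Bnd0 m I \<D>. \<Union>v\<in>B b. orbit m I (level_perms m I) (up_to_sign (zv m I \<D> (\<Gamma> b) b v)))"

end

theory Submission
  imports Defs "HOL-Library.Multiset"
begin

text \<open>A fiber in \<open>Bnd0\<close> consists of the tables \<open>n\<^sub>v\<close> for all \<open>v\<close> in the space over GF(2), because
  the cells of a degree two table agree up to exchange along every component. On it \<open>G\<^sub>b\<close>
  acts by the translations \<open>n\<^sub>v \<mapsto> n\<^sub>v\<^sub>+\<^sub>w\<close>, so the orbit of the move \<open>n\<^sub>u - n\<^sub>v\<close> is determined by
  \<open>u + v\<close>, and an invariant set of moves connects the fiber iff the occurring directions span
  the space; minimal spanning sets are bases.

  For a decomposable model the moves of degree two connect every fiber: remove a simplicial vertex of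
  the independence graph, connect the marginal tables on the remaining variables, lift these moves,
  and finally exchange levels of the removed variable. Hence an invariant set is a Markov basis iff it
  spans in each fiber in \<open>Bnd0\<close>. The directions in different such fibers do not interact, since
  each orbit of moves under the full group of level permutations contains at most one
  \<open>z\<^sub>v\<close> with \<open>v \<noteq> 0\<close>, up to sign.\<close>

subsection \<open>Simplicial vertices of chordal graphs\<close>

text \<open>The two cells of a table are unordered. Fixing level 0 on \<open>\<Gamma> 1\<close> for
  one of them orders the pair, which is why only \<open>c - 1\<close> coordinates remain and why
  \<open>G\<^sub>b\<close> leaves \<open>\<Gamma> 1\<close> alone. Simplicial vertices enter because
  all cliques through such a vertex lie in a single one, its closed neighbourhood: a lifted move or
  an exchange of levels has only one new marginal to respect. The last two claims of the theorem mix
  all fibers through the large group. What separates the fibers is that an orbit still determines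
  its starting data. Distinct tables of one fiber have disjoint supports, so a move remembers its
  two tables. Level permutations preserve the set of nondegenerate variables, which determines
  \<open>b\<close>. Finally, \<open>v l\<close> is encoded in whether the two tables have the same
  marginal on one variable of \<open>\<Gamma> 1\<close> and one of \<open>\<Gamma> l\<close>, a
  condition that neither a permutation nor a sign affects.\<close>

definition simplicial :: "nat rel \<Rightarrow> nat set \<Rightarrow> nat \<Rightarrow> bool"
  where "simplicial E W v \<longleftrightarrow> v \<in> W \<and> clique W E {x \<in> W. (v, x) \<in> E}"

definition walk :: "nat rel \<Rightarrow> nat list \<Rightarrow> nat \<Rightarrow> nat \<Rightarrow> bool"
  where "walk E p s t \<longleftrightarrow> p \<noteq> [] \<and> hd p = s \<and> last p = t \<and> (\<forall>k. Suc k < length p \<longrightarrow> (p ! k, p ! Suc k) \<in> E)"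

text \<open>This covers both ways of shortening a walk: cutting out a loop and jumping along a
  chord. There is no junction for \<open>k = 0\<close>, where the new walk starts at
  \<open>p ! l\<close>; the assumption on \<open>hd\<close> then says that this vertex is
  \<open>s\<close>.\<close>

lemma walk_splice:
  assumes w: "walk E p s t" and kl: "k \<le> length p" "l < length p"
    and hd: "hd (take k p @ drop l p) = s"
    and junction: "0 < k \<Longrightarrow> (p ! (k - 1), p ! l) \<in> E"
  shows "walk E (take k p @ drop l p) s t"
proof -
  let ?q = "take k p @ drop l p"
  have "(?q ! i, ?q ! Suc i) \<in> E" if i: "Suc i < length ?q" for i
  proof -
    have step: "(p ! j, p ! Suc j) \<in> E" if "Suc j < length p" for j
      using w that by (simp add: walk_def)
    consider "Suc i < k" | "Suc i = k" | "k \<le> i" by linarith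
    then show ?thesis
    proof cases
      case 3
      then have "?q ! i = p ! (l + (i - k))" "?q ! Suc i = p ! Suc (l + (i - k))"
        using kl by (auto simp: nth_append min_def Suc_diff_le)
      then show ?thesis using step[of "l + (i - k)"] 3 i kl by auto
    qed (use kl junction step[of i] in \<open>auto simp: nth_append min_def\<close>)
  qed
  then show ?thesis using w kl hd by (auto simp: walk_def)
qed

text \<open>Take a walk of minimal length inside \<open>Q\<close>: a repeated vertex or an edge that
  skips positions would allow a shorter one. For symmetric \<open>E\<close> the result is an induced
  path, the form needed to exhibit chordless cycles.\<close>

lemma shortest_walk:
  assumes "walk E p0 s t" "set p0 \<subseteq> Q"
  obtains p where "walk E p s t" "set p \<subseteq> Q" "distinct p"
    "\<And>k l. Suc k < l \<Longrightarrow> l < length p \<Longrightarrow> (p ! k, p ! l) \<notin> E"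
proof -
  define P where "P = (\<lambda>p. walk E p s t \<and> set p \<subseteq> Q)"
  obtain p where p: "P p" and min: "\<And>q. P q \<Longrightarrow> length p \<le> length q"
    using ex_has_least_nat[of P p0 length] assms unfolding P_def by blast
  have sub: "set (take k p @ drop l p) \<subseteq> Q" for k l
    using p set_take_subset[of k p] set_drop_subset[of l p] unfolding P_def by auto
  have w: "walk E p s t" and edge: "\<And>i. Suc i < length p \<Longrightarrow> (p ! i, p ! Suc i) \<in> E"
    using p by (auto simp: P_def walk_def)
  have ne: "p \<noteq> []" and hd: "hd p = s" using w by (auto simp: walk_def)
  have "p ! k \<noteq> p ! l" if kl: "k < l" "l < length p" for k l
  proof
    assume eq: "p ! k = p ! l"
    have "hd (take k p @ drop l p) = s"
      using eq kl hd ne by (cases "k = 0") (simp_all add: hd_append hd_drop_conv_nth hd_conv_nth)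
    moreover have "(p ! (k - 1), p ! l) \<in> E" if "0 < k"
      using edge[of "k - 1"] eq that kl by simp
    ultimately have "walk E (take k p @ drop l p) s t"
      by (intro walk_splice[OF w]) (use kl in auto)
    then have "P (take k p @ drop l p)" using sub by (simp add: P_def)
    from min[OF this] kl show False by simp
  qed
  then have "distinct p"
    by (metis distinct_conv_nth linorder_neqE_nat)
  moreover have "(p ! k, p ! l) \<notin> E" if kl: "Suc k < l" "l < length p" for k l
  proof
    assume e: "(p ! k, p ! l) \<in> E"
    have "hd (take (Suc k) p @ drop l p) = s" using hd ne by (simp add: hd_append)
    then have "walk E (take (Suc k) p @ drop l p) s t"
      by (intro walk_splice[OF w]) (use kl e in auto)
    then have "P (take (Suc k) p @ drop l p)" using sub by (simp add: P_def)
    from min[OF this] kl show False by simp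
  qed
  ultimately show ?thesis using that p unfolding P_def by blast
qed

text \<open>If \<open>s\<close> and \<open>t\<close> were not adjacent, a shortest walk between them
  through \<open>C\<close>, closed up by \<open>x\<close>, would be a cycle of length at least 4. A
  chord would either shorten the walk or join \<open>x\<close> to an interior vertex, which lies in
  \<open>C\<close> and is no neighbour of \<open>x\<close>.\<close>

lemma chordal_common_neighbours:
  assumes ch: "chordal E" and sym: "sym E" and irr: "irrefl E"
    and xs: "(x, s) \<in> E" and xt: "(x, t) \<in> E" and st: "s \<noteq> t"
    and C: "\<forall>c\<in>C. (x, c) \<notin> E" "x \<notin> C"
    and w: "walk E p0 s t" "set p0 \<subseteq> C \<union> {s, t}"
  shows "(s, t) \<in> E"
proof (rule ccontr)
  assume nst: "(s, t) \<notin> E"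
  from shortest_walk[OF w] obtain p where p: "walk E p s t" "set p \<subseteq> C \<union> {s, t}" "distinct p"
    and noch: "\<And>k l. Suc k < l \<Longrightarrow> l < length p \<Longrightarrow> (p ! k, p ! l) \<notin> E" by blast
  have ne: "p \<noteq> []" and p0: "p ! 0 = s" and pl: "p ! (length p - 1) = t"
    using p(1) by (auto simp: walk_def hd_conv_nth last_conv_nth)
  have len: "3 \<le> length p"
  proof (rule ccontr)
    assume "\<not> 3 \<le> length p"
    with ne consider "length p = 1" | "length p = 2"
      by (cases p; cases "tl p"; cases "tl (tl p)") auto
    then show False
    proof cases
      case 2
      then have "(p ! 0, p ! 1) \<in> E" using p(1) by (simp add: walk_def)
      then show False using p0 pl 2 nst by simp
    qed (use p0 pl st in auto)
  qed
  have int: "(x, p ! k) \<notin> E" if "0 < k" "k < length p - 1" for k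
  proof -
    have "p ! k \<noteq> p ! 0" "p ! k \<noteq> p ! (length p - 1)"
      using that ne nth_eq_iff_index_eq[OF p(3), of k 0] nth_eq_iff_index_eq[OF p(3), of k "length p - 1"]
      by auto
    moreover have "p ! k \<in> set p" using that by auto
    ultimately show ?thesis using p(2) p0 pl C by auto
  qed
  have xne: "x \<notin> set p"
    using p(2) C xs xt irr by (auto simp: irrefl_def)
  let ?c = "x # p"
  have "is_cycle E ?c"
    unfolding is_cycle_def
  proof (intro conjI allI impI)
    fix k assume k: "k < length ?c"
    show "(?c ! k, ?c ! (Suc k mod length ?c)) \<in> E"
    proof (cases "k = length p")
      case True
      then have "?c ! k = t" "?c ! (Suc k mod length ?c) = x"
        using pl ne by (simp_all add: nth_Cons')
      then show ?thesis using symD[OF sym xt] by simp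
    next
      case False
      then have "Suc k mod length ?c = Suc k" using k by simp
      then show ?thesis using k p(1) False xs p0 by (cases k) (auto simp: walk_def)
    qed
  qed (use len xne p(3) in auto)
  then have "has_chord E ?c" using ch len unfolding chordal_def by auto
  moreover have "False" if kl: "k < l" "l < length ?c" and e: "(?c ! k, ?c ! l) \<in> E"
    and n: "l \<noteq> Suc k mod length ?c" "k \<noteq> Suc l mod length ?c" for k l
  proof -
    have l: "l \<noteq> Suc k" using n(1) kl by auto
    obtain l' where l': "l = Suc l'" using kl by (cases l) auto
    show False
    proof (cases k)
      case 0
      have "l \<noteq> length p" using n(2) 0 by auto
      then have "l' < length p - 1" using kl l' by simp
      then show False using int[of l'] e l l' kl 0 by auto
    next
      case (Suc k')
      then show False using noch[of k' l'] e l l' kl by auto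
    qed
  qed
  ultimately show False
    unfolding has_chord_def using sym by (metis linorder_neqE_nat symD)
qed

lemma rtrancl_walk:
  assumes "(a, b) \<in> (E \<inter> C \<times> C)\<^sup>*" "a \<in> C"
  shows "\<exists>p. walk E p a b \<and> set p \<subseteq> C"
  using assms
proof (induction rule: rtrancl_induct)
  case base
  then show ?case by (intro exI[of _ "[a]"]) (auto simp: walk_def)
next
  case (step y z)
  then obtain p where p: "walk E p a y" "set p \<subseteq> C" by auto
  have "walk E (p @ [z]) a z"
    unfolding walk_def
  proof (intro conjI allI impI)
    fix k assume "Suc k < length (p @ [z])"
    then consider "Suc k < length p" | "Suc k = length p" by fastforce
    then show "((p @ [z]) ! k, (p @ [z]) ! Suc k) \<in> E"
    proof cases
      case 2
      then have "p ! k = y" using p(1) by (metis diff_Suc_1 last_conv_nth walk_def)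
      then show ?thesis using step 2 by (auto simp: nth_append)
    qed (use p(1) in \<open>auto simp: nth_append walk_def\<close>)
  qed (use p(1) in \<open>auto simp: walk_def\<close>)
  then show ?case using p step by (intro exI[of _ "p @ [z]"]) auto
qed

text \<open>Dirac's argument: the neighbourhood \<open>S\<close> of a component \<open>C\<close> of the non-neighbours of \<open>x\<close> is
  a clique, so a simplicial vertex of \<open>C \<union> S\<close> lying in \<open>C\<close> is simplicial in the whole graph.\<close>

lemma simplicial_nonneighbour:
  assumes ch: "chordal E" and sym: "sym E" and irr: "irrefl E"
    and fin: "finite W" and x: "x \<in> W" and y: "y \<in> W" "y \<noteq> x" "(x, y) \<notin> E"
  shows "\<exists>v. simplicial E W v \<and> v \<noteq> x \<and> (x, v) \<notin> E"
  using fin x y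
proof (induction W arbitrary: x y rule: finite_psubset_induct)
  case (psubset W)
  \<comment> \<open>The induction hypothesis speaks of nonadjacent pairs only; complete subgraphs,
    where every vertex is simplicial, are added here.\<close>
  have ex: "\<exists>v. simplicial E U v" if U: "U \<subset> W" "U \<noteq> {}" for U
  proof (cases "clique U E U")
    case True
    then show ?thesis using U by (auto simp: simplicial_def clique_def)
  next
    case False
    then obtain a b where "a \<in> U" "b \<in> U" "a \<noteq> b" "(a, b) \<notin> E" by (auto simp: clique_def)
    then show ?thesis using psubset.IH[OF U(1), of a b] by blast
  qed
  define Q where "Q = {z \<in> W. z \<noteq> x \<and> (x, z) \<notin> E}"
  define C where "C = {z. (y, z) \<in> (E \<inter> Q \<times> Q)\<^sup>*}"
  define S where "S = {s \<in> W - C. \<exists>c\<in>C. (c, s) \<in> E}"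
  have yQ: "y \<in> Q" using psubset.prems by (simp add: Q_def)
  have CQ: "C \<subseteq> Q"
  proof
    fix z assume "z \<in> C"
    then have "(y, z) \<in> (E \<inter> Q \<times> Q)\<^sup>*" by (simp add: C_def)
    then show "z \<in> Q" by (cases rule: rtranclE) (use yQ in auto)
  qed
  have yC: "y \<in> C" by (simp add: C_def)
  have closed: "z \<in> C" if "c \<in> C" "(c, z) \<in> E" "z \<in> Q" for c z
    using that CQ unfolding C_def by (auto intro: rtrancl_into_rtrancl)
  have Sx: "(x, s) \<in> E" if "s \<in> S" for s
  proof -
    obtain c where c: "c \<in> C" "(c, s) \<in> E" using \<open>s \<in> S\<close> by (auto simp: S_def)
    have "s \<noteq> x" using c CQ sym by (auto simp: Q_def dest: symD)
    then show ?thesis using closed[OF c] \<open>s \<in> S\<close> by (auto simp: S_def Q_def)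
  qed
  have symR: "sym ((E \<inter> Q \<times> Q)\<^sup>*)"
    using sym by (intro sym_rtrancl) (auto simp: sym_def)
  have Srel: "(a, b) \<in> (E \<inter> (C \<union> {s, t}) \<times> (C \<union> {s, t}))\<^sup>*" if "(a, b) \<in> (E \<inter> Q \<times> Q)\<^sup>*" "a \<in> C" for a b s t
    using that
  proof (induction rule: rtrancl_induct)
    case (step u v)
    have "u \<in> C" using step by (auto simp: C_def)
    moreover have "v \<in> C" using closed[of u v] step \<open>u \<in> C\<close> by auto
    ultimately show ?case using step by (auto intro: rtrancl_into_rtrancl)
  qed simp
  have Sclique: "(s, t) \<in> E" if s: "s \<in> S" and t: "t \<in> S" and st: "s \<noteq> t" for s t
  proof -
    obtain c d where c: "c \<in> C" "(c, s) \<in> E" and d: "d \<in> C" "(d, t) \<in> E"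
      using s t by (auto simp: S_def)
    let ?R = "E \<inter> (C \<union> {s, t}) \<times> (C \<union> {s, t})"
    have "(c, d) \<in> (E \<inter> Q \<times> Q)\<^sup>*"
      using c(1) d(1) symR unfolding C_def by (metis mem_Collect_eq rtrancl_trans symD)
    then have "(c, d) \<in> ?R\<^sup>*" using Srel c by blast
    moreover have "(s, c) \<in> ?R" "(d, t) \<in> ?R" using c d sym by (auto dest: symD)
    ultimately have "(s, t) \<in> ?R\<^sup>*" by (meson converse_rtrancl_into_rtrancl rtrancl.rtrancl_into_rtrancl)
    then obtain p where "walk E p s t" "set p \<subseteq> C \<union> {s, t}"
      using rtrancl_walk[of s t E "C \<union> {s, t}"] by blast
    then show ?thesis
      using chordal_common_neighbours[OF ch sym irr Sx[OF s] Sx[OF t] st, of C p] CQ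
      by (auto simp: Q_def)
  qed
  have xCS: "x \<notin> C \<union> S" using CQ Sx irr by (auto simp: Q_def irrefl_def)
  have sub: "C \<union> S \<subset> W" using CQ xCS psubset.prems by (auto simp: Q_def S_def)
  have nb: "z \<in> C \<union> S" if "c \<in> C" "(c, z) \<in> E" "z \<in> W" for c z
    using that by (auto simp: S_def)
  \<comment> \<open>If some \<open>s \<in> S\<close> misses a vertex of \<open>C \<union> S\<close>,
    the induction hypothesis is applied with \<open>s\<close> in the role of \<open>x\<close>: the
    vertex found is not adjacent to \<open>s\<close>, so it lies outside the clique
    \<open>S\<close>. Otherwise \<open>S\<close> is joined completely to \<open>C\<close>, and a
    simplicial vertex of \<open>C\<close> stays simplicial in \<open>C \<union> S\<close>.\<close>
  have "\<exists>v\<in>C. simplicial E (C \<union> S) v"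
  proof (cases "\<exists>s\<in>S. \<exists>z\<in>C \<union> S. z \<noteq> s \<and> (s, z) \<notin> E")
    case True
    then obtain s z where "s \<in> S" "z \<in> C \<union> S" "z \<noteq> s" "(s, z) \<notin> E" by blast
    then obtain v where "simplicial E (C \<union> S) v" "v \<noteq> s" "(s, v) \<notin> E"
      using psubset.IH[OF sub, of s z] by auto
    then show ?thesis using Sclique[OF \<open>s \<in> S\<close>, of v] by (auto simp: simplicial_def)
  next
    case False
    have "C \<subset> W" using sub by auto
    then obtain v where v: "simplicial E C v" using ex[of C] yC by auto
    have "simplicial E (C \<union> S) v"
      using v False Sclique sym unfolding simplicial_def clique_def
      by (auto 5 0 dest: symD) (metis UnCI symD)+
    then show ?thesis using v by (auto simp: simplicial_def)
  qed
  then obtain v where v: "v \<in> C" "simplicial E (C \<union> S) v" by blast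
  \<comment> \<open>\<open>S\<close> collects all neighbours of \<open>C\<close> outside
    \<open>C\<close>, so no neighbour of \<open>v\<close> is lost.\<close>
  have "{z \<in> W. (v, z) \<in> E} = {z \<in> C \<union> S. (v, z) \<in> E}"
    using nb[OF v(1)] sub by auto
  then have "clique W E {z \<in> W. (v, z) \<in> E}"
    using v(2) by (auto simp: simplicial_def clique_def)
  moreover have "v \<in> W" "v \<noteq> x" "(x, v) \<notin> E" using v(1) CQ by (auto simp: Q_def)
  ultimately show ?case by (auto simp: simplicial_def)
qed

lemma chordal_has_simplicial:
  assumes "chordal E" "sym E" "irrefl E" "finite W" "W \<noteq> {}"
  obtains v where "simplicial E W v"
proof (cases "clique W E W")
  case True
  then show ?thesis using assms that by (auto simp: simplicial_def clique_def)
next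
  case False
  then obtain a b where "a \<in> W" "b \<in> W" "a \<noteq> b" "(a, b) \<notin> E" by (auto simp: clique_def)
  then show ?thesis using simplicial_nonneighbour[OF assms(1-4), of a b] that by blast
qed

subsection \<open>Connecting tables by moves of degree two\<close>

text \<open>A table is regarded as the multiset of its cells. Equality of the marginals for all cliques is
  the same as equality for all generators, but it is inherited by induced subgraphs.\<close>

abbreviation restr :: "nat set \<Rightarrow> cell multiset \<Rightarrow> cell multiset"
  where "restr C \<equiv> image_mset (\<lambda>i. restrict i C)"

definition same_margins :: "nat set set \<Rightarrow> cell multiset \<Rightarrow> cell multiset \<Rightarrow> bool"
  where "same_margins K X Y \<longleftrightarrow> (\<forall>C\<in>K. restr C X = restr C Y)"

definition cliques :: "nat set \<Rightarrow> nat rel \<Rightarrow> nat set set"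
  where "cliques W E = {C. clique W E C}"

text \<open>Only extensionality is demanded of the new cells. When \<open>K\<close> contains the
  singletons, equality of marginals confines the new cells to levels already present, so bounds on
  the levels can be recovered afterwards.\<close>

definition deg2_step :: "nat set set \<Rightarrow> nat set \<Rightarrow> cell multiset \<Rightarrow> cell multiset \<Rightarrow> bool"
  where "deg2_step K W X Y \<longleftrightarrow> (\<exists>R i j i' j'. X = R + {#i, j#} \<and> Y = R + {#i', j'#} \<and>
    {i', j'} \<subseteq> extensional W \<and> same_margins K {#i, j#} {#i', j'#})"

lemma same_margins_refl [simp]: "same_margins K X X"
  by (simp add: same_margins_def)

lemma same_margins_sym: "same_margins K X Y \<Longrightarrow> same_margins K Y X"
  by (simp add: same_margins_def)

lemma same_margins_trans: "same_margins K X Y \<Longrightarrow> same_margins K Y Z \<Longrightarrow> same_margins K X Z"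
  by (simp add: same_margins_def)

lemma same_margins_add_left [simp]: "same_margins K (R + X) (R + Y) \<longleftrightarrow> same_margins K X Y"
  by (simp add: same_margins_def)

lemma same_margins_add_mset [simp]:
  "same_margins K (add_mset x X) (add_mset x Y) \<longleftrightarrow> same_margins K X Y"
  by (simp add: same_margins_def)

lemma restr_restr: "C \<subseteq> U \<Longrightarrow> restr C (restr U X) = restr C X"
  by (simp add: multiset.map_comp comp_def Int_absorb1)

lemma restrict_ext: "i \<in> extensional W \<Longrightarrow> restrict i W = i"
  by (rule extensional_restrict)

lemma deg2_step_same_margins: "deg2_step K W X Y \<Longrightarrow> same_margins K X Y"
  unfolding deg2_step_def by (elim exE conjE) (simp del: union_mset_add_mset_right)

lemma deg2_steps_same_margins: "(deg2_step K W)\<^sup>*\<^sup>* X Y \<Longrightarrow> same_margins K X Y"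
  by (induction rule: rtranclp_induct) (auto intro: same_margins_trans deg2_step_same_margins)

lemma deg2_step_extensional:
  "deg2_step K W X Y \<Longrightarrow> set_mset X \<subseteq> extensional W \<Longrightarrow> set_mset Y \<subseteq> extensional W"
  by (auto simp: deg2_step_def)

lemma deg2_steps_extensional:
  "(deg2_step K W)\<^sup>*\<^sup>* X Y \<Longrightarrow> set_mset X \<subseteq> extensional W \<Longrightarrow> set_mset Y \<subseteq> extensional W"
  by (induction rule: rtranclp_induct) (auto dest: deg2_step_extensional)

lemma deg2_step_add_mset: "deg2_step K W X Y \<Longrightarrow> deg2_step K W (add_mset x X) (add_mset x Y)"
  unfolding deg2_step_def
proof (elim exE conjE)
  fix R i j i' j'
  assume "X = R + {#i, j#}" "Y = R + {#i', j'#}" "{i', j'} \<subseteq> extensional W"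
    "same_margins K {#i, j#} {#i', j'#}"
  then show "\<exists>R i j i' j'. add_mset x X = R + {#i, j#} \<and> add_mset x Y = R + {#i', j'#} \<and>
    {i', j'} \<subseteq> extensional W \<and> same_margins K {#i, j#} {#i', j'#}"
    by (intro exI[of _ "add_mset x R"] exI[of _ i] exI[of _ j] exI[of _ i'] exI[of _ j']) simp
qed

lemma deg2_steps_add_mset:
  "(deg2_step K W)\<^sup>*\<^sup>* X Y \<Longrightarrow> (deg2_step K W)\<^sup>*\<^sup>* (add_mset x X) (add_mset x Y)"
  by (induction rule: rtranclp_induct) (auto intro: deg2_step_add_mset rtranclp.rtrancl_into_rtrancl)

lemma pair_mset_eq: "{#a, b#} = {#c, d#} \<longleftrightarrow> a = c \<and> b = d \<or> a = d \<and> b = c"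
  by (auto simp: add_eq_conv_ex)

lemma restrict_eq_iff: "restrict f A = restrict g A \<longleftrightarrow> (\<forall>x\<in>A. f x = g x)"
  by (auto simp: restrict_def fun_eq_iff)

lemma image_mset_eq_add_msetE:
  assumes "image_mset f X = add_mset z R"
  obtains x where "x \<in># X" "f x = z"
proof -
  from msed_map_invR[OF assms] obtain X1 x where "X = add_mset x X1" "f x = z" by blast
  then show ?thesis using that[of x] by simp
qed

section \<open>Removing a simplicial vertex: lifting moves and exchanging levels\<close>

context
  fixes E :: "nat rel" and W U N :: "nat set" and \<delta> :: nat
  assumes W: "W = insert \<delta> U" and \<delta>: "\<delta> \<notin> U"
    and N: "N = {x \<in> U. (\<delta>, x) \<in> E}" and Nclique: "clique U E N" and symE: "sym E"
begin

text \<open>All neighbours of \<open>\<delta>\<close> lie in \<open>N\<close>, so the cliques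
  through \<open>\<delta>\<close> are confined to one set. Marginals over \<open>W\<close> thus
  reduce to those over \<open>U\<close> and those inside \<open>insert \<delta> N\<close>.\<close>

lemma clique_cases:
  assumes "clique W E C"
  obtains "\<delta> \<notin> C" "clique U E C" | "\<delta> \<in> C" "C \<subseteq> insert \<delta> N"
proof (cases "\<delta> \<in> C")
  case True
  then have "C \<subseteq> insert \<delta> N" using assms by (auto simp: clique_def W N)
  then show ?thesis using that(2) True by blast
next
  case False
  then have "clique U E C" using assms by (auto simp: clique_def W)
  then show ?thesis using that(1) False by blast
qed

lemma insert_clique: "clique W E (insert \<delta> N)"
  using Nclique symE unfolding clique_def W N by (auto dest: symD)

text \<open>Each new cell inherits the level of \<open>\<delta>\<close> from the old cell with the
  same restriction to \<open>N\<close>. Cliques through \<open>\<delta>\<close> therefore see no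
  change in either cell, while the other cliques see the given move on \<open>U\<close>.\<close>

lemma lift_pair:
  assumes i: "{i, j} \<subseteq> extensional W" and i': "{i', j'} \<subseteq> extensional U"
    and eq: "same_margins (cliques U E) {#i, j#} {#i', j'#}"
    and N1: "restrict i N = restrict i' N" and N2: "restrict j N = restrict j' N"
  shows "same_margins (cliques W E) {#i, j#} {#i'(\<delta> := i \<delta>), j'(\<delta> := j \<delta>)#}"
  unfolding same_margins_def
proof
  fix C assume "C \<in> cliques W E"
  then have "clique W E C" by (simp add: cliques_def)
  then show "restr C {#i, j#} = restr C {#i'(\<delta> := i \<delta>), j'(\<delta> := j \<delta>)#}"
  proof (cases rule: clique_cases)
    case 1
    then have "restrict (i'(\<delta> := i \<delta>)) C = restrict i' C" "restrict (j'(\<delta> := j \<delta>)) C = restrict j' C"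
      by (auto simp: restrict_eq_iff)
    moreover have "restr C {#i, j#} = restr C {#i', j'#}"
      using eq 1 by (auto simp: same_margins_def cliques_def)
    ultimately show ?thesis by simp
  next
    case 2
    then have "restrict (i'(\<delta> := i \<delta>)) C = restrict i C" "restrict (j'(\<delta> := j \<delta>)) C = restrict j C"
      using N1 N2 \<delta> by (auto simp: restrict_eq_iff)
    then show ?thesis by simp
  qed
qed

text \<open>Because \<open>N\<close> is a clique, the old and the new pair agree on \<open>N\<close>
  as multisets. The new cells can thus be named in an order in which they match the old ones on
  \<open>N\<close> one by one, and \<open>lift_pair\<close> applies.\<close>

lemma lift_step:
  assumes X: "set_mset X \<subseteq> extensional W" and st: "deg2_step (cliques U E) U (restr U X) Z"
  shows "\<exists>X'. deg2_step (cliques W E) W X X' \<and> restr U X' = Z"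
proof -
  from st obtain R i j i' j' where RX: "restr U X = R + {#i, j#}" and Z: "Z = R + {#i', j'#}"
    and ext: "{i', j'} \<subseteq> extensional U" and eq: "same_margins (cliques U E) {#i, j#} {#i', j'#}"
    unfolding deg2_step_def by blast
  from image_mset_eq_plusD[OF RX] obtain R0 P where P: "X = R0 + P" "R = restr U R0" "{#i, j#} = restr U P"
    by blast
  from P(3) obtain i0 j0 where ij: "P = {#i0, j0#}" "i = restrict i0 U" "j = restrict j0 U"
    using msed_map_invR[of "\<lambda>i. restrict i U" P i "{#j#}"]
    by (auto dest!: msed_map_invR)
  have sub: "clique U E C \<Longrightarrow> C \<subseteq> U" for C by (simp add: clique_def)
  have ext0: "{i0, j0} \<subseteq> extensional W" using X P ij by auto
  have eq0: "same_margins (cliques U E) {#i0, j0#} {#i', j'#}"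
    unfolding same_margins_def
  proof
    fix C assume C: "C \<in> cliques U E"
    then have "restr C {#i, j#} = restr C {#i', j'#}" "C \<subseteq> U"
      using eq sub by (auto simp: same_margins_def cliques_def)
    then show "restr C {#i0, j0#} = restr C {#i', j'#}"
      using restr_restr[of C U "{#i0, j0#}"] ij by simp
  qed
  have "restr N {#i0, j0#} = restr N {#i', j'#}"
    using eq0 Nclique by (auto simp: same_margins_def cliques_def)
  then obtain k l where kl: "{#k, l#} = {#i', j'#}" "restrict i0 N = restrict k N" "restrict j0 N = restrict l N"
    by (auto simp: pair_mset_eq add_mset_commute)
  have extk: "{k, l} \<subseteq> extensional U" using ext kl(1) by (auto simp: pair_mset_eq)
  have eqk: "same_margins (cliques W E) {#i0, j0#} {#k(\<delta> := i0 \<delta>), l(\<delta> := j0 \<delta>)#}"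
    using lift_pair[OF ext0 extk _ kl(2,3)] eq0 kl(1) by simp
  let ?X = "R0 + {#k(\<delta> := i0 \<delta>), l(\<delta> := j0 \<delta>)#}"
  have "{k(\<delta> := i0 \<delta>), l(\<delta> := j0 \<delta>)} \<subseteq> extensional W"
    using extk by (auto simp: W extensional_def)
  then have "deg2_step (cliques W E) W X ?X"
    unfolding deg2_step_def using P(1) ij(1) eqk by blast
  moreover have "restrict (k(\<delta> := a)) U = k" "restrict (l(\<delta> := a)) U = l" for a
    using extk \<delta> by (auto simp: restrict_def extensional_def fun_eq_iff)
  then have "restr U ?X = R + {#k, l#}" using P(2) by simp
  then have "restr U ?X = Z" using Z kl(1) by (simp only:)
  ultimately show ?thesis by blast
qed

lemma lift_steps:
  assumes "set_mset X \<subseteq> extensional W" and "(deg2_step (cliques U E) U)\<^sup>*\<^sup>* (restr U X) Z"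
  shows "\<exists>X'. (deg2_step (cliques W E) W)\<^sup>*\<^sup>* X X' \<and> restr U X' = Z"
  using assms(2)
proof (induction rule: rtranclp_induct)
  case (step Y Z)
  then obtain X' where X': "(deg2_step (cliques W E) W)\<^sup>*\<^sup>* X X'" "restr U X' = Y" by blast
  then show ?case
    using lift_step[of X' Z] deg2_steps_extensional[OF X'(1) assms(1)] step
    by (metis rtranclp.rtrancl_into_rtrancl)
qed (blast intro: rtranclp.rtrancl_refl)

text \<open>Once the marginals on \<open>U\<close> agree, exchanging the level of \<open>\<delta>\<close> between two cells that agree on
  \<open>N\<close> creates a prescribed cell of the target.\<close>

lemma exchange:
  assumes "set_mset X \<subseteq> extensional W" "set_mset Y \<subseteq> extensional W"
    and "same_margins (cliques W E) X Y" "restr U X = restr U Y"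
  shows "(deg2_step (cliques W E) W)\<^sup>*\<^sup>* X Y"
  using assms
proof (induction "size Y" arbitrary: X Y)
  case 0
  then have "Y = {#}" by simp
  moreover from this 0(5) have "X = {#}" by simp
  ultimately show ?case by simp
next
  case (Suc n Y X)
  obtain y Y0 where Y: "Y = add_mset y Y0" using Suc.hyps(2) by (cases Y) auto
  \<comment> \<open>The target cell \<open>y\<close> is found in \<open>X\<close> in two pieces:
    \<open>x\<close> has its levels on \<open>U\<close>, and \<open>x'\<close> its levels on
    \<open>\<delta>\<close> and \<open>N\<close>, the latter because
    \<open>insert \<delta> N\<close> is a clique.\<close>
  have "restr U X = add_mset (restrict y U) (restr U Y0)"
    using Suc.prems(4) Y by simp
  then obtain x where x: "x \<in># X" "restrict x U = restrict y U"
    by (rule image_mset_eq_add_msetE)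
  have "restr (insert \<delta> N) X = add_mset (restrict y (insert \<delta> N)) (restr (insert \<delta> N) Y0)"
    using Suc.prems(3) insert_clique Y by (auto simp: same_margins_def cliques_def)
  then obtain x' where x': "x' \<in># X" "restrict x' (insert \<delta> N) = restrict y (insert \<delta> N)"
    by (rule image_mset_eq_add_msetE)
  have NU: "N \<subseteq> U" using N by auto
  have ye: "y \<in> extensional W" using Suc.prems(2) Y by auto
  have xe: "x \<in> extensional W" "x' \<in> extensional W" using Suc.prems(1) x x' by auto
  have y_eq: "y = x(\<delta> := x' \<delta>)"
  proof
    fix z show "y z = (x(\<delta> := x' \<delta>)) z"
      using x(2) x'(2) ye xe W by (cases "z \<in> W") (auto simp: restrict_eq_iff extensional_def)
  qed
  obtain X1 where X1: "(deg2_step (cliques W E) W)\<^sup>*\<^sup>* X (add_mset y X1)" "restr U (add_mset y X1) = restr U X"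
  proof (cases "x' = x")
    case True
    then have "y = x" using y_eq by simp
    then show ?thesis using that[of "X - {#x#}"] x(1) by simp
  next
    case False
    obtain X0 where X0: "X = add_mset x X0" using x(1) by (rule mset_add)
    with False x'(1) have "x' \<in># X0" by simp
    then obtain R where "X0 = add_mset x' R" by (rule mset_add)
    with X0 have R: "X = R + {#x, x'#}" by simp
    let ?x = "x'(\<delta> := x \<delta>)"
    have "same_margins (cliques W E) {#x, x'#} {#y, ?x#}"
      unfolding same_margins_def
    proof
      fix C assume "C \<in> cliques W E"
      then have "clique W E C" by (simp add: cliques_def)
      then show "restr C {#x, x'#} = restr C {#y, ?x#}"
      proof (cases rule: clique_cases)
        case 1
        then have "restrict y C = restrict x C" "restrict ?x C = restrict x' C"
          using y_eq by (auto simp: restrict_eq_iff)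
        then show ?thesis by simp
      next
        case 2
        \<comment> \<open>Both cells agree with \<open>y\<close> on \<open>N\<close>. Seen within
          \<open>insert \<delta> N\<close>, exchanging the levels of \<open>\<delta>\<close>
          therefore only swaps the two cells.\<close>
        have "\<forall>z\<in>N. x z = x' z" using x(2) x'(2) NU by (auto simp: restrict_eq_iff)
        then have "restrict y C = restrict x' C" "restrict ?x C = restrict x C"
          using 2 y_eq by (auto simp: restrict_eq_iff)
        then show ?thesis by simp
      qed
    qed
    moreover have "{y, ?x} \<subseteq> extensional W" using ye xe by (auto simp: W extensional_def)
    ultimately have "deg2_step (cliques W E) W X (R + {#y, ?x#})"
      unfolding deg2_step_def using R by blast
    moreover have "restrict y U = restrict x U" "restrict ?x U = restrict x' U"
      using y_eq \<delta> by (auto simp: restrict_eq_iff)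
    then have "restr U (R + {#y, ?x#}) = restr U X" using R by simp
    ultimately show ?thesis using that[of "add_mset ?x R"] by auto
  qed
  \<comment> \<open>Now \<open>y\<close> is cancelled on both sides. Equality of the marginals and
    of the parts on \<open>U\<close> survives, so the induction hypothesis connects the
    remainders.\<close>
  have "set_mset (add_mset y X1) \<subseteq> extensional W"
    using deg2_steps_extensional[OF X1(1)] Suc.prems(1) by simp
  moreover have "same_margins (cliques W E) (add_mset y X1) (add_mset y Y0)"
    using deg2_steps_same_margins[OF X1(1)] Suc.prems(3) Y by (metis same_margins_sym same_margins_trans)
  moreover have "restr U X1 = restr U Y0" using X1(2) Suc.prems(4) Y by simp
  ultimately have "(deg2_step (cliques W E) W)\<^sup>*\<^sup>* X1 Y0"
    using Suc.hyps Suc.prems(2) Y by (intro Suc.hyps(1)) auto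
  then show ?case using X1(1) deg2_steps_add_mset[of _ _ X1 Y0 y] Y by (metis rtranclp_trans)
qed

end

theorem chordal_deg2_connected:
  assumes "chordal E" "sym E" "irrefl E" "finite W"
    and "set_mset X \<subseteq> extensional W" "set_mset Y \<subseteq> extensional W" "same_margins (cliques W E) X Y"
  shows "(deg2_step (cliques W E) W)\<^sup>*\<^sup>* X Y"
  using assms(4-)
proof (induction W arbitrary: X Y rule: finite_psubset_induct)
  case (psubset W)
  show ?case
  proof (cases "W = {}")
    case True
    \<comment> \<open>The empty set is the only clique here, and for cells without variables the
      marginal on it is the table itself.\<close>
    then have "restr {} X = restr {} Y"
      using psubset.prems by (auto simp: same_margins_def cliques_def clique_def)
    moreover have "restr {} Z = Z" if "set_mset Z \<subseteq> extensional {}" for Z :: "cell multiset"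
    proof -
      have "restr {} Z = image_mset (\<lambda>i. i) Z"
        using that by (intro image_mset_cong restrict_ext) auto
      then show ?thesis by simp
    qed
    ultimately show ?thesis using psubset.prems True by simp
  next
    case False
    from chordal_has_simplicial[OF assms(1-3) psubset.hyps(1) False]
    obtain v where v: "simplicial E W v" .
    define U where "U = W - {v}"
    define N where "N = {x \<in> U. (v, x) \<in> E}"
    have WU: "W = insert v U" "v \<notin> U" using v by (auto simp: U_def simplicial_def)
    have "clique U E N"
      using v unfolding simplicial_def clique_def N_def U_def by auto
    note ctx = WU N_def this assms(2)
    have UW: "U \<subset> W" using WU by auto
    have cl: "cliques U E \<subseteq> cliques W E" using UW by (auto simp: cliques_def clique_def)
    have "same_margins (cliques U E) (restr U X) (restr U Y)"
      unfolding same_margins_def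
    proof
      fix C assume C: "C \<in> cliques U E"
      then have "C \<subseteq> U" by (simp add: cliques_def clique_def)
      then show "restr C (restr U X) = restr C (restr U Y)"
        using C cl psubset.prems(3) by (auto simp only: restr_restr same_margins_def)
    qed
    then have "(deg2_step (cliques U E) U)\<^sup>*\<^sup>* (restr U X) (restr U Y)"
      by (intro psubset.IH[OF UW]) auto
    from lift_steps[OF ctx psubset.prems(1) this]
    obtain X' where X': "(deg2_step (cliques W E) W)\<^sup>*\<^sup>* X X'" "restr U X' = restr U Y" by blast
    have "(deg2_step (cliques W E) W)\<^sup>*\<^sup>* X' Y"
      using deg2_steps_extensional[OF X'(1)] deg2_steps_same_margins[OF X'(1)] psubset.prems X'(2)
      by (intro exchange[OF ctx]) (auto intro: same_margins_trans same_margins_sym)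
    then show ?thesis using X'(1) by auto
  qed
qed

subsection \<open>Tables as multisets of cells\<close>

definition freq :: "cell multiset \<Rightarrow> arr"
  where "freq X = (\<lambda>i. int (count X i))"

lemma freq_inject [simp]: "freq X = freq Y \<longleftrightarrow> X = Y"
  by (auto simp: freq_def fun_eq_iff multiset_eq_iff)

lemma freq_union: "freq (X + Y) = freq X + freq Y"
  by (simp add: freq_def fun_eq_iff)

lemma two_cells_freq: "two_cells i j = freq {#i, j#}"
  by (rule ext) (auto simp: two_cells_def freq_def)

lemma up_to_sign_eq_iff: "up_to_sign x = up_to_sign y \<longleftrightarrow> x = y \<or> x = - y"
  by (auto simp: up_to_sign_def doubleton_eq_iff)

lemma up_to_sign_commute: "up_to_sign (x - y) = up_to_sign (y - x)"
  by (simp add: up_to_sign_eq_iff)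

text \<open>Disjointness turns \<open>X\<close> and \<open>Y\<close> into the positive and negative
  parts of the difference, which are determined by it. In this way a move gives back the tables it
  was formed from.\<close>

lemma freq_diff_inject:
  assumes "X \<inter># Y = {#}" "X' \<inter># Y' = {#}" and eq: "freq X - freq Y = freq X' - freq Y'"
  shows "X = X' \<and> Y = Y'"
proof -
  have "count X i = count X' i \<and> count Y i = count Y' i" for i
  proof -
    have "min (count X i) (count Y i) = 0" "min (count X' i) (count Y' i) = 0"
      using assms(1,2) by (metis count_empty count_inter_mset)+
    moreover have "int (count X i) - int (count Y i) = int (count X' i) - int (count Y' i)"
      using fun_cong[OF eq, of i] by (simp add: freq_def)
    ultimately show ?thesis by linarith
  qed
  then show ?thesis by (simp add: multiset_eq_iff)
qed

lemma finite_cells: "finite (cells m I)"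
  unfolding cells_def by (intro finite_PiE) auto

lemma tables_iff_freq: "n \<in> tables m I \<longleftrightarrow> (\<exists>X. set_mset X \<subseteq> cells m I \<and> n = freq X)"
proof
  assume n: "n \<in> tables m I"
  have "finite {i. 0 < nat (n i)}"
    by (rule finite_subset[OF _ finite_cells[of m I]]) (use n in \<open>auto simp: tables_def arrays_def\<close>)
  then have c: "count (Abs_multiset (\<lambda>i. nat (n i))) = (\<lambda>i. nat (n i))" by simp
  have "n = freq (Abs_multiset (\<lambda>i. nat (n i)))"
    using n c by (auto simp: freq_def tables_def)
  moreover have "i \<in> cells m I" if "i \<in># Abs_multiset (\<lambda>i. nat (n i))" for i
  proof -
    have "0 < nat (n i)" using that c by (metis count_greater_zero_iff)
    then show ?thesis using n by (auto simp: tables_def arrays_def)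
  qed
  ultimately show "\<exists>X. set_mset X \<subseteq> cells m I \<and> n = freq X" by blast
qed (auto simp: tables_def arrays_def freq_def not_in_iff subset_iff)

lemma marginal_freq:
  assumes "set_mset X \<subseteq> cells m I"
  shows "marginal m I D (freq X) k = int (count (restr D X) k)"
proof -
  have "marginal m I D (freq X) k = (\<Sum>i | i \<in># X \<and> restrict i D = k. int (count X i))"
    unfolding marginal_def freq_def
    by (rule sum.mono_neutral_right) (use assms finite_cells in \<open>auto simp: not_in_iff\<close>)
  also have "\<dots> = int (count (restr D X) k)"
    by (simp add: count_image_mset' eq_commute)
  finally show ?thesis .
qed

lemma margins_freq_eq_iff:
  assumes "set_mset X \<subseteq> cells m I" "set_mset Y \<subseteq> cells m I"
  shows "margins m I \<D> (freq X) = margins m I \<D> (freq Y) \<longleftrightarrow> same_margins \<D> X Y"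
proof
  assume eq: "margins m I \<D> (freq X) = margins m I \<D> (freq Y)"
  show "same_margins \<D> X Y"
    unfolding same_margins_def
  proof
    fix D assume D: "D \<in> \<D>"
    show "restr D X = restr D Y"
    proof (rule multiset_eqI)
      fix k
      have "marginal m I D (freq X) k = marginal m I D (freq Y) k"
        using fun_cong[OF fun_cong[OF eq, of D], of k] D by (simp add: margins_def)
      then show "count (restr D X) k = count (restr D Y) k"
        using assms by (simp add: marginal_freq)
    qed
  qed
next
  assume "same_margins \<D> X Y"
  then show "margins m I \<D> (freq X) = margins m I \<D> (freq Y)"
    using assms by (auto simp: margins_def fun_eq_iff marginal_freq same_margins_def)
qed

lemma fiber_freq_iff:
  assumes "set_mset X \<subseteq> cells m I"
  shows "n \<in> fiber m I \<D> (margins m I \<D> (freq X)) \<longleftrightarrow>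
    (\<exists>Y. set_mset Y \<subseteq> cells m I \<and> n = freq Y \<and> same_margins \<D> X Y)"
proof -
  have "margins m I \<D> (freq Y) = margins m I \<D> (freq X) \<longleftrightarrow> same_margins \<D> X Y"
    if "set_mset Y \<subseteq> cells m I" for Y
    using that assms margins_freq_eq_iff[of Y m I X \<D>] by (auto intro: same_margins_sym)
  then show ?thesis unfolding fiber_def by (auto simp: tables_iff_freq)
qed

lemma fiber_memE:
  assumes "n \<in> fiber m I \<D> b"
  obtains X where "set_mset X \<subseteq> cells m I" "n = freq X" "b = margins m I \<D> (freq X)"
  using assms by (auto simp: fiber_def tables_iff_freq)

lemma same_margins_subset:
  assumes "restr D X = restr D Y" "C \<subseteq> D"
  shows "restr C X = restr C Y"
  using assms by (metis restr_restr)

lemma restr_eq_size: "restr D X = restr D Y \<Longrightarrow> size X = size Y"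
  by (metis size_image_mset)

lemma sample_size_freq: "set_mset X \<subseteq> cells m I \<Longrightarrow> sample_size m I (freq X) = int (size X)"
  unfolding sample_size_def freq_def size_multiset_overloaded_eq of_nat_sum
  by (rule sum.mono_neutral_right) (auto simp: finite_cells not_in_iff)

subsection \<open>Level permutations\<close>

definition act_cell :: "nat \<Rightarrow> (nat \<Rightarrow> nat \<Rightarrow> nat) \<Rightarrow> cell \<Rightarrow> cell"
  where "act_cell m g i = (\<lambda>\<delta>\<in>vars m. g \<delta> (i \<delta>))"

abbreviation act_mset :: "nat \<Rightarrow> (nat \<Rightarrow> nat \<Rightarrow> nat) \<Rightarrow> cell multiset \<Rightarrow> cell multiset"
  where "act_mset m g \<equiv> image_mset (act_cell m g)"

text \<open>Elements of \<open>level_perms\<close> are extensional, hence the restriction to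
  \<open>vars m\<close>.\<close>

definition inv_perms :: "nat \<Rightarrow> (nat \<Rightarrow> nat \<Rightarrow> nat) \<Rightarrow> nat \<Rightarrow> nat \<Rightarrow> nat"
  where "inv_perms m g = (\<lambda>\<delta>\<in>vars m. inv (g \<delta>))"

definition comp_perms :: "nat \<Rightarrow> (nat \<Rightarrow> nat \<Rightarrow> nat) \<Rightarrow> (nat \<Rightarrow> nat \<Rightarrow> nat) \<Rightarrow> nat \<Rightarrow> nat \<Rightarrow> nat"
  where "comp_perms m g h = (\<lambda>\<delta>\<in>vars m. g \<delta> \<circ> h \<delta>)"

lemma level_permsD: "g \<in> level_perms m I \<Longrightarrow> \<delta> \<in> vars m \<Longrightarrow> g \<delta> permutes {..<I \<delta>}"
  by (auto simp: level_perms_def PiE_iff)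

lemma act_cell_in_cells: "g \<in> level_perms m I \<Longrightarrow> i \<in> cells m I \<Longrightarrow> act_cell m g i \<in> cells m I"
  by (auto simp: cells_def PiE_iff act_cell_def dest!: level_permsD simp: permutes_in_image[of _ "{..<_}", simplified])

lemma act_mset_in_cells:
  "g \<in> level_perms m I \<Longrightarrow> set_mset X \<subseteq> cells m I \<Longrightarrow> set_mset (act_mset m g X) \<subseteq> cells m I"
  using act_cell_in_cells by (fastforce simp: image_subset_iff)

lemma inv_perms_in: "g \<in> level_perms m I \<Longrightarrow> inv_perms m g \<in> level_perms m I"
  by (auto simp: level_perms_def inv_perms_def PiE_iff intro: permutes_inv)

lemma comp_perms_in:
  "g \<in> level_perms m I \<Longrightarrow> h \<in> level_perms m I \<Longrightarrow> comp_perms m g h \<in> level_perms m I"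
  by (auto simp: level_perms_def comp_perms_def PiE_iff intro: permutes_compose)

lemma act_cell_comp: "act_cell m (comp_perms m g h) i = act_cell m g (act_cell m h i)"
  by (auto simp: act_cell_def comp_perms_def fun_eq_iff)

lemma act_cell_inv:
  assumes "g \<in> level_perms m I" "i \<in> cells m I"
  shows "act_cell m (inv_perms m g) (act_cell m g i) = i" "act_cell m g (act_cell m (inv_perms m g) i) = i"
  using assms permutes_inverses[OF level_permsD[OF assms(1)]]
  by (auto simp: act_cell_def inv_perms_def fun_eq_iff cells_def PiE_iff extensional_def)

lemma act_mset_inv:
  assumes "g \<in> level_perms m I" "set_mset X \<subseteq> cells m I"
  shows "act_mset m (inv_perms m g) (act_mset m g X) = X" "act_mset m g (act_mset m (inv_perms m g) X) = X"
proof -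
  have "image_mset (\<lambda>i. act_cell m (inv_perms m g) (act_cell m g i)) X = image_mset (\<lambda>i. i) X"
    "image_mset (\<lambda>i. act_cell m g (act_cell m (inv_perms m g) i)) X = image_mset (\<lambda>i. i) X"
    using act_cell_inv[OF assms(1)] assms(2) by (intro image_mset_cong; blast)+
  then show "act_mset m (inv_perms m g) (act_mset m g X) = X"
    "act_mset m g (act_mset m (inv_perms m g) X) = X"
    by (simp_all add: multiset.map_comp comp_def)
qed

text \<open>\<open>act\<close> evaluates a table at the preimage of a cell; since \<open>g\<close>
  induces a bijection of the cells, this amounts to moving every cell of the multiset
  forward.\<close>

lemma act_freq:
  assumes g: "g \<in> level_perms m I" and X: "set_mset X \<subseteq> cells m I"
  shows "act m I g (freq X) = freq (act_mset m g X)"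
proof
  fix i
  show "act m I g (freq X) i = freq (act_mset m g X) i"
  proof (cases "i \<in> cells m I")
    case True
    have i: "(\<lambda>\<delta>\<in>vars m. inv (g \<delta>) (i \<delta>)) = act_cell m (inv_perms m g) i"
      by (auto simp: act_cell_def inv_perms_def)
    have "{y. y \<in># X \<and> i = act_cell m g y} = set_mset X \<inter> {act_cell m (inv_perms m g) i}"
      using act_cell_inv[OF g] X True by auto
    then have "count (act_mset m g X) i = count X (act_cell m (inv_perms m g) i)"
      unfolding count_image_mset' by (simp add: not_in_iff Int_insert_right)
    then show ?thesis using True unfolding act_def i by (simp add: freq_def)
  next
    case False
    then have "count (act_mset m g X) i = 0"
      using act_mset_in_cells[OF g X] by (meson count_eq_zero_iff subsetD)
    then show ?thesis using False by (simp add: act_def freq_def)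
  qed
qed

lemma act_diff: "act m I g (x - y) = act m I g x - act m I g y"
  by (auto simp: act_def)

lemma act_uminus: "act m I g (- x) = - act m I g x"
  by (auto simp: act_def)

lemma act_move_up_to_sign: "act_move m I g (up_to_sign z) = up_to_sign (act m I g z)"
  by (simp add: act_move_def up_to_sign_def act_uminus)

lemma act_move_freq:
  assumes "g \<in> level_perms m I" "set_mset X \<subseteq> cells m I" "set_mset Y \<subseteq> cells m I"
  shows "act_move m I g (up_to_sign (freq X - freq Y)) = up_to_sign (freq (act_mset m g X) - freq (act_mset m g Y))"
  using assms by (simp add: act_move_up_to_sign act_diff act_freq)

text \<open>Level permutations treat the variables separately, so the levels on \<open>C\<close>
  after the action depend only on the levels on \<open>C\<close> before it.\<close>

lemma restr_act_mset:
  assumes "C \<subseteq> vars m" and eq: "restr C X = restr C Y"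
  shows "restr C (act_mset m g X) = restr C (act_mset m g Y)"
proof -
  have "restrict (act_cell m g i) C = restrict (act_cell m g (restrict i C)) C" for i
    using assms(1) by (auto simp: act_cell_def restrict_def fun_eq_iff)
  then have "restr C (act_mset m g Z) = image_mset (\<lambda>i. restrict (act_cell m g i) C) (restr C Z)" for Z
    by (simp add: multiset.map_comp comp_def)
  then show ?thesis using eq by simp
qed

lemma restr_act_mset_iff:
  assumes "C \<subseteq> vars m" "g \<in> level_perms m I" "set_mset X \<subseteq> cells m I" "set_mset Y \<subseteq> cells m I"
  shows "restr C (act_mset m g X) = restr C (act_mset m g Y) \<longleftrightarrow> restr C X = restr C Y"
  using restr_act_mset[OF assms(1)] act_mset_inv(1)[OF assms(2)] assms(3,4) by metis

subsection \<open>The model and its fibers of degree two\<close>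

locale decomposable_model =
  fixes m :: nat and I :: "nat \<Rightarrow> nat" and \<D> :: "nat set set"
  assumes levels: "\<forall>\<delta>\<in>vars m. 2 \<le> I \<delta>"
    and decomp: "decomposable m \<D>"
begin

abbreviation "E \<equiv> indep_graph \<D>"
abbreviation "CL \<equiv> cells m I"
abbreviation "fib X \<equiv> margins m I \<D> (freq X)"
abbreviation "G \<equiv> level_perms m I"

lemma symE: "sym E" and irreflE: "irrefl E"
  by (auto simp: sym_def irrefl_def indep_graph_def)

lemma D_maximal: "\<D> = maximal_cliques (vars m) E" and chordalE: "chordal E"
  using decomp by (auto simp: decomposable_def)

lemma D_clique: "D \<in> \<D> \<Longrightarrow> clique (vars m) E D"
  using D_maximal by (auto simp: maximal_cliques_def)

lemma D_subset: "D \<in> \<D> \<Longrightarrow> D \<subseteq> vars m"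
  using D_clique by (simp add: clique_def)

lemma clique_in_generator:
  assumes "clique (vars m) E C"
  obtains D where "D \<in> \<D>" "C \<subseteq> D"
proof -
  let ?K = "{C'. clique (vars m) E C'}"
  have "finite ?K" by (rule finite_subset[of _ "Pow (vars m)"]) (auto simp: clique_def)
  from finite_has_maximal2[OF this, of C] assms
  obtain D where "clique (vars m) E D" "C \<subseteq> D" "\<forall>C'. clique (vars m) E C' \<and> D \<subseteq> C' \<longrightarrow> C' = D"
    by (metis mem_Collect_eq)
  then have "D \<in> maximal_cliques (vars m) E" by (simp add: maximal_cliques_def)
  then have "D \<in> \<D>" using D_maximal by blast
  then show ?thesis using that \<open>C \<subseteq> D\<close> by blast
qed

lemma restr_clique:
  assumes "same_margins \<D> X Y" "clique (vars m) E C"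
  shows "restr C X = restr C Y"
proof -
  obtain D where "D \<in> \<D>" "C \<subseteq> D" using assms(2) by (rule clique_in_generator)
  then show ?thesis using assms(1) same_margins_subset[of D] unfolding same_margins_def by blast
qed

lemma same_margins_cliques: "same_margins \<D> X Y \<longleftrightarrow> same_margins (cliques (vars m) E) X Y"
proof
  assume "same_margins \<D> X Y"
  then show "same_margins (cliques (vars m) E) X Y"
    unfolding same_margins_def[of "cliques _ _"] using restr_clique by (simp add: cliques_def)
next
  assume "same_margins (cliques (vars m) E) X Y"
  then show "same_margins \<D> X Y"
    using D_clique unfolding same_margins_def cliques_def by blast
qed

lemma clique_singleton: "\<delta> \<in> vars m \<Longrightarrow> clique (vars m) E {\<delta>}"
  by (simp add: clique_def)

lemma restr_image:
  assumes "restr C X = restr C Y" "\<And>i. h (restrict i C) = h i"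
  shows "image_mset h X = image_mset h Y"
proof -
  have "image_mset h Z = image_mset h (restr C Z)" for Z
    by (simp add: multiset.map_comp comp_def assms(2))
  then show ?thesis using assms(1) by metis
qed

lemma same_margins_level:
  assumes "same_margins \<D> X Y" "\<delta> \<in> vars m"
  shows "image_mset (\<lambda>i. i \<delta>) X = image_mset (\<lambda>i. i \<delta>) Y"
  by (rule restr_image[OF restr_clique[OF assms(1) clique_singleton[OF assms(2)]]]) simp

text \<open>The marginal on the empty clique records exactly the sample size.\<close>

lemma same_margins_size: "same_margins \<D> X Y \<Longrightarrow> size X = size Y"
  using restr_clique[of X Y "{}"] by (metis clique_def empty_iff empty_subsetI restr_eq_size)

text \<open>Singletons are cliques, so every level used in \<open>Y\<close> already occurs in
  \<open>X\<close>. This supplies the bounds that \<open>deg2_step\<close> leaves open.\<close>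

lemma same_margins_in_cells:
  assumes "same_margins \<D> X Y" "set_mset X \<subseteq> CL" "set_mset Y \<subseteq> extensional (vars m)"
  shows "set_mset Y \<subseteq> CL"
proof
  fix j assume j: "j \<in># Y"
  have "j \<delta> < I \<delta>" if "\<delta> \<in> vars m" for \<delta>
  proof -
    have "j \<delta> \<in># image_mset (\<lambda>i. i \<delta>) X"
      unfolding same_margins_level[OF assms(1) that] using j by simp
    then obtain i where i: "i \<in># X" "i \<delta> = j \<delta>" by auto
    then have "i \<in> CL" using assms(2) by blast
    then have "i \<delta> < I \<delta>" using that by (simp add: cells_def PiE_iff)
    then show ?thesis using i by simp
  qed
  then show "j \<in> CL" using assms(3) j by (auto simp: cells_def PiE_iff)
qed

lemma fib_eq_iff:
  "set_mset X \<subseteq> CL \<Longrightarrow> set_mset Y \<subseteq> CL \<Longrightarrow> fib X = fib Y \<longleftrightarrow> same_margins \<D> X Y"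
  by (rule margins_freq_eq_iff)

lemma freq_in_fiber_iff:
  "set_mset X \<subseteq> CL \<Longrightarrow> set_mset Y \<subseteq> CL \<Longrightarrow>
    freq Y \<in> fiber m I \<D> (fib X) \<longleftrightarrow> same_margins \<D> X Y"
  by (auto simp: fiber_freq_iff)

lemma finite_fiber: "finite (fiber m I \<D> b)"
proof (cases "fiber m I \<D> b = {}")
  case False
  then obtain n where "n \<in> fiber m I \<D> b" by blast
  then obtain X where X: "set_mset X \<subseteq> CL" "b = fib X" by (rule fiber_memE)
  have "fiber m I \<D> b \<subseteq> freq ` multisets_of_size CL (size X)"
  proof
    fix n assume "n \<in> fiber m I \<D> b"
    then obtain Y where Y: "set_mset Y \<subseteq> CL" "n = freq Y" "same_margins \<D> X Y"
      using X by (auto simp: fiber_freq_iff)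
    then have "Y \<in> multisets_of_size CL (size X)"
      using same_margins_size[OF Y(3)] by (simp add: multisets_of_size_def)
    then show "n \<in> freq ` multisets_of_size CL (size X)" using Y(2) by blast
  qed
  then show ?thesis
    by (rule finite_subset) (intro finite_imageI finite_multisets_of_size finite_cells)
qed simp

lemma deg_fib:
  assumes "set_mset X \<subseteq> CL"
  shows "deg m I \<D> (fib X) = int (size X)"
  unfolding deg_def
proof (rule the_equality)
  show "\<forall>n\<in>fiber m I \<D> (fib X). sample_size m I n = int (size X)"
  proof
    fix n assume "n \<in> fiber m I \<D> (fib X)"
    then obtain Y where "set_mset Y \<subseteq> CL" "n = freq Y" "same_margins \<D> X Y"
      using assms by (auto simp: fiber_freq_iff)
    then show "sample_size m I n = int (size X)"
      using same_margins_size[of X Y] by (simp add: sample_size_freq)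
  qed
  have "freq X \<in> fiber m I \<D> (fib X)" using assms by (auto simp: fiber_freq_iff)
  then show "s = int (size X)" if "\<forall>n\<in>fiber m I \<D> (fib X). sample_size m I n = s" for s
    using that assms by (auto simp: sample_size_freq)
qed

lemma fib_in_Bnd:
  assumes "set_mset X \<subseteq> CL" "size X = 2" "set_mset Y \<subseteq> CL" "same_margins \<D> X Y" "X \<noteq> Y"
  shows "fib X \<in> Bnd m I \<D>"
proof -
  have "{freq X, freq Y} \<subseteq> fiber m I \<D> (fib X)" using assms by (auto simp: fiber_freq_iff)
  then have "card {freq X, freq Y} \<le> card (fiber m I \<D> (fib X))" by (rule card_mono[OF finite_fiber])
  then show ?thesis using assms by (simp add: Bnd_def deg_fib)
qed

lemma BndE:
  assumes "b \<in> Bnd m I \<D>"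
  obtains X Y where "set_mset X \<subseteq> CL" "size X = 2" "set_mset Y \<subseteq> CL" "same_margins \<D> X Y" "X \<noteq> Y" "b = fib X"
proof -
  have c: "2 \<le> card (fiber m I \<D> b)" "deg m I \<D> b = 2" using assms by (auto simp: Bnd_def)
  then obtain n where "n \<in> fiber m I \<D> b" by (cases "fiber m I \<D> b = {}") auto
  then obtain X where X: "set_mset X \<subseteq> CL" "b = fib X" by (rule fiber_memE)
  have "\<not> fiber m I \<D> b \<subseteq> {freq X}"
  proof
    assume "fiber m I \<D> b \<subseteq> {freq X}"
    then have "card (fiber m I \<D> b) \<le> card {freq X}" by (intro card_mono) auto
    then show False using c by simp
  qed
  then obtain n' where n': "n' \<in> fiber m I \<D> b" "n' \<noteq> freq X" by blast
  then obtain Y where Y: "set_mset Y \<subseteq> CL" "n' = freq Y" "same_margins \<D> X Y"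
    unfolding X(2) fiber_freq_iff[OF X(1)] by blast
  then have "X \<noteq> Y" using n'(2) by auto
  then show ?thesis using that[OF X(1) _ Y(1) Y(3)] X c(2) deg_fib[OF X(1)] by simp
qed

text \<open>One-dimensional marginals are constant on the fiber, so the existential over tables in
  \<open>nondegenerate\<close> may be evaluated at the given table.\<close>

lemma nondegenerate_fib:
  assumes "{i, j} \<subseteq> CL"
  shows "nondegenerate m I \<D> (fib {#i, j#}) = {\<delta> \<in> vars m. i \<delta> \<noteq> j \<delta>}"
proof -
  have marg: "marginal m I {\<delta>} n (\<lambda>_\<in>{\<delta>}. k) = of_bool (i \<delta> = k) + of_bool (j \<delta> = k)"
    if n: "n \<in> fiber m I \<D> (fib {#i, j#})" and \<delta>: "\<delta> \<in> vars m" for n \<delta> k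
  proof -
    obtain Y where Y: "set_mset Y \<subseteq> CL" "n = freq Y" "same_margins \<D> {#i, j#} Y"
      using n assms by (auto simp: fiber_freq_iff)
    have "marginal m I {\<delta>} n (\<lambda>_\<in>{\<delta>}. k) = int (count (restr {\<delta>} {#i, j#}) (\<lambda>_\<in>{\<delta>}. k))"
      using Y restr_clique[OF Y(3) clique_singleton[OF \<delta>]] by (simp add: marginal_freq)
    moreover have "restrict i {\<delta>} = (\<lambda>_\<in>{\<delta>}. k) \<longleftrightarrow> i \<delta> = k" for i :: cell
      by (auto simp: restrict_eq_iff)
    ultimately show ?thesis by simp
  qed
  have mem: "freq {#i, j#} \<in> fiber m I \<D> (fib {#i, j#})" using assms by (auto simp: fiber_freq_iff)
  show ?thesis
  proof (intro set_eqI iffI)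
    fix \<delta> assume "\<delta> \<in> nondegenerate m I \<D> (fib {#i, j#})"
    then obtain n k l where "n \<in> fiber m I \<D> (fib {#i, j#})" "k \<noteq> l" "\<delta> \<in> vars m"
      "marginal m I {\<delta>} n (\<lambda>_\<in>{\<delta>}. k) = 1" "marginal m I {\<delta>} n (\<lambda>_\<in>{\<delta>}. l) = 1"
      unfolding nondegenerate_def by blast
    then show "\<delta> \<in> {\<delta> \<in> vars m. i \<delta> \<noteq> j \<delta>}" by (auto simp: marg of_bool_def split: if_splits)
  next
    fix \<delta> assume \<delta>: "\<delta> \<in> {\<delta> \<in> vars m. i \<delta> \<noteq> j \<delta>}"
    then have "i \<delta> < I \<delta>" "j \<delta> < I \<delta>" using assms by (auto simp: cells_def PiE_iff)
    moreover have "marginal m I {\<delta>} (freq {#i, j#}) (\<lambda>_\<in>{\<delta>}. i \<delta>) = 1"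
      "marginal m I {\<delta>} (freq {#i, j#}) (\<lambda>_\<in>{\<delta>}. j \<delta>) = 1"
      using \<delta> by (simp_all add: marg[OF mem])
    ultimately show "\<delta> \<in> nondegenerate m I \<D> (fib {#i, j#})"
      using \<delta> mem unfolding nondegenerate_def by blast
  qed
qed

lemma same_margins_act: "same_margins \<D> X Y \<Longrightarrow> same_margins \<D> (act_mset m g X) (act_mset m g Y)"
  using restr_act_mset D_subset unfolding same_margins_def by blast

abbreviation "zero_cell \<equiv> (\<lambda>\<delta>\<in>vars m. 0) :: cell"

definition chi :: "nat set \<Rightarrow> cell"
  where "chi S = (\<lambda>\<delta>\<in>vars m. if \<delta> \<in> S then 1 else 0)"

lemma std_cells: "{zero_cell, chi S} \<subseteq> CL"
proof -
  have "0 < I \<delta>" "1 < I \<delta>" if "\<delta> \<in> vars m" for \<delta> using levels that by force+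
  then show ?thesis by (auto simp: cells_def chi_def)
qed

lemma n0_freq: "n0 m I \<D> b = freq {#zero_cell, chi (nondegenerate m I \<D> b)#}"
  by (simp add: n0_def two_cells_freq chi_def)

lemma Bnd0_fib: "b \<in> Bnd0 m I \<D> \<Longrightarrow> b = fib {#zero_cell, chi (nondegenerate m I \<D> b)#}"
  by (simp add: Bnd0_def fiber_def n0_freq)

lemma fib_in_Bnd0:
  assumes "fib {#zero_cell, chi S#} \<in> Bnd m I \<D>" "S \<subseteq> vars m"
  shows "fib {#zero_cell, chi S#} \<in> Bnd0 m I \<D>"
proof -
  have "nondegenerate m I \<D> (fib {#zero_cell, chi S#}) = S"
    using assms(2) by (subst nondegenerate_fib[OF std_cells]) (auto simp: chi_def)
  then show ?thesis
    using assms std_cells[of S] by (auto simp: Bnd0_def n0_freq fiber_freq_iff)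
qed

lemma finite_Bnd0: "finite (Bnd0 m I \<D>)"
proof (rule finite_surj[of "Pow (vars m)"])
  show "Bnd0 m I \<D> \<subseteq> (\<lambda>S. fib {#zero_cell, chi S#}) ` Pow (vars m)"
  proof
    fix b assume "b \<in> Bnd0 m I \<D>"
    then have "b = fib {#zero_cell, chi (nondegenerate m I \<D> b)#}" by (rule Bnd0_fib)
    moreover have "nondegenerate m I \<D> b \<subseteq> vars m" by (auto simp: nondegenerate_def)
    ultimately show "b \<in> (\<lambda>S. fib {#zero_cell, chi S#}) ` Pow (vars m)" by blast
  qed
qed simp

lemma size2_iff: "size X = 2 \<longleftrightarrow> (\<exists>i j. X = {#i, j#})"
proof
  assume "size X = 2"
  then obtain i X' where X: "X = add_mset i X'" "size X' = 1" by (cases X) auto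
  then obtain j where "X' = {#j#}" using size_1_singleton_mset by blast
  then show "\<exists>i j. X = {#i, j#}" using X by blast
qed auto

text \<open>A fiber in \<open>Bnd0\<close> is determined by its set of nondegenerate variables, which is invariant
  under level permutations.\<close>

lemma Bnd0_orbit_unique:
  assumes b: "b \<in> Bnd0 m I \<D>" and b': "b' \<in> Bnd0 m I \<D>" and g: "g \<in> G"
    and X: "set_mset X \<subseteq> CL" "b = fib X" "size X = 2" and gX: "b' = fib (act_mset m g X)"
  shows "b = b'"
proof -
  obtain i j where ij: "X = {#i, j#}" using X(3) unfolding size2_iff by (elim exE)
  have inj: "g \<delta> x = g \<delta> y \<longleftrightarrow> x = y" if "\<delta> \<in> vars m" for \<delta> x y
    using permutes_inj[OF level_permsD[OF g that]] by (simp add: inj_eq)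
  have "{act_cell m g i, act_cell m g j} \<subseteq> CL" using act_cell_in_cells[OF g] X ij by simp
  then have "nondegenerate m I \<D> b' = {\<delta> \<in> vars m. act_cell m g i \<delta> \<noteq> act_cell m g j \<delta>}"
    using nondegenerate_fib[of "act_cell m g i" "act_cell m g j"] gX ij by simp
  also have "\<dots> = {\<delta> \<in> vars m. i \<delta> \<noteq> j \<delta>}" by (auto simp: act_cell_def inj)
  also have "\<dots> = nondegenerate m I \<D> b" using nondegenerate_fib[of i j] X ij by simp
  finally show ?thesis using Bnd0_fib[OF b] Bnd0_fib[OF b'] by simp
qed

text \<open>First \<open>a\<close> is transposed to 0, then the image of \<open>b\<close> to 1. That
  image is not 0 when \<open>a \<noteq> b\<close>, so the second transposition leaves 0 in
  place.\<close>

lemma normalising_perm: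
  assumes "a < n" "b < n" "2 \<le> n"
  shows "\<exists>p. p permutes {..<n} \<and> p a = 0 \<and> p b = (if a = b then 0 else (1::nat))"
proof -
  let ?t = "transpose a 0"
  have t: "?t permutes {..<n}" using assms by (intro permutes_swap_id) auto
  show ?thesis
  proof (cases "a = b")
    case True
    then show ?thesis using t by (intro exI[of _ ?t]) auto
  next
    case False
    have "?t b < n" using permutes_in_image[OF t, of b] assms by simp
    then have "transpose (?t b) 1 permutes {..<n}" using assms by (intro permutes_swap_id) auto
    then have "(transpose (?t b) 1 \<circ> ?t) permutes {..<n}" by (rule permutes_compose[OF t])
    moreover have "?t b \<noteq> 0" using False by (metis transpose_apply_first transpose_eq_imp_eq)
    ultimately show ?thesis using False by (intro exI[of _ "transpose (?t b) 1 \<circ> ?t"]) auto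
  qed
qed

text \<open>The variables can be normalised independently, and the resulting table has the shape of
  \<open>n0\<close>. This is how a fiber in \<open>Bnd\<close> is carried to one in
  \<open>Bnd0\<close>.\<close>

lemma normalise:
  assumes "{i, j} \<subseteq> CL"
  shows "\<exists>g\<in>G. act_mset m g {#i, j#} = {#zero_cell, chi {\<delta> \<in> vars m. i \<delta> \<noteq> j \<delta>}#}"
proof -
  have "\<exists>p. p permutes {..<I \<delta>} \<and> p (i \<delta>) = 0 \<and> p (j \<delta>) = (if i \<delta> = j \<delta> then 0 else 1)"
    if "\<delta> \<in> vars m" for \<delta>
    using assms levels that by (intro normalising_perm) (auto simp: cells_def PiE_iff)
  then obtain p where p: "\<And>\<delta>. \<delta> \<in> vars m \<Longrightarrow> p \<delta> permutes {..<I \<delta>} \<and> p \<delta> (i \<delta>) = 0 \<and>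
      p \<delta> (j \<delta>) = (if i \<delta> = j \<delta> then 0 else 1)"
    by metis
  have "restrict p (vars m) \<in> G" using p by (auto simp: level_perms_def)
  moreover have "act_cell m (restrict p (vars m)) i = zero_cell"
    "act_cell m (restrict p (vars m)) j = chi {\<delta> \<in> vars m. i \<delta> \<noteq> j \<delta>}"
    using p by (auto simp: act_cell_def chi_def fun_eq_iff)
  ultimately show ?thesis by (intro bexI[of _ "restrict p (vars m)"]) auto
qed

subsection \<open>Connectedness\<close>

abbreviation move_rel :: "arr set set \<Rightarrow> arr set \<Rightarrow> arr rel"
  where "move_rel M F \<equiv> {(x, y). x \<in> F \<and> y \<in> F \<and> up_to_sign (y - x) \<in> M}"

lemma move_rel_map:
  assumes "(x, y) \<in> (move_rel M F)\<^sup>*"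
    and "\<And>x y. (x, y) \<in> move_rel M F \<Longrightarrow> (f x, f y) \<in> move_rel M F'"
  shows "(f x, f y) \<in> (move_rel M F')\<^sup>*"
  using assms(1)
proof (induction rule: rtrancl_induct)
  case (step y z)
  show ?case by (rule rtrancl_into_rtrancl[OF step.IH assms(2)[OF step.hyps(2)]])
qed (rule rtrancl_refl)

text \<open>The two tables are carried over by \<open>g\<close> and joined there, and the whole path
  is brought back by the inverse; invariance keeps its steps in \<open>M\<close>.\<close>

lemma connects_transfer:
  assumes inv: "invariant m I G M" and g: "g \<in> G" and X: "set_mset X \<subseteq> CL"
    and con: "connects M (fiber m I \<D> (fib (act_mset m g X)))"
  shows "connects M (fiber m I \<D> (fib X))"
proof -
  let ?h = "inv_perms m g"
  let ?F = "fiber m I \<D> (fib X)" and ?F' = "fiber m I \<D> (fib (act_mset m g X))"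
  have h: "?h \<in> G" by (rule inv_perms_in[OF g])
  have to: "act m I g n \<in> ?F'" if "n \<in> ?F" for n
    using that X g act_mset_in_cells[OF g]
    by (fastforce simp: fiber_freq_iff act_freq intro: same_margins_act)
  have from_F': "act m I ?h n \<in> ?F" if n: "n \<in> ?F'" for n
  proof -
    obtain Y where Y: "set_mset Y \<subseteq> CL" "n = freq Y" "same_margins \<D> (act_mset m g X) Y"
      using n X act_mset_in_cells[OF g] by (auto simp: fiber_freq_iff)
    then have "same_margins \<D> X (act_mset m ?h Y)"
      using same_margins_act[OF Y(3), of ?h] act_mset_inv(1)[OF g X] by simp
    then show ?thesis using Y X h act_mset_in_cells[OF h] by (auto simp: fiber_freq_iff act_freq)
  qed
  have id: "act m I ?h (act m I g n) = n" if "n \<in> ?F" for n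
    using that X g h act_mset_in_cells[OF g] act_mset_inv(1)[OF g]
    by (auto simp: fiber_freq_iff act_freq)
  show ?thesis
    unfolding connects_def
  proof (intro ballI)
    fix n n' assume n: "n \<in> ?F" "n' \<in> ?F"
    have "(act m I g n, act m I g n') \<in> (move_rel M ?F')\<^sup>*"
      using con to n unfolding connects_def by blast
    then have "(act m I ?h (act m I g n), act m I ?h (act m I g n')) \<in> (move_rel M ?F)\<^sup>*"
    proof (rule move_rel_map)
      fix x y assume xy: "(x, y) \<in> move_rel M ?F'"
      then have "act_move m I ?h (up_to_sign (y - x)) \<in> M" using inv h by (auto simp: invariant_def)
      then show "(act m I ?h x, act m I ?h y) \<in> move_rel M ?F"
        using xy from_F' by (auto simp: act_move_up_to_sign act_diff)
    qed
    then show "(n, n') \<in> (move_rel M ?F)\<^sup>*" using id n by simp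
  qed
qed

lemma connects_Bnd:
  assumes inv: "invariant m I G M" and con: "\<forall>b\<in>Bnd0 m I \<D>. connects M (fiber m I \<D> b)"
    and b: "b \<in> Bnd m I \<D>"
  shows "connects M (fiber m I \<D> b)"
proof -
  from b obtain X Y where X: "set_mset X \<subseteq> CL" "size X = 2" "set_mset Y \<subseteq> CL" "same_margins \<D> X Y" "X \<noteq> Y"
    and bX: "b = fib X" by (rule BndE)
  obtain i j where ij: "X = {#i, j#}" using X(2) unfolding size2_iff by (elim exE)
  let ?S = "{\<delta> \<in> vars m. i \<delta> \<noteq> j \<delta>}"
  obtain g where g: "g \<in> G" "act_mset m g X = {#zero_cell, chi ?S#}"
    using normalise[of i j] X(1) ij by auto
  \<comment> \<open>The image of the second table witnesses that the normalised fiber still has two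
    elements, as \<open>Bnd\<close> requires.\<close>
  have "act_mset m g X \<noteq> act_mset m g Y"
    using act_mset_inv(1)[OF g(1)] X by metis
  then have "fib (act_mset m g X) \<in> Bnd m I \<D>"
    using X act_mset_in_cells[OF g(1)] same_margins_act[OF X(4)]
    by (intro fib_in_Bnd[of _ "act_mset m g Y"]) auto
  then have "fib (act_mset m g X) \<in> Bnd0 m I \<D>"
    unfolding g(2) by (rule fib_in_Bnd0) blast
  then show ?thesis using connects_transfer[OF inv g(1) X(1)] con bX by auto
qed

text \<open>Every step of degree two takes place inside the fiber of the pair being replaced. Adding
  the unchanged rest \<open>R\<close> to a path in that small fiber keeps all differences, hence the
  moves, and yields a path in the large one.\<close>

lemma connects_all:
  assumes con: "\<forall>b\<in>Bnd m I \<D>. connects M (fiber m I \<D> b)"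
  shows "connects M (fiber m I \<D> b)"
  unfolding connects_def
proof (intro ballI)
  fix n n' assume n: "n \<in> fiber m I \<D> b" "n' \<in> fiber m I \<D> b"
  let ?F = "fiber m I \<D> b" and ?K = "cliques (vars m) E"
  obtain X where X: "set_mset X \<subseteq> CL" "n = freq X" "b = fib X" using n(1) by (rule fiber_memE)
  obtain Y where Y: "set_mset Y \<subseteq> CL" "n' = freq Y" "same_margins \<D> X Y"
    using n(2) X by (auto simp: fiber_freq_iff)
  have ext: "CL \<subseteq> extensional (vars m)" by (auto simp: cells_def PiE_iff)
  have "(deg2_step ?K (vars m))\<^sup>*\<^sup>* X Y"
    using X Y ext same_margins_cliques chordal_deg2_connected[OF chordalE symE irreflE, of "vars m" X Y]
    by auto
  then have "set_mset Y \<subseteq> CL \<and> same_margins \<D> X Y \<and> (freq X, freq Y) \<in> (move_rel M ?F)\<^sup>*"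
  proof (induction rule: rtranclp_induct)
    case base
    then show ?case using X by simp
  next
    case (step Y Z)
    then obtain R i j i' j' where Y: "Y = R + {#i, j#}" and Z: "Z = R + {#i', j'#}"
      and e: "{i', j'} \<subseteq> extensional (vars m)" and sm: "same_margins \<D> {#i, j#} {#i', j'#}"
      unfolding deg2_step_def same_margins_cliques by blast
    have ij: "{i, j} \<subseteq> CL" "set_mset R \<subseteq> CL" using step Y by auto
    have ij': "{i', j'} \<subseteq> CL" using same_margins_in_cells[OF sm] ij(1) e by simp
    have XY: "same_margins \<D> X Y" "(freq X, freq Y) \<in> (move_rel M ?F)\<^sup>*" using step.IH by blast+
    have "same_margins \<D> Y Z" using sm by (simp only: Y Z same_margins_add_left)
    with XY have XZ: "same_margins \<D> X Z" by (blast intro: same_margins_trans)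
    have "(freq Y, freq Z) \<in> (move_rel M ?F)\<^sup>*"
    proof (cases "{#i, j#} = {#i', j'#}")
      case True
      then show ?thesis using Y Z by simp
    next
      case False
      let ?F2 = "fiber m I \<D> (fib {#i, j#})"
      have "fib {#i, j#} \<in> Bnd m I \<D>"
        using fib_in_Bnd[OF _ _ _ sm False] ij ij' by simp
      then have "connects M ?F2" using con by blast
      moreover have "freq {#i, j#} \<in> ?F2" "freq {#i', j'#} \<in> ?F2"
        using ij ij' sm by (simp_all add: freq_in_fiber_iff)
      ultimately have "(freq {#i, j#}, freq {#i', j'#}) \<in> (move_rel M ?F2)\<^sup>*"
        unfolding connects_def by blast
      then have "(freq R + freq {#i, j#}, freq R + freq {#i', j'#}) \<in> (move_rel M ?F)\<^sup>*"
      proof (rule move_rel_map)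
        have "freq R + x \<in> ?F" if x: "x \<in> ?F2" for x
        proof -
          obtain P where P: "set_mset P \<subseteq> CL" "x = freq P" "same_margins \<D> {#i, j#} P"
            using x ij by (auto simp: fiber_freq_iff)
          have "same_margins \<D> Y (R + P)" using P(3) by (simp only: Y same_margins_add_left)
          then have "same_margins \<D> X (R + P)" using XY by (blast intro: same_margins_trans)
          then show ?thesis
            using X P ij by (auto simp: fiber_freq_iff freq_union[symmetric] simp del: freq_union)
        qed
        then show "(freq R + x, freq R + y) \<in> move_rel M ?F" if "(x, y) \<in> move_rel M ?F2" for x y
          using that by simp
      qed
      then show ?thesis by (simp only: Y Z freq_union)
    qed
    with XY(2) have "(freq X, freq Z) \<in> (move_rel M ?F)\<^sup>*" by (rule rtrancl_trans)
    moreover have "set_mset Z \<subseteq> CL" using ij ij' Z by simp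
    ultimately show ?case using XZ by blast
  qed
  then show "(n, n') \<in> (move_rel M ?F)\<^sup>*" using X Y by simp
qed

end

subsection \<open>Minimal spanning sets over GF(2)\<close>

lemma bit_cases: "(a::bit) = 0 \<or> a = 1"
  by (cases a) auto

lemma bit_fun_add_self [simp]: "v + v = (0 :: nat \<Rightarrow> bit)"
  by (simp add: fun_eq_iff)

lemma bit_fun_add_eq_0_iff: "u + v = 0 \<longleftrightarrow> u = (v :: nat \<Rightarrow> bit)"
  by (metis add.assoc add_0 add_0_right bit_fun_add_self)

lemma bit_fun_add_cancel: "u + (u + w) = (w :: nat \<Rightarrow> bit)"
  unfolding add.assoc[symmetric] bit_fun_add_self add_0 ..

lemma subspace_gf2: "gf2.subspace (gf2_space c)"
  unfolding gf2.subspace_def gf2_space_def by simp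

lemma gf2_space_add: "u \<in> gf2_space c \<Longrightarrow> v \<in> gf2_space c \<Longrightarrow> u + v \<in> gf2_space c"
  by (simp add: gf2_space_def)

lemma gf2_space_zero: "0 \<in> gf2_space c"
  by (simp add: gf2_space_def)

lemma span_subset_gf2_space: "T \<subseteq> gf2_space c \<Longrightarrow> gf2.span T \<subseteq> gf2_space c"
  by (rule gf2.span_minimal[OF _ subspace_gf2])

text \<open>Independence is traded for minimality under inclusion, the form that can be compared
  with minimality of invariant sets of moves.\<close>

lemma gf2_basis_iff_minimal:
  assumes "T \<subseteq> gf2_space c"
  shows "gf2_basis c T \<longleftrightarrow> gf2.span T = gf2_space c \<and> (\<forall>T'. T' \<subset> T \<longrightarrow> gf2.span T' \<noteq> gf2_space c)"
proof
  assume B: "gf2_basis c T"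
  have "gf2.span T' \<noteq> gf2_space c" if T': "T' \<subset> T" for T'
  proof
    assume sp: "gf2.span T' = gf2_space c"
    obtain a where a: "a \<in> T" "a \<notin> T'" using T' by blast
    have "T' \<subseteq> T - {a}" using T' a by auto
    then have "a \<in> gf2.span (T - {a})" using gf2.span_mono sp a assms by blast
    then show False using B a unfolding gf2_basis_def gf2.dependent_def by blast
  qed
  then show "gf2.span T = gf2_space c \<and> (\<forall>T'. T' \<subset> T \<longrightarrow> gf2.span T' \<noteq> gf2_space c)"
    using B by (simp add: gf2_basis_def)
next
  assume m: "gf2.span T = gf2_space c \<and> (\<forall>T'. T' \<subset> T \<longrightarrow> gf2.span T' \<noteq> gf2_space c)"
  have "gf2.independent T"
  proof
    assume "gf2.dependent T"
    then obtain a where a: "a \<in> T" "a \<in> gf2.span (T - {a})" unfolding gf2.dependent_def by blast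
    then have "gf2.span (T - {a}) = gf2.span T"
      using gf2.span_redundant[OF a(2)] by (simp add: insert_absorb)
    moreover have "T - {a} \<subset> T" using a by auto
    ultimately show False using m by blast
  qed
  then show "gf2_basis c T" using m assms by (simp add: gf2_basis_def)
qed

lemma gf2_basis_subset_exists:
  assumes "T \<subseteq> gf2_space c" "gf2.span T = gf2_space c"
  obtains B where "B \<subseteq> T" "gf2_basis c B"
proof -
  obtain B where B: "B \<subseteq> T" "gf2.independent B" "T \<subseteq> gf2.span B"
    by (rule gf2.maximal_independent_subset)
  have "gf2.span B = gf2_space c"
    using gf2.span_mono[OF B(1)] gf2.span_minimal[OF B(3) gf2.subspace_span] assms(2) by blast
  then show ?thesis using that[of B] B assms(1) by (auto simp: gf2_basis_def)
qed

lemma gf2_basis_nonzero: "gf2_basis c B \<Longrightarrow> v \<in> B \<Longrightarrow> v \<in> gf2_space c \<and> v \<noteq> 0"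
  using gf2.dependent_zero by (auto simp: gf2_basis_def)

lemma finite_gf2_space: "finite (gf2_space c)"
proof -
  have "gf2_space c \<subseteq> (\<lambda>S l. of_bool (l \<in> S)) ` Pow {2..c}"
  proof
    fix v assume v: "v \<in> gf2_space c"
    have "v = (\<lambda>l. of_bool (l \<in> {l. v l = 1}))"
      by (auto simp: fun_eq_iff)
    moreover have "{l. v l = 1} \<in> Pow {2..c}" using v by (auto simp: gf2_space_def)
    ultimately show "v \<in> (\<lambda>S l. of_bool (l \<in> S)) ` Pow {2..c}" by blast
  qed
  then show ?thesis by (rule finite_subset) simp
qed

lemma sum_fun_apply: "(\<Sum>k\<in>A. f k) x = (\<Sum>k\<in>A. f k x)"
  for f :: "'a \<Rightarrow> 'b \<Rightarrow> 'c::comm_monoid_add"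
  by (induction A rule: infinite_finite_induct) auto

text \<open>The unit vectors \<open>e k\<close> with \<open>k \<in> {2..c}\<close> form a basis, so
  the dimension is \<open>c - 1\<close>; the sum form avoids truncated subtraction.\<close>

lemma card_gf2_basis:
  assumes B: "gf2_basis c B" and c: "1 \<le> c"
  shows "card B + 1 = c"
proof -
  define e where "e = (\<lambda>(k::nat) l. of_bool (l = k) :: bit)"
  have inj: "inj_on e {2..c}"
  proof (rule inj_onI)
    fix k l assume "e k = e l"
    from fun_cong[OF this, of k] show "k = l" by (simp add: e_def of_bool_def split: if_splits)
  qed
  have sub: "e ` {2..c} \<subseteq> gf2_space c" by (auto simp: e_def gf2_space_def)
  have "gf2.independent (e ` {2..c})"
  proof
    assume "gf2.dependent (e ` {2..c})"
    then obtain k where k: "k \<in> {2..c}" "e k \<in> gf2.span (e ` {2..c} - {e k})"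
      unfolding gf2.dependent_def by blast
    \<comment> \<open>Coordinate \<open>k\<close> vanishes on the remaining unit vectors and hence
      on their span.\<close>
    have "e k k = 0"
      using k(2)
      by (induction rule: gf2.span_induct_alt) (auto simp: e_def)
    then show False by (simp add: e_def)
  qed
  moreover have "gf2_space c \<subseteq> gf2.span (e ` {2..c})"
  proof
    fix v assume v: "v \<in> gf2_space c"
    have "v = (\<Sum>k\<in>{2..c}. (\<lambda>l. v k * e k l))"
    proof
      fix l
      have "(\<Sum>k\<in>{2..c}. (\<lambda>l. v k * e k l)) l = (\<Sum>k\<in>{2..c}. v k * e k l)"
        by (rule sum_fun_apply)
      also have "\<dots> = (\<Sum>k\<in>{2..c}. if l = k then v k else 0)"
        by (rule sum.cong) (auto simp: e_def)
      also have "\<dots> = v l" using v by (simp add: gf2_space_def)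
      finally show "v l = (\<Sum>k\<in>{2..c}. (\<lambda>l. v k * e k l)) l" ..
    qed
    also have "\<dots> \<in> gf2.span (e ` {2..c})"
      by (intro gf2.span_sum gf2.span_scale gf2.span_base) auto
    finally show "v \<in> gf2.span (e ` {2..c})" .
  qed
  ultimately have "card (e ` {2..c}) = gf2.dim (gf2_space c)"
    using sub gf2.basis_card_eq_dim by blast
  moreover have "card B = gf2.dim (gf2_space c)"
    using B gf2.basis_card_eq_dim[of B "gf2_space c"] by (simp add: gf2_basis_def)
  ultimately show ?thesis using c card_image[OF inj] by simp
qed

subsection \<open>The fiber over a normalised marginal\<close>

locale fixed_fiber = decomposable_model +
  fixes b :: marginals and \<Gamma> :: "nat \<Rightarrow> nat set"
  assumes b: "b \<in> Bnd0 m I \<D>"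
    and enum: "bij_betw \<Gamma> {1..num_comps m I \<D> b} (nd_components m I \<D> b)"
begin

abbreviation "c \<equiv> num_comps m I \<D> b"
abbreviation "S \<equiv> nondegenerate m I \<D> b"
abbreviation "F \<equiv> fiber m I \<D> b"
abbreviation "H \<equiv> Gb m I c \<Gamma>"
abbreviation "VS \<equiv> gf2_space c"

section \<open>Components of the nondegenerate variables and the tables of the fiber\<close>

definition "conn = (E \<inter> S \<times> S)\<^sup>* \<inter> S \<times> S"

lemma S_sub: "S \<subseteq> vars m"
  by (auto simp: nondegenerate_def)

lemma equiv_conn: "equiv S conn"
proof (rule equivI)
  show "refl_on S conn" by (auto simp: refl_on_def conn_def)
  have "sym ((E \<inter> S \<times> S)\<^sup>*)" using symE by (intro sym_rtrancl) (auto simp: sym_def)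
  then show "sym conn" by (auto simp: sym_def conn_def)
  show "trans conn" by (auto simp: trans_def conn_def)
  show "conn \<subseteq> S \<times> S" by (auto simp: conn_def)
qed

lemma comps: "nd_components m I \<D> b = S // conn"
  by (simp add: nd_components_def components_def conn_def)

lemma \<Gamma>_comp: "l \<in> {1..c} \<Longrightarrow> \<Gamma> l \<in> S // conn"
  using enum comps by (auto simp: bij_betw_def)

lemma \<Gamma>_sub: "l \<in> {1..c} \<Longrightarrow> \<delta> \<in> \<Gamma> l \<Longrightarrow> \<delta> \<in> S"
  using in_quotient_imp_subset[OF equiv_conn \<Gamma>_comp] by blast

lemma \<Gamma>_unique: "l \<in> {1..c} \<Longrightarrow> l' \<in> {1..c} \<Longrightarrow> \<delta> \<in> \<Gamma> l \<Longrightarrow> \<delta> \<in> \<Gamma> l' \<Longrightarrow> l = l'"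
  using quotient_disj[OF equiv_conn \<Gamma>_comp \<Gamma>_comp, of l l'] enum
  unfolding bij_betw_def inj_on_def by blast

lemma \<Gamma>_cover:
  assumes "\<delta> \<in> S"
  obtains l where "l \<in> {1..c}" "\<delta> \<in> \<Gamma> l"
proof -
  have "\<delta> \<in> conn `` {\<delta>}" using assms by (simp add: conn_def)
  moreover have "conn `` {\<delta>} \<in> \<Gamma> ` {1..c}"
    using enum comps quotientI[OF assms] by (simp add: bij_betw_def)
  ultimately show ?thesis using that by blast
qed

lemma \<Gamma>_adjacent:
  assumes "l \<in> {1..c}" "\<delta> \<in> \<Gamma> l" "\<delta>' \<in> S" "(\<delta>, \<delta>') \<in> E"
  shows "\<delta>' \<in> \<Gamma> l"
proof -
  have "(\<delta>, \<delta>') \<in> conn" using assms \<Gamma>_sub by (auto simp: conn_def)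
  then show ?thesis using in_quotient_imp_closed[OF equiv_conn \<Gamma>_comp[OF assms(1)] assms(2)] by blast
qed

lemma \<Gamma>_constant:
  assumes f: "\<And>\<delta> \<delta>'. \<delta> \<in> S \<Longrightarrow> \<delta>' \<in> S \<Longrightarrow> (\<delta>, \<delta>') \<in> E \<Longrightarrow> f \<delta> = f \<delta>'"
    and l: "l \<in> {1..c}" "\<delta> \<in> \<Gamma> l" "\<delta>' \<in> \<Gamma> l"
  shows "f \<delta> = f \<delta>'"
proof -
  have "(\<delta>, \<delta>') \<in> (E \<inter> S \<times> S)\<^sup>*"
    using in_quotient_imp_in_rel[OF equiv_conn \<Gamma>_comp[OF l(1)]] l by (auto simp: conn_def)
  then show ?thesis by (induction rule: rtrancl_induct) (use f in auto)
qed

text \<open>A sample variable of each component: within a cell of the fiber the levels are constant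
  along every component, so this variable reveals them all.\<close>

definition rep :: "nat \<Rightarrow> nat"
  where "rep l = (SOME \<delta>. \<delta> \<in> \<Gamma> l)"

lemma rep: "l \<in> {1..c} \<Longrightarrow> rep l \<in> \<Gamma> l"
  using in_quotient_imp_non_empty[OF equiv_conn \<Gamma>_comp] unfolding rep_def by (metis ex_in_conv someI_ex)

text \<open>The cells of the table for \<open>v\<close> are told apart by their level on
  \<open>\<Gamma> 1\<close>, which is 0 in \<open>lo v\<close> and 1 in \<open>hi v\<close>. This
  gives the unordered pair a canonical order.\<close>

definition lo :: "(nat \<Rightarrow> bit) \<Rightarrow> cell"
  where "lo v = (\<lambda>\<delta>\<in>vars m. if \<exists>l\<in>{2..c}. \<delta> \<in> \<Gamma> l \<and> v l = 1 then 1 else 0)"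

definition hi :: "(nat \<Rightarrow> bit) \<Rightarrow> cell"
  where "hi v = (\<lambda>\<delta>\<in>vars m. if \<delta> \<in> \<Gamma> 1 \<or> (\<exists>l\<in>{2..c}. \<delta> \<in> \<Gamma> l \<and> v l = 0) then 1 else 0)"

definition pr :: "(nat \<Rightarrow> bit) \<Rightarrow> cell multiset"
  where "pr v = {#lo v, hi v#}"

lemma nv_freq: "nv m c \<Gamma> v = freq (pr v)"
  by (simp add: nv_def two_cells_freq pr_def lo_def hi_def)

text \<open>If all variables were degenerate, the one-dimensional marginals would force both cells
  to be \<open>zero_cell\<close>, and the fiber would be a single table. This guarantees that
  \<open>\<Gamma> 1\<close> exists.\<close>

lemma S_nonempty: "S \<noteq> {}"
proof
  assume "S = {}"
  then have b0: "b = fib {#zero_cell, zero_cell#}" using Bnd0_fib[OF b] by (simp add: chi_def)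
  have "b \<in> Bnd m I \<D>" using b by (simp add: Bnd0_def)
  then obtain X Y where X: "set_mset X \<subseteq> CL" "size X = 2" "set_mset Y \<subseteq> CL" "same_margins \<D> X Y" "X \<noteq> Y"
    "b = fib X" by (rule BndE)
  have z: "set_mset {#zero_cell, zero_cell#} \<subseteq> CL" using std_cells[of "{}"] by simp
  have single: "Z = {#zero_cell, zero_cell#}" if Z: "set_mset Z \<subseteq> CL" "same_margins \<D> {#zero_cell, zero_cell#} Z" for Z
  proof -
    have zero: "i = zero_cell" if i: "i \<in># Z" for i
    proof
      fix \<delta>
      show "i \<delta> = zero_cell \<delta>"
      proof (cases "\<delta> \<in> vars m")
        case True
        have "i \<delta> \<in># image_mset (\<lambda>i. i \<delta>) Z" using i by simp
        then have "i \<delta> \<in># image_mset (\<lambda>i. i \<delta>) {#zero_cell, zero_cell#}"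
          using same_margins_level[OF Z(2) True] by metis
        then show ?thesis using True by simp
      next
        case False
        then show ?thesis using i Z(1) by (auto simp: cells_def PiE_iff extensional_def)
      qed
    qed
    have "size Z = 2" using same_margins_size[OF Z(2)] by simp
    then obtain i j where ij: "Z = {#i, j#}" unfolding size2_iff by (elim exE)
    show ?thesis using zero[of i] zero[of j] unfolding ij by simp
  qed
  have X0: "same_margins \<D> {#zero_cell, zero_cell#} X"
    using fib_eq_iff[OF z X(1)] b0 X(6) by simp
  show False
    using single[OF X(1) X0] single[OF X(3) same_margins_trans[OF X0 X(4)]] X(5) by simp
qed

lemma c_pos: "1 \<le> c"
proof -
  obtain \<delta> where "\<delta> \<in> S" using S_nonempty by blast
  then obtain l where "l \<in> {1..c}" by (rule \<Gamma>_cover)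
  then show ?thesis by simp
qed

lemma one_in: "1 \<in> {1..c}"
  using c_pos by simp

lemma VS_outside: "v \<in> VS \<Longrightarrow> l \<notin> {2..c} \<Longrightarrow> v l = 0"
  by (simp add: gf2_space_def)

text \<open>Vectors vanish at 1, so one formula serves all components including
  \<open>\<Gamma> 1\<close>, and the special clause for it in \<open>hi\<close> disappears in
  \<open>hi_comp\<close>.\<close>

lemma lo_comp:
  assumes "v \<in> VS" "l \<in> {1..c}" "\<delta> \<in> \<Gamma> l"
  shows "lo v \<delta> = of_bool (v l = 1)"
proof -
  have "(\<exists>k\<in>{2..c}. \<delta> \<in> \<Gamma> k \<and> v k = 1) \<longleftrightarrow> v l = 1"
  proof
    assume "\<exists>k\<in>{2..c}. \<delta> \<in> \<Gamma> k \<and> v k = 1"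
    then obtain k where k: "k \<in> {2..c}" "\<delta> \<in> \<Gamma> k" "v k = 1" by blast
    then have "k \<in> {1..c}" by simp
    with k show "v l = 1" using \<Gamma>_unique[OF assms(2) _ assms(3)] by blast
  next
    assume "v l = 1"
    then have "l \<in> {2..c}" using VS_outside[OF assms(1), of l] by (cases "l \<in> {2..c}") simp_all
    then show "\<exists>k\<in>{2..c}. \<delta> \<in> \<Gamma> k \<and> v k = 1" using assms(3) \<open>v l = 1\<close> by blast
  qed
  then show ?thesis using \<Gamma>_sub[OF assms(2,3)] S_sub by (auto simp: lo_def)
qed

lemma hi_comp:
  assumes "v \<in> VS" "l \<in> {1..c}" "\<delta> \<in> \<Gamma> l"
  shows "hi v \<delta> = of_bool (v l = 0)"
proof -
  have "\<delta> \<in> \<Gamma> 1 \<or> (\<exists>k\<in>{2..c}. \<delta> \<in> \<Gamma> k \<and> v k = 0) \<longleftrightarrow> v l = 0"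
  proof
    assume "v l = 0"
    then show "\<delta> \<in> \<Gamma> 1 \<or> (\<exists>k\<in>{2..c}. \<delta> \<in> \<Gamma> k \<and> v k = 0)"
      using assms by (cases "l = 1") auto
  next
    assume "\<delta> \<in> \<Gamma> 1 \<or> (\<exists>k\<in>{2..c}. \<delta> \<in> \<Gamma> k \<and> v k = 0)"
    then have "\<exists>k\<in>{1..c}. \<delta> \<in> \<Gamma> k \<and> v k = 0"
    proof
      assume "\<delta> \<in> \<Gamma> 1"
      moreover have "v 1 = 0" using VS_outside[OF assms(1), of 1] by simp
      ultimately show ?thesis using one_in by blast
    next
      assume "\<exists>k\<in>{2..c}. \<delta> \<in> \<Gamma> k \<and> v k = 0"
      then obtain k where k: "k \<in> {2..c}" "\<delta> \<in> \<Gamma> k" "v k = 0" by blast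
      then have "k \<in> {1..c}" by simp
      with k show ?thesis by blast
    qed
    then show "v l = 0" using \<Gamma>_unique[OF assms(2) _ assms(3)] by blast
  qed
  then show ?thesis using \<Gamma>_sub[OF assms(2,3)] S_sub by (auto simp: hi_def)
qed

lemma lo_hi_degenerate:
  assumes "\<delta> \<in> vars m" "\<delta> \<notin> S"
  shows "lo v \<delta> = 0" "hi v \<delta> = 0"
proof -
  have "\<delta> \<notin> \<Gamma> l" if "l \<in> {1..c}" for l using assms(2) \<Gamma>_sub that by blast
  then have "\<delta> \<notin> \<Gamma> 1" "\<forall>l\<in>{2..c}. \<delta> \<notin> \<Gamma> l" using one_in by auto
  then show "lo v \<delta> = 0" "hi v \<delta> = 0" using assms(1) by (auto simp: lo_def hi_def)
qed

lemma lo_hi_extensional: "lo v \<in> extensional (vars m)" "hi v \<in> extensional (vars m)"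
  by (auto simp: lo_def hi_def)

lemma lo_hi_cells: "lo v \<in> CL" "hi v \<in> CL"
proof -
  have "0 < I \<delta>" "1 < I \<delta>" if "\<delta> \<in> vars m" for \<delta> using levels that by force+
  then show "lo v \<in> CL" "hi v \<in> CL" by (auto simp: cells_def lo_def hi_def)
qed

lemma pr_cells: "set_mset (pr v) \<subseteq> CL"
  using lo_hi_cells by (simp add: pr_def)

lemma cell_eqI:
  assumes "i \<in> extensional (vars m)" "j \<in> extensional (vars m)"
    and "\<And>\<delta>. \<delta> \<in> vars m - S \<Longrightarrow> i \<delta> = j \<delta>"
    and "\<And>l \<delta>. l \<in> {1..c} \<Longrightarrow> \<delta> \<in> \<Gamma> l \<Longrightarrow> i \<delta> = j \<delta>"
  shows "i = j"
proof (rule extensionalityI[OF assms(1,2)])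
  fix \<delta> assume "\<delta> \<in> vars m"
  show "i \<delta> = j \<delta>"
  proof (cases "\<delta> \<in> S")
    case True
    then obtain l where "l \<in> {1..c}" "\<delta> \<in> \<Gamma> l" by (rule \<Gamma>_cover)
    then show ?thesis by (rule assms(4))
  next
    case False
    then show ?thesis using assms(3) \<open>\<delta> \<in> vars m\<close> by blast
  qed
qed

lemma pr_0: "pr 0 = {#zero_cell, chi S#}"
proof -
  have "lo 0 = zero_cell" by (auto simp: lo_def)
  moreover have "hi 0 = chi S"
  proof (rule cell_eqI)
    show "hi 0 \<delta> = chi S \<delta>" if "l \<in> {1..c}" "\<delta> \<in> \<Gamma> l" for l \<delta>
      using hi_comp[OF gf2_space_zero that] \<Gamma>_sub[OF that] S_sub by (auto simp: chi_def)
    show "hi 0 \<delta> = chi S \<delta>" if "\<delta> \<in> vars m - S" for \<delta>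
      using that lo_hi_degenerate(2) by (simp add: chi_def)
  qed (use lo_hi_extensional in \<open>auto simp: chi_def\<close>)
  ultimately show ?thesis by (simp add: pr_def)
qed

lemma b_fib: "b = fib (pr 0)"
  using Bnd0_fib[OF b] by (simp add: pr_0)

lemma n0_pr: "n0 m I \<D> b = freq (pr 0)"
  by (simp add: n0_freq pr_0)

lemma zv_pr: "zv m I \<D> \<Gamma> b v = freq (pr 0) - freq (pr v)"
  by (simp add: zv_def n0_pr nv_freq)

text \<open>A generator is a clique, so it meets the nondegenerate variables in at most one
  component \<open>\<Gamma> l\<close>. On it the two cells for \<open>v\<close> look like those for
  0, in the same order if \<open>v l = 0\<close> and exchanged if \<open>v l = 1\<close>; the
  marginal does not see the order.\<close>

lemma pr_in_fiber:
  assumes v: "v \<in> VS"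
  shows "freq (pr v) \<in> F"
proof -
  have "restr D (pr 0) = restr D (pr v)" if D: "D \<in> \<D>" for D
  proof (cases "D \<inter> S = {}")
    case True
    then have "lo u \<delta> = 0" "hi u \<delta> = 0" if "\<delta> \<in> D" for u \<delta>
      using that lo_hi_degenerate D_subset[OF D] by blast+
    then have "restrict (lo 0) D = restrict (lo v) D" "restrict (hi 0) D = restrict (hi v) D"
      by (auto simp: restrict_eq_iff)
    then show ?thesis by (simp add: pr_def)
  next
    case False
    then obtain \<delta> where \<delta>: "\<delta> \<in> D" "\<delta> \<in> S" by blast
    obtain l where l: "l \<in> {1..c}" "\<delta> \<in> \<Gamma> l" using \<Gamma>_cover[OF \<delta>(2)] .
    have DS: "\<delta>' \<in> \<Gamma> l" if "\<delta>' \<in> D" "\<delta>' \<in> S" for \<delta>'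
      using \<Gamma>_adjacent[OF l that(2)] D_clique[OF D] \<delta> that l by (cases "\<delta>' = \<delta>") (auto simp: clique_def)
    have val: "lo u \<delta>' = (if \<delta>' \<in> S then of_bool (u l = 1) else 0)"
      "hi u \<delta>' = (if \<delta>' \<in> S then of_bool (u l = 0) else 0)" if "u \<in> VS" "\<delta>' \<in> D" for u \<delta>'
      using that DS lo_comp[OF _ l(1)] hi_comp[OF _ l(1)] lo_hi_degenerate D_subset[OF D] by auto
    consider "v l = 0" | "v l = 1" using bit_cases by blast
    then show ?thesis
    proof cases
      case 1
      then have "restrict (lo 0) D = restrict (lo v) D" "restrict (hi 0) D = restrict (hi v) D"
        using val v gf2_space_zero by (auto simp: restrict_eq_iff)
      then show ?thesis by (simp add: pr_def)
    next
      case 2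
      then have "restrict (lo 0) D = restrict (hi v) D" "restrict (hi 0) D = restrict (lo v) D"
        using val v gf2_space_zero by (auto simp: restrict_eq_iff)
      then show ?thesis by (simp add: pr_def add_mset_commute)
    qed
  qed
  then have "freq (pr v) \<in> fiber m I \<D> (fib (pr 0))"
    by (simp add: freq_in_fiber_iff[OF pr_cells pr_cells] same_margins_def)
  then show ?thesis by (simp only: b_fib[symmetric])
qed

text \<open>For adjacent nondegenerate variables the joint marginal allows only the level pairs
  (0,0) and (1,1), so each cell is constant on every component. The levels of \<open>i\<close> at
  the \<open>rep l\<close> then define \<open>v\<close>; the assumption at \<open>rep 1\<close>
  decides which cell is \<open>lo v\<close>.\<close>

lemma pair_from_levels:
  assumes ij: "i \<in> extensional (vars m)" "j \<in> extensional (vars m)"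
    and sm: "same_margins \<D> (pr 0) {#i, j#}" and i0: "i (rep 1) = 0"
  shows "\<exists>v\<in>VS. i = lo v \<and> j = hi v"
proof -
  have lev: "{#i \<delta>, j \<delta>#} = {#0, chi S \<delta>#}" if "\<delta> \<in> vars m" for \<delta>
    using same_margins_level[OF sm that] that by (simp add: pr_0)
  have adj: "i \<delta> = i \<delta>'" if \<delta>: "\<delta> \<in> S" "\<delta>' \<in> S" "(\<delta>, \<delta>') \<in> E" for \<delta> \<delta>'
  proof -
    have "clique (vars m) E {\<delta>, \<delta>'}"
      using \<delta> S_sub symE by (auto simp: clique_def dest: symD)
    then have "restr {\<delta>, \<delta>'} (pr 0) = restr {\<delta>, \<delta>'} {#i, j#}" by (rule restr_clique[OF sm])
    then show ?thesis
      using \<delta> S_sub by (auto simp: pr_0 pair_mset_eq restrict_eq_iff chi_def subset_iff)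
  qed
  define v where "v = (\<lambda>l. of_bool (l \<in> {2..c} \<and> i (rep l) = 1) :: bit)"
  have v: "v \<in> VS" by (auto simp: gf2_space_def v_def)
  have comp: "i \<delta> = of_bool (v l = 1) \<and> j \<delta> = of_bool (v l = 0)" if l: "l \<in> {1..c}" "\<delta> \<in> \<Gamma> l" for l \<delta>
  proof -
    have S: "\<delta> \<in> S" "\<delta> \<in> vars m" using \<Gamma>_sub[OF l] S_sub by auto
    then have or: "i \<delta> = 0 \<and> j \<delta> = 1 \<or> i \<delta> = 1 \<and> j \<delta> = 0"
      using lev[OF S(2)] by (auto simp: pair_mset_eq chi_def)
    have "i \<delta> = i (rep l)" using \<Gamma>_constant[of i, OF adj l rep[OF l(1)]] by blast
    moreover have "v l = 1 \<longleftrightarrow> i (rep l) = 1" using l(1) i0 by (cases "l = 1") (auto simp: v_def)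
    ultimately show ?thesis using or bit_cases[of "v l"] by auto
  qed
  have deg: "i \<delta> = 0 \<and> j \<delta> = 0" if "\<delta> \<in> vars m - S" for \<delta>
    using lev[of \<delta>] that by (auto simp: pair_mset_eq chi_def)
  have "i = lo v"
  proof (rule cell_eqI[OF ij(1) lo_hi_extensional(1)])
    show "i \<delta> = lo v \<delta>" if "\<delta> \<in> vars m - S" for \<delta>
      using deg[OF that] lo_hi_degenerate(1)[of \<delta> v] that by simp
    show "i \<delta> = lo v \<delta>" if "l \<in> {1..c}" "\<delta> \<in> \<Gamma> l" for l \<delta>
      using comp[OF that] lo_comp[OF v that] by simp
  qed
  moreover have "j = hi v"
  proof (rule cell_eqI[OF ij(2) lo_hi_extensional(2)])
    show "j \<delta> = hi v \<delta>" if "\<delta> \<in> vars m - S" for \<delta>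
      using deg[OF that] lo_hi_degenerate(2)[of \<delta> v] that by simp
    show "j \<delta> = hi v \<delta>" if "l \<in> {1..c}" "\<delta> \<in> \<Gamma> l" for l \<delta>
      using comp[OF that] hi_comp[OF v that] by simp
  qed
  ultimately show ?thesis using v by blast
qed

lemma fiber_pr: "F = (\<lambda>v. freq (pr v)) ` VS"
proof
  show "F \<subseteq> (\<lambda>v. freq (pr v)) ` VS"
  proof
    fix n assume "n \<in> F"
    then obtain Y where Y: "set_mset Y \<subseteq> CL" "n = freq Y" "same_margins \<D> (pr 0) Y"
      using fiber_freq_iff[OF pr_cells[of 0], of n \<D>] unfolding b_fib[symmetric] by blast
    have "size Y = 2" using same_margins_size[OF Y(3)] by (simp add: pr_def)
    then obtain i j where ij: "Y = {#i, j#}" unfolding size2_iff by (elim exE)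
    have ext: "i \<in> extensional (vars m)" "j \<in> extensional (vars m)"
      using Y(1) ij by (auto simp: cells_def PiE_iff)
    have "rep 1 \<in> vars m" using \<Gamma>_sub[OF one_in rep[OF one_in]] S_sub by blast
    then have "i (rep 1) = 0 \<or> j (rep 1) = 0"
      using same_margins_level[OF Y(3), of "rep 1"] by (auto simp: ij pr_0 pair_mset_eq)
    then obtain v where "v \<in> VS" "Y = pr v"
      using pair_from_levels[OF ext] pair_from_levels[OF ext(2,1)] Y(3)
      by (auto simp: ij pr_def add_mset_commute)
    then show "n \<in> (\<lambda>v. freq (pr v)) ` VS" using Y(2) by blast
  qed
  show "(\<lambda>v. freq (pr v)) ` VS \<subseteq> F" using pr_in_fiber by blast
qed

lemma level_one: "v \<in> VS \<Longrightarrow> lo v (rep 1) = 0" "v \<in> VS \<Longrightarrow> hi v (rep 1) = 1"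
  using lo_comp[OF _ one_in rep[OF one_in]] hi_comp[OF _ one_in rep[OF one_in]] VS_outside[of _ 1] by auto

text \<open>Comparing the marginals of the pairs of variables with one member in \<open>\<Gamma> 1\<close> recovers a vector
  from its table; this criterion is invariant under all level permutations.\<close>

lemma restr_pair_iff:
  assumes "u \<in> VS" "v \<in> VS" "l \<in> {1..c}"
  shows "restr {rep 1, rep l} (pr u) = restr {rep 1, rep l} (pr v) \<longleftrightarrow> u l = v l"
  using level_one[OF assms(1)] level_one[OF assms(2)] lo_comp[OF _ assms(3) rep[OF assms(3)]]
    hi_comp[OF _ assms(3) rep[OF assms(3)]] assms(1,2) bit_cases[of "u l"] bit_cases[of "v l"]
  by (auto simp: pr_def pair_mset_eq restrict_eq_iff)

lemma VS_eqI: "u \<in> VS \<Longrightarrow> v \<in> VS \<Longrightarrow> (\<And>l. l \<in> {1..c} \<Longrightarrow> u l = v l) \<Longrightarrow> u = v"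
proof
  fix l assume "u \<in> VS" "v \<in> VS" "\<And>l. l \<in> {1..c} \<Longrightarrow> u l = v l"
  then show "u l = v l" using VS_outside[of u l] VS_outside[of v l] by (cases "l \<in> {2..c}") simp_all
qed

lemma pr_inject: "u \<in> VS \<Longrightarrow> v \<in> VS \<Longrightarrow> pr u = pr v \<longleftrightarrow> u = v"
  using restr_pair_iff VS_eqI by metis

text \<open>A single cell determines the vector: its level at \<open>rep 1\<close> tells
  \<open>lo\<close> from \<open>hi\<close>, and the other representatives give the coordinates.
  Disjoint supports are what \<open>freq_diff_inject\<close> needs to recover both tables from a
  move.\<close>

lemma pr_disjoint:
  assumes u: "u \<in> VS" and v: "v \<in> VS" and ne: "u \<noteq> v"
  shows "pr u \<inter># pr v = {#}"
proof -
  obtain l where l: "l \<in> {1..c}" "u l \<noteq> v l" using VS_eqI[OF u v] ne by blast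
  note lv = lo_comp[OF _ l(1) rep[OF l(1)]] hi_comp[OF _ l(1) rep[OF l(1)]]
  have "lo u (rep l) \<noteq> lo v (rep l)" "hi u (rep l) \<noteq> hi v (rep l)"
    using lv[OF u] lv[OF v] l(2) bit_cases[of "u l"] bit_cases[of "v l"] by auto
  then have "lo u \<noteq> lo v" "hi u \<noteq> hi v" by auto
  moreover have "lo u \<noteq> hi v" "hi u \<noteq> lo v"
    using fun_cong[of "lo u" "hi v" "rep 1"] fun_cong[of "hi u" "lo v" "rep 1"]
      level_one[OF u] level_one[OF v] by auto
  ultimately show ?thesis by (auto simp: pr_def disjunct_not_in)
qed

definition mv :: "(nat \<Rightarrow> bit) \<Rightarrow> (nat \<Rightarrow> bit) \<Rightarrow> arr set"
  where "mv u v = up_to_sign (freq (pr u) - freq (pr v))"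

lemma zv_mv: "up_to_sign (zv m I \<D> \<Gamma> b v) = mv 0 v"
  by (simp add: zv_pr mv_def)

text \<open>A move up to sign determines the unordered pair of its tables, and the sum of the two
  vectors is insensitive to their order.\<close>

lemma mv_sum_unique:
  assumes VS: "u \<in> VS" "v \<in> VS" "u' \<in> VS" "v' \<in> VS" and ne: "u \<noteq> v" and eq: "mv u v = mv u' v'"
  shows "u + v = u' + v'"
proof -
  from eq consider "freq (pr u) - freq (pr v) = freq (pr u') - freq (pr v')"
    | "freq (pr u) - freq (pr v) = freq (pr v') - freq (pr u')"
    by (auto simp: mv_def up_to_sign_eq_iff)
  note cases = this
  have "u' \<noteq> v'"
  proof
    assume "u' = v'"
    with cases have "freq (pr u) = freq (pr v)" by auto
    then show False using pr_inject[OF VS(1,2)] ne by simp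
  qed
  with cases show ?thesis
  proof cases
    case 1
    then have "pr u = pr u' \<and> pr v = pr v'"
      by (intro freq_diff_inject pr_disjoint VS ne \<open>u' \<noteq> v'\<close>)
    then show ?thesis using pr_inject VS by simp
  next
    case 2
    then have "pr u = pr v' \<and> pr v = pr u'"
      by (intro freq_diff_inject pr_disjoint VS ne \<open>u' \<noteq> v'\<close>[symmetric])
    then show ?thesis using pr_inject VS by (simp add: add.commute)
  qed
qed

section \<open>The action of \<open>G\<^sub>b\<close> by translations\<close>

lemma H_sub: "H \<subseteq> G"
  by (auto simp: Gb_def)

text \<open>A permutation of \<open>{0, 1}\<close> is the identity or the swap, that is, addition of
  its value at 0 modulo 2; hence \<open>w l\<close> is read off from \<open>s l 0\<close>. As
  \<open>\<Gamma> 1\<close> is fixed, \<open>lo\<close> goes to \<open>lo\<close> and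
  \<open>hi\<close> to \<open>hi\<close>.\<close>

lemma act_shift_cell:
  assumes g: "\<forall>l\<in>{2..c}. s l permutes {0, 1}" "\<forall>l\<in>{2..c}. \<forall>\<delta>\<in>\<Gamma> l. g \<delta> = s l"
      "\<forall>\<delta>\<in>vars m - (\<Union>l\<in>{2..c}. \<Gamma> l). g \<delta> = id"
    and w: "w \<in> VS" "\<forall>l\<in>{2..c}. w l = of_bool (s l 0 = 1)"
    and v: "v \<in> VS"
  shows "act_cell m g (lo v) = lo (v + w)" "act_cell m g (hi v) = hi (v + w)"
proof -
  note vw = gf2_space_add[OF v w(1)]
  have act: "act_cell m g i \<delta> = g \<delta> (i \<delta>)" if "\<delta> \<in> vars m" for i \<delta>
    using that by (simp add: act_cell_def)
  have ext: "act_cell m g i \<in> extensional (vars m)" for i by (simp add: act_cell_def)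
  have deg: "g \<delta> = id" if "\<delta> \<in> vars m - S" for \<delta>
  proof -
    have "\<delta> \<notin> \<Gamma> l" if "l \<in> {2..c}" for l using \<open>\<delta> \<in> vars m - S\<close> \<Gamma>_sub[of l \<delta>] that by auto
    then show ?thesis using g(3) that by blast
  qed
  have one: "g \<delta> = id" if "\<delta> \<in> \<Gamma> 1" for \<delta>
  proof -
    have "\<delta> \<notin> \<Gamma> l" if "l \<in> {2..c}" for l
      using \<Gamma>_unique[OF one_in, of l \<delta>] \<open>\<delta> \<in> \<Gamma> 1\<close> that by auto
    moreover have "\<delta> \<in> vars m" using \<Gamma>_sub[OF one_in that] S_sub by blast
    ultimately show ?thesis using g(3) by blast
  qed
  have comp: "g \<delta> (lo v \<delta>) = lo (v + w) \<delta> \<and> g \<delta> (hi v \<delta>) = hi (v + w) \<delta>"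
    if l: "l \<in> {1..c}" "\<delta> \<in> \<Gamma> l" for l \<delta>
  proof (cases "l = 1")
    case True
    have "w 1 = 0" using VS_outside[OF w(1), of 1] by simp
    then show ?thesis
      using one[of \<delta>] l True lo_comp[OF v l] lo_comp[OF vw l] hi_comp[OF v l] hi_comp[OF vw l] by simp
  next
    case False
    then have l2: "l \<in> {2..c}" using l(1) by simp
    then have p: "s l permutes {0, 1}" and gs: "g \<delta> = s l" using g l(2) by auto
    have "s l 0 \<in> {0, 1}" "s l 1 \<in> {0, 1}" using permutes_in_image[OF p] by auto
    moreover have "s l 0 \<noteq> s l 1" using permutes_inj[OF p] by (metis injD zero_neq_one)
    moreover have "w l = of_bool (s l 0 = 1)" using w(2) l2 by blast
    ultimately show ?thesis
      using gs lo_comp[OF v l] lo_comp[OF vw l] hi_comp[OF v l] hi_comp[OF vw l]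
        bit_cases[of "v l"] by auto
  qed
  show "act_cell m g (lo v) = lo (v + w)"
  proof (rule cell_eqI[OF ext lo_hi_extensional(1)])
    show "act_cell m g (lo v) \<delta> = lo (v + w) \<delta>" if "\<delta> \<in> vars m - S" for \<delta>
      using deg[OF that] that lo_hi_degenerate(1)[of \<delta>] by (simp add: act)
    show "act_cell m g (lo v) \<delta> = lo (v + w) \<delta>" if "l \<in> {1..c}" "\<delta> \<in> \<Gamma> l" for l \<delta>
    proof -
      have "\<delta> \<in> vars m" using \<Gamma>_sub[OF that] S_sub by blast
      then show ?thesis using comp[OF that] by (simp only: act)
    qed
  qed
  show "act_cell m g (hi v) = hi (v + w)"
  proof (rule cell_eqI[OF ext lo_hi_extensional(2)])
    show "act_cell m g (hi v) \<delta> = hi (v + w) \<delta>" if "\<delta> \<in> vars m - S" for \<delta>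
      using deg[OF that] that lo_hi_degenerate(2)[of \<delta>] by (simp add: act)
    show "act_cell m g (hi v) \<delta> = hi (v + w) \<delta>" if "l \<in> {1..c}" "\<delta> \<in> \<Gamma> l" for l \<delta>
    proof -
      have "\<delta> \<in> vars m" using \<Gamma>_sub[OF that] S_sub by blast
      then show ?thesis using comp[OF that] by (simp only: act)
    qed
  qed
qed

lemma H_acts_by_translation:
  assumes "g \<in> H"
  obtains w where "w \<in> VS" "\<And>v. v \<in> VS \<Longrightarrow> act_mset m g (pr v) = pr (v + w)"
proof -
  obtain s where s: "\<forall>l\<in>{2..c}. s l permutes {0, 1}" "\<forall>l\<in>{2..c}. \<forall>\<delta>\<in>\<Gamma> l. g \<delta> = s l"
      "\<forall>\<delta>\<in>vars m - (\<Union>l\<in>{2..c}. \<Gamma> l). g \<delta> = id"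
    using assms unfolding Gb_def by blast
  define w where "w = (\<lambda>l. of_bool (l \<in> {2..c} \<and> s l 0 = 1) :: bit)"
  have w: "w \<in> VS" "\<forall>l\<in>{2..c}. w l = of_bool (s l 0 = 1)" by (auto simp: w_def gf2_space_def)
  show ?thesis
    using that[OF w(1)] act_shift_cell[OF s w] by (simp add: pr_def)
qed

lemma translation_in_H:
  assumes w: "w \<in> VS"
  obtains g where "g \<in> H" "\<And>v. v \<in> VS \<Longrightarrow> act_mset m g (pr v) = pr (v + w)"
proof -
  define s where "s = (\<lambda>l. if w l = 1 then transpose 0 1 else (id :: nat \<Rightarrow> nat))"
  define g where "g = (\<lambda>\<delta>\<in>vars m. if \<exists>l\<in>{2..c}. \<delta> \<in> \<Gamma> l \<and> w l = 1 then transpose 0 1 else (id :: nat \<Rightarrow> nat))"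
  have s: "\<forall>l\<in>{2..c}. s l permutes {0, 1}"
    by (auto simp: s_def intro: permutes_swap_id permutes_id)
  have gs: "\<forall>l\<in>{2..c}. \<forall>\<delta>\<in>\<Gamma> l. g \<delta> = s l"
  proof (intro ballI)
    fix l \<delta> assume l: "l \<in> {2..c}" "\<delta> \<in> \<Gamma> l"
    then have l1: "l \<in> {1..c}" by simp
    have "\<delta> \<in> vars m" using \<Gamma>_sub[OF l1 l(2)] S_sub by blast
    moreover have "(\<exists>k\<in>{2..c}. \<delta> \<in> \<Gamma> k \<and> w k = 1) \<longleftrightarrow> w l = 1"
    proof
      assume "\<exists>k\<in>{2..c}. \<delta> \<in> \<Gamma> k \<and> w k = 1"
      then obtain k where k: "k \<in> {2..c}" "\<delta> \<in> \<Gamma> k" "w k = 1" by blast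
      then have "k = l" using \<Gamma>_unique[of k l \<delta>] l l1 by simp
      then show "w l = 1" using k by simp
    qed (use l in blast)
    ultimately show "g \<delta> = s l" by (simp add: g_def s_def)
  qed
  have gid: "\<forall>\<delta>\<in>vars m - (\<Union>l\<in>{2..c}. \<Gamma> l). g \<delta> = id"
    by (auto simp: g_def)
  have "g \<delta> permutes {..<I \<delta>}" if "\<delta> \<in> vars m" for \<delta>
  proof -
    have "0 < I \<delta>" "1 < I \<delta>" using levels that by force+
    then show ?thesis using that by (auto simp: g_def intro: permutes_swap_id permutes_id)
  qed
  then have "g \<in> G" by (auto simp: level_perms_def g_def)
  then have "g \<in> H" using s gs gid unfolding Gb_def by blast
  moreover have "\<forall>l\<in>{2..c}. w l = of_bool (s l 0 = 1)" using bit_cases by (auto simp: s_def)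
  ultimately show ?thesis
    using that[of g] act_shift_cell[OF s gs gid w] by (simp add: pr_def)
qed

lemma act_move_mv:
  assumes "g \<in> G" "act_mset m g (pr u) = pr u'" "act_mset m g (pr v) = pr v'"
  shows "act_move m I g (mv u v) = mv u' v'"
  using act_move_freq[OF assms(1) pr_cells pr_cells] assms(2,3) by (simp add: mv_def)

lemma orbit_mv:
  assumes "u \<in> VS" "v \<in> VS"
  shows "orbit m I H (mv u v) = (\<lambda>w. mv (u + w) (v + w)) ` VS"
proof (intro equalityI subsetI)
  fix Z assume "Z \<in> orbit m I H (mv u v)"
  then obtain g where g: "g \<in> H" "Z = act_move m I g (mv u v)" by (auto simp: orbit_def)
  obtain w where w: "w \<in> VS" "\<And>v. v \<in> VS \<Longrightarrow> act_mset m g (pr v) = pr (v + w)"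
    using g(1) by (rule H_acts_by_translation) blast
  have "Z = mv (u + w) (v + w)"
    unfolding g(2) by (intro act_move_mv w(2) assms) (use H_sub g(1) in blast)
  then show "Z \<in> (\<lambda>w. mv (u + w) (v + w)) ` VS" using w(1) by blast
next
  fix Z assume "Z \<in> (\<lambda>w. mv (u + w) (v + w)) ` VS"
  then obtain w where w: "w \<in> VS" "Z = mv (u + w) (v + w)" by blast
  obtain g where g: "g \<in> H" "\<And>v. v \<in> VS \<Longrightarrow> act_mset m g (pr v) = pr (v + w)"
    using w(1) by (rule translation_in_H) blast
  have "Z = act_move m I g (mv u v)"
    unfolding w(2) by (rule act_move_mv[symmetric]) (use H_sub g assms in auto)
  then show "Z \<in> orbit m I H (mv u v)" using g(1) by (simp add: orbit_def)
qed

lemma orbit_mv_sum: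
  assumes "u \<in> VS" "v \<in> VS"
  shows "orbit m I H (mv u v) = orbit m I H (mv 0 (u + v))"
proof -
  have "orbit m I H (mv u v) = (\<lambda>w. mv (0 + w) (u + v + w)) ` VS"
    unfolding orbit_mv[OF assms]
  proof (intro equalityI subsetI; elim imageE)
    fix Z w assume w: "w \<in> VS" "Z = mv (u + w) (v + w)"
    have "u + v + (u + w) = u + (u + (v + w))" by (simp only: ac_simps)
    then have "u + v + (u + w) = v + w" by (simp only: bit_fun_add_cancel)
    then have "Z = mv (0 + (u + w)) (u + v + (u + w))" using w(2) by (simp only: add_0)
    then show "Z \<in> (\<lambda>w. mv (0 + w) (u + v + w)) ` VS"
      using gf2_space_add[OF assms(1) w(1)] by blast
  next
    fix Z w assume w: "w \<in> VS" "Z = mv (0 + w) (u + v + w)"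
    have "v + (u + w) = u + v + w" by (simp only: ac_simps)
    then have "Z = mv (u + (u + w)) (v + (u + w))" using w(2) by (simp only: bit_fun_add_cancel add_0)
    then show "Z \<in> (\<lambda>w. mv (u + w) (v + w)) ` VS"
      using gf2_space_add[OF assms(1) w(1)] by blast
  qed
  then show ?thesis by (simp only: orbit_mv[OF gf2_space_zero gf2_space_add[OF assms]])
qed

lemma mv_in_orbit: "u \<in> VS \<Longrightarrow> v \<in> VS \<Longrightarrow> mv u v \<in> orbit m I H (mv u v)"
  unfolding orbit_mv using gf2_space_zero by (intro image_eqI[of _ _ 0]) (simp_all only: add_0_right)

section \<open>Directions of an invariant set of moves and connectedness\<close>

lemma orbit_sub_invariant: "invariant m I H M \<Longrightarrow> Z \<in> M \<Longrightarrow> orbit m I H Z \<subseteq> M"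
  by (auto simp: invariant_def orbit_def)

text \<open>\<open>mv 0 0\<close> is the zero move, which belongs to \<open>moves\<close> and so may
  occur in a Markov basis; the vector 0 is excluded because it would destroy independence.\<close>

definition dirs :: "arr set set \<Rightarrow> (nat \<Rightarrow> bit) set"
  where "dirs M = {v \<in> VS. v \<noteq> 0 \<and> mv 0 v \<in> M}"

lemma dirs_sub: "dirs M \<subseteq> VS"
  by (auto simp: dirs_def)

lemma mv_mem_iff:
  assumes inv: "invariant m I H M" and VS: "u \<in> VS" "v \<in> VS" "u \<noteq> v"
  shows "mv u v \<in> M \<longleftrightarrow> u + v \<in> dirs M"
proof -
  have uv: "u + v \<in> VS" "u + v \<noteq> 0" using VS gf2_space_add bit_fun_add_eq_0_iff by auto
  have "mv u v \<in> M \<longleftrightarrow> mv 0 (u + v) \<in> M"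
    using orbit_sub_invariant[OF inv] orbit_mv_sum[OF VS(1,2)] mv_in_orbit[OF VS(1,2)]
      mv_in_orbit[OF gf2_space_zero uv(1)] by blast
  then show ?thesis using uv by (simp add: dirs_def)
qed

abbreviation "rel M \<equiv> move_rel M F"

lemma rel_pr_iff:
  "u \<in> VS \<Longrightarrow> v \<in> VS \<Longrightarrow> (freq (pr u), freq (pr v)) \<in> rel M \<longleftrightarrow> mv u v \<in> M"
  using pr_in_fiber by (simp add: mv_def up_to_sign_commute)

lemma rel_steps_of_span:
  assumes inv: "invariant m I H M" and u: "u \<in> gf2.span (dirs M)" and x: "x \<in> VS"
  shows "(freq (pr x), freq (pr (x + u))) \<in> (rel M)\<^sup>*"
proof -
  \<comment> \<open>All starting points are needed at once: after a step in direction
    \<open>t\<close> the remaining path starts at \<open>x + t\<close>.\<close>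
  have "u \<in> VS \<and> (\<forall>x\<in>VS. (freq (pr x), freq (pr (x + u))) \<in> (rel M)\<^sup>*)"
    using u
  proof (induction rule: gf2.span_induct_alt)
    case base
    show ?case unfolding add_0_right using gf2_space_zero by blast
  next
    case (step a t y)
    show ?case
    proof (cases "a = 0")
      case True
      then have "(\<lambda>l. a * t l) + y = y" by (simp add: fun_eq_iff)
      then show ?thesis using step by simp
    next
      case False
      then have "a = 1" using bit_cases by blast
      then have at: "(\<lambda>l. a * t l) = t" by (simp add: fun_eq_iff)
      have t: "t \<in> VS" "t \<noteq> 0" using step by (auto simp: dirs_def)
      have "(freq (pr x), freq (pr (x + (t + y)))) \<in> (rel M)\<^sup>*" if x: "x \<in> VS" for x
      proof -
        have xt: "x + t \<in> VS" using x t gf2_space_add by blast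
        have xxt: "x + (x + t) = t" by (rule bit_fun_add_cancel)
        have "x \<noteq> x + t" using t(2) by simp
        then have "mv x (x + t) \<in> M" using mv_mem_iff[OF inv x xt] xxt step(1) by simp
        then have "(freq (pr x), freq (pr (x + t))) \<in> (rel M)\<^sup>*"
          unfolding rel_pr_iff[OF x xt, symmetric] by (rule r_into_rtrancl)
        moreover have "(freq (pr (x + t)), freq (pr (x + t + y))) \<in> (rel M)\<^sup>*" using step xt by blast
        ultimately show ?thesis unfolding add.assoc by (rule rtrancl_trans)
      qed
      then show ?thesis unfolding at using t step gf2_space_add by blast
    qed
  qed
  then show ?thesis using x by blast
qed

lemma span_of_rel_steps:
  assumes inv: "invariant m I H M" and x: "x \<in> VS" and st: "(freq (pr x), n) \<in> (rel M)\<^sup>*"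
  shows "\<exists>y\<in>VS. n = freq (pr y) \<and> x + y \<in> gf2.span (dirs M)"
  using st
proof (induction rule: rtrancl_induct)
  case base
  have "x + x \<in> gf2.span (dirs M)" unfolding bit_fun_add_self by (rule gf2.span_zero)
  then show ?case using x by blast
next
  case (step n n')
  then obtain y where y: "y \<in> VS" "n = freq (pr y)" "x + y \<in> gf2.span (dirs M)" by blast
  have "n' \<in> F" using step(2) by blast
  then obtain z where z: "z \<in> VS" "n' = freq (pr z)" unfolding fiber_pr by blast
  have "x + z \<in> gf2.span (dirs M)"
  proof (cases "y = z")
    case False
    have "mv y z \<in> M" using step(2) rel_pr_iff[OF y(1) z(1)] y(2) z(2) by blast
    then have "y + z \<in> gf2.span (dirs M)"
      using mv_mem_iff[OF inv y(1) z(1) False] gf2.span_base by blast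
    \<comment> \<open>The directions of successive steps telescope, because \<open>y\<close> cancels
      in characteristic 2.\<close>
    then have "(x + y) + (y + z) \<in> gf2.span (dirs M)" using y(3) gf2.span_add by blast
    moreover have "(x + y) + (y + z) = x + z"
      unfolding add.assoc bit_fun_add_cancel ..
    ultimately show ?thesis by simp
  qed (use y in simp)
  then show ?case using z by blast
qed

lemma connects_iff_span:
  assumes inv: "invariant m I H M"
  shows "connects M F \<longleftrightarrow> gf2.span (dirs M) = VS"
proof
  assume con: "connects M F"
  have "v \<in> gf2.span (dirs M)" if v: "v \<in> VS" for v
  proof -
    have "(freq (pr 0), freq (pr v)) \<in> (rel M)\<^sup>*"
      using con pr_in_fiber[OF v] pr_in_fiber[OF gf2_space_zero] unfolding connects_def by blast
    from span_of_rel_steps[OF inv gf2_space_zero this]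
    obtain y where "y \<in> VS" "freq (pr v) = freq (pr y)" "0 + y \<in> gf2.span (dirs M)" by blast
    then show ?thesis using pr_inject[OF v] by simp
  qed
  then show "gf2.span (dirs M) = VS" using span_subset_gf2_space[OF dirs_sub] by blast
next
  assume sp: "gf2.span (dirs M) = VS"
  show "connects M F"
    unfolding connects_def
  proof (intro ballI)
    fix n n' assume "n \<in> F" "n' \<in> F"
    then obtain x y where xy: "x \<in> VS" "y \<in> VS" "n = freq (pr x)" "n' = freq (pr y)"
      unfolding fiber_pr by blast
    have "x + y \<in> gf2.span (dirs M)" using xy gf2_space_add sp by blast
    then have "(freq (pr x), freq (pr (x + (x + y)))) \<in> (rel M)\<^sup>*"
      by (rule rel_steps_of_span[OF inv _ xy(1)])
    then show "(n, n') \<in> (rel M)\<^sup>*" by (simp only: bit_fun_add_cancel xy)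
  qed
qed

lemma fiber_moves_iff:
  "Z \<in> fiber_moves m I \<D> b \<longleftrightarrow> (\<exists>u\<in>VS. \<exists>v\<in>VS. u \<noteq> v \<and> Z = mv u v)"
proof
  assume "Z \<in> fiber_moves m I \<D> b"
  then obtain n n' where n: "Z = up_to_sign (n - n')" "n \<in> F" "n' \<in> F" "n \<noteq> n'"
    unfolding fiber_moves_def by blast
  then obtain u v where "u \<in> VS" "v \<in> VS" "n = freq (pr u)" "n' = freq (pr v)"
    unfolding fiber_pr by blast
  moreover from this have "u \<noteq> v" using n(4) by blast
  ultimately show "\<exists>u\<in>VS. \<exists>v\<in>VS. u \<noteq> v \<and> Z = mv u v" using n(1) unfolding mv_def by blast
next
  assume "\<exists>u\<in>VS. \<exists>v\<in>VS. u \<noteq> v \<and> Z = mv u v"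
  then obtain u v where uv: "u \<in> VS" "v \<in> VS" "u \<noteq> v" "Z = mv u v" by blast
  then have "freq (pr u) \<noteq> freq (pr v)" using pr_inject by simp
  then show "Z \<in> fiber_moves m I \<D> b"
    using uv pr_in_fiber unfolding fiber_moves_def mv_def by blast
qed

section \<open>Orbits of moves and minimal invariant sets in one fiber\<close>

definition orb :: "(nat \<Rightarrow> bit) \<Rightarrow> arr set set"
  where "orb v = orbit m I H (mv 0 v)"

lemma orb_mv: "v \<in> VS \<Longrightarrow> orb v = (\<lambda>w. mv w (v + w)) ` VS"
  unfolding orb_def using orbit_mv[OF gf2_space_zero] by (simp only: add_0)

lemma mv_in_orb_iff:
  assumes "v \<in> VS" "u \<in> VS" "u' \<in> VS" "u \<noteq> u'"
  shows "mv u u' \<in> orb v \<longleftrightarrow> u + u' = v"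
proof
  assume "mv u u' \<in> orb v"
  then obtain w where w: "w \<in> VS" "mv u u' = mv w (v + w)" using orb_mv[OF assms(1)] by blast
  have "u + u' = w + (v + w)"
    using mv_sum_unique[OF assms(2,3) w(1) gf2_space_add[OF assms(1) w(1)] assms(4) w(2)] .
  also have "\<dots> = w + (w + v)" by (simp only: ac_simps)
  also have "\<dots> = v" by (rule bit_fun_add_cancel)
  finally show "u + u' = v" .
next
  assume "u + u' = v"
  then show "mv u u' \<in> orb v"
    using orbit_mv_sum[OF assms(2,3)] mv_in_orbit[OF assms(2,3)] by (simp only: orb_def)
qed

lemma orb_inj:
  assumes "u \<in> VS" "u \<noteq> 0" "v \<in> VS" "orb u = orb v"
  shows "u = v"
proof -
  have "mv 0 u \<in> orb u" unfolding orb_def by (rule mv_in_orbit[OF gf2_space_zero assms(1)])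
  then have "mv 0 u \<in> orb v" using assms(4) by blast
  then show ?thesis
    using mv_in_orb_iff[OF assms(3) gf2_space_zero assms(1) assms(2)[symmetric]] by (simp only: add_0)
qed

lemma invariant_orbs:
  assumes "T \<subseteq> VS"
  shows "invariant m I H (\<Union>v\<in>T. orb v)"
  unfolding invariant_def
proof (intro ballI)
  fix g Z assume g: "g \<in> H" and Z: "Z \<in> (\<Union>v\<in>T. orb v)"
  then obtain v w where v: "v \<in> T" and w: "w \<in> VS" "Z = mv w (v + w)" using orb_mv assms by blast
  have vVS: "v \<in> VS" using v assms by blast
  obtain t where t: "t \<in> VS" "\<And>v. v \<in> VS \<Longrightarrow> act_mset m g (pr v) = pr (v + t)"
    using g by (rule H_acts_by_translation) blast
  have "act_move m I g Z = mv (w + t) (v + w + t)"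
    unfolding w(2) by (intro act_move_mv t(2) w(1) gf2_space_add vVS) (use H_sub g in blast)
  then have "act_move m I g Z = mv (w + t) (v + (w + t))" by (simp only: add.assoc)
  then have "act_move m I g Z \<in> orb v" using orb_mv[OF vVS] gf2_space_add[OF w(1) t(1)] by blast
  then show "act_move m I g Z \<in> (\<Union>v\<in>T. orb v)" using v by blast
qed

lemma dirs_orbs:
  assumes "T \<subseteq> VS" "0 \<notin> T"
  shows "dirs (\<Union>v\<in>T. orb v) = T"
proof (intro equalityI subsetI)
  fix v assume "v \<in> dirs (\<Union>v\<in>T. orb v)"
  then obtain t where v: "v \<in> VS" "v \<noteq> 0" and t: "t \<in> T" "mv 0 v \<in> orb t" by (auto simp: dirs_def)
  then have "0 + v = t" using mv_in_orb_iff[OF _ gf2_space_zero v(1) v(2)[symmetric]] assms by blast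
  then show "v \<in> T" using t by (simp only: add_0)
next
  fix v assume v: "v \<in> T"
  then have "v \<in> VS" "v \<noteq> 0" using assms by auto
  moreover have "mv 0 v \<in> orb v"
    unfolding orb_def by (rule mv_in_orbit[OF gf2_space_zero \<open>v \<in> VS\<close>])
  ultimately show "v \<in> dirs (\<Union>v\<in>T. orb v)" using v by (auto simp: dirs_def)
qed

text \<open>Together with \<open>invariant_orbs\<close> and \<open>dirs_orbs\<close> this sets up an
  inclusion-preserving correspondence between invariant sets of moves in the fiber and sets of
  nonzero vectors, along which minimality is transported.\<close>

lemma invariant_eq_orbs:
  assumes M: "M \<subseteq> fiber_moves m I \<D> b" and inv: "invariant m I H M"
  shows "M = (\<Union>v\<in>dirs M. orb v)" "orbits m I H M = orb ` dirs M"
proof -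
  have rep: "\<exists>v\<in>dirs M. orbit m I H Z = orb v \<and> Z \<in> orb v" if Z: "Z \<in> M" for Z
  proof -
    obtain u v where uv: "u \<in> VS" "v \<in> VS" "u \<noteq> v" "Z = mv u v"
      using Z M fiber_moves_iff by blast
    then have "u + v \<in> dirs M" using mv_mem_iff[OF inv] Z by blast
    moreover have "orbit m I H Z = orb (u + v)" "Z \<in> orb (u + v)"
      using orbit_mv_sum[OF uv(1,2)] mv_in_orbit[OF uv(1,2)] uv(4) by (simp_all only: orb_def)
    ultimately show ?thesis by blast
  qed
  have sub: "orb v \<subseteq> M" "orb v \<in> orbits m I H M" if "v \<in> dirs M" for v
  proof -
    have "mv 0 v \<in> M" using that by (simp add: dirs_def)
    then show "orb v \<subseteq> M" "orb v \<in> orbits m I H M"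
      using orbit_sub_invariant[OF inv] unfolding orb_def orbits_def by blast+
  qed
  show "M = (\<Union>v\<in>dirs M. orb v)" using rep sub(1) by blast
  show "orbits m I H M = orb ` dirs M"
  proof
    show "orbits m I H M \<subseteq> orb ` dirs M"
      unfolding orbits_def using rep by blast
    show "orb ` dirs M \<subseteq> orbits m I H M" using sub(2) by blast
  qed
qed

lemma zero_notin_dirs: "0 \<notin> dirs M"
  by (simp add: dirs_def)

lemma dirs_mono: "M' \<subseteq> M \<Longrightarrow> dirs M' \<subseteq> dirs M"
  by (auto simp: dirs_def)

lemma minimal_iff_dirs_basis:
  assumes M: "M \<subseteq> fiber_moves m I \<D> b" and inv: "invariant m I H M"
  shows "minimal_invariant_connecting m I H F M \<longleftrightarrow> gf2_basis c (dirs M)"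
proof
  assume min: "minimal_invariant_connecting m I H F M"
  have "gf2.span T' \<noteq> VS" if T': "T' \<subset> dirs M" for T'
  proof
    assume sp: "gf2.span T' = VS"
    let ?M' = "\<Union>v\<in>T'. orb v"
    have T'VS: "T' \<subseteq> VS" "0 \<notin> T'" using T' dirs_sub zero_notin_dirs by auto
    have inv': "invariant m I H ?M'" using T'VS(1) by (rule invariant_orbs)
    have d: "dirs ?M' = T'" using T'VS by (rule dirs_orbs)
    have "?M' \<subseteq> M" using invariant_eq_orbs(1)[OF M inv] T' by blast
    moreover have "?M' \<noteq> M" using d T' by auto
    moreover have "connects ?M' F" using connects_iff_span[OF inv'] d sp by simp
    ultimately show False using min inv' unfolding minimal_invariant_connecting_def by blast
  qed
  moreover have "gf2.span (dirs M) = VS"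
    using min connects_iff_span[OF inv] by (simp add: minimal_invariant_connecting_def)
  ultimately show "gf2_basis c (dirs M)" using gf2_basis_iff_minimal[OF dirs_sub] by blast
next
  assume basis: "gf2_basis c (dirs M)"
  then have sp: "gf2.span (dirs M) = VS" by (simp add: gf2_basis_def)
  have "\<not> connects M' F" if M': "M' \<subset> M" "invariant m I H M'" for M'
  proof
    assume "connects M' F"
    then have "gf2.span (dirs M') = VS" using connects_iff_span[OF M'(2)] by simp
    moreover have "dirs M' \<subseteq> dirs M" using dirs_mono M'(1) by blast
    ultimately have "dirs M' = dirs M" using basis gf2_basis_iff_minimal[OF dirs_sub] by blast
    then have "M' = M"
      using invariant_eq_orbs(1)[OF M inv] invariant_eq_orbs(1)[OF _ M'(2)] M M'(1) by auto
    then show False using M'(1) by blast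
  qed
  then show "minimal_invariant_connecting m I H F M"
    using inv connects_iff_span[OF inv] sp by (simp add: minimal_invariant_connecting_def)
qed

lemma orb_inj_on: "T \<subseteq> VS \<Longrightarrow> 0 \<notin> T \<Longrightarrow> inj_on orb T"
  using orb_inj by (intro inj_onI) blast

lemma zv_orb: "orbit m I H (up_to_sign (zv m I \<D> \<Gamma> b v)) = orb v"
  by (simp only: zv_mv orb_def)

theorem minimal_iff_basis:
  assumes M: "M \<subseteq> fiber_moves m I \<D> b" and inv: "invariant m I H M"
  shows "minimal_invariant_connecting m I H F M \<longleftrightarrow>
    (\<exists>B. gf2_basis c B \<and>
      bij_betw (\<lambda>v. orbit m I H (up_to_sign (zv m I \<D> \<Gamma> b v))) B (orbits m I H M))"
proof
  assume "minimal_invariant_connecting m I H F M"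
  then have "gf2_basis c (dirs M)" using minimal_iff_dirs_basis[OF M inv] by blast
  moreover have "bij_betw orb (dirs M) (orbits m I H M)"
    using orb_inj_on[OF dirs_sub zero_notin_dirs] invariant_eq_orbs(2)[OF M inv]
    by (simp add: bij_betw_def)
  ultimately show "\<exists>B. gf2_basis c B \<and>
      bij_betw (\<lambda>v. orbit m I H (up_to_sign (zv m I \<D> \<Gamma> b v))) B (orbits m I H M)"
    unfolding zv_orb by blast
next
  assume "\<exists>B. gf2_basis c B \<and>
      bij_betw (\<lambda>v. orbit m I H (up_to_sign (zv m I \<D> \<Gamma> b v))) B (orbits m I H M)"
  then obtain B where B: "gf2_basis c B" "bij_betw orb B (orbits m I H M)"
    unfolding zv_orb by blast
  have BVS: "B \<subseteq> VS" "0 \<notin> B" using gf2_basis_nonzero[OF B(1)] by blast+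
  have eq: "orb ` B = orb ` dirs M"
    using B(2) invariant_eq_orbs(2)[OF M inv] by (simp add: bij_betw_def)
  \<comment> \<open>The given \<open>B\<close> must be \<open>dirs M\<close>: the orbits it
    represents make up \<open>M\<close>, and the directions of such a union are just the chosen
    vectors.\<close>
  have "M = (\<Union>v\<in>B. orb v)" using invariant_eq_orbs(1)[OF M inv] eq by simp
  then have "dirs M = B" using dirs_orbs[OF BVS] by simp
  then show "minimal_invariant_connecting m I H F M"
    using minimal_iff_dirs_basis[OF M inv] B(1) by simp
qed

theorem card_orbits_minimal:
  assumes M: "M \<subseteq> fiber_moves m I \<D> b" and min: "minimal_invariant_connecting m I H F M"
  shows "card (orbits m I H M) + 1 = c"
proof -
  have inv: "invariant m I H M" using min by (simp add: minimal_invariant_connecting_def)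
  have "card (orbits m I H M) = card (dirs M)"
    using invariant_eq_orbs(2)[OF M inv] card_image[OF orb_inj_on[OF dirs_sub zero_notin_dirs]] by simp
  moreover have "gf2_basis c (dirs M)" using minimal_iff_dirs_basis[OF M inv] min by blast
  ultimately show ?thesis using card_gf2_basis c_pos by simp
qed

text \<open>Equality of the marginals of two tables on \<open>{rep 1, rep l}\<close> is symmetric in
  the tables and preserved by \<open>g\<close>. So neither the permutation nor an interchange of the
  tables, that is, the sign of the move, can alter the coordinate \<open>v l\<close>.\<close>

lemma orbit_zv_inject:
  assumes v: "v \<in> VS" "v \<noteq> 0" and v': "v' \<in> VS" and g: "g \<in> G"
    and eq: "act_mset m g (pr 0) = pr 0 \<and> act_mset m g (pr v) = pr v' \<or>
      act_mset m g (pr 0) = pr v' \<and> act_mset m g (pr v) = pr 0"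
  shows "v = v'"
proof (rule VS_eqI[OF v(1) v'])
  fix l assume l: "l \<in> {1..c}"
  let ?P = "{rep 1, rep l}"
  have P: "?P \<subseteq> vars m" using \<Gamma>_sub[OF one_in rep[OF one_in]] \<Gamma>_sub[OF l rep[OF l]] S_sub by blast
  have "0 = v l \<longleftrightarrow> restr ?P (pr 0) = restr ?P (pr v)"
    using restr_pair_iff[OF gf2_space_zero v(1) l] by simp
  also have "\<dots> \<longleftrightarrow> restr ?P (act_mset m g (pr 0)) = restr ?P (act_mset m g (pr v))"
    by (rule restr_act_mset_iff[OF P g pr_cells pr_cells, symmetric])
  also have "\<dots> \<longleftrightarrow> restr ?P (pr 0) = restr ?P (pr v')"
    using eq by (auto simp only:)
  also have "\<dots> \<longleftrightarrow> 0 = v' l"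
    using restr_pair_iff[OF gf2_space_zero v' l] by simp
  finally show "v l = v' l" using bit_cases[of "v l"] bit_cases[of "v' l"] by auto
qed

end

subsection \<open>Invariant Markov bases\<close>

lemma act_mset_comp: "act_mset m (comp_perms m g h) X = act_mset m g (act_mset m h X)"
proof -
  have "act_cell m (comp_perms m g h) = act_cell m g \<circ> act_cell m h"
    by (simp add: fun_eq_iff act_cell_comp)
  then show ?thesis by (simp add: multiset.map_comp)
qed

lemma act_mset_disjoint:
  assumes g: "g \<in> level_perms m I" and X: "set_mset X \<subseteq> cells m I" "set_mset Y \<subseteq> cells m I"
    and d: "X \<inter># Y = {#}"
  shows "act_mset m g X \<inter># act_mset m g Y = {#}"
proof -
  have "i \<notin># act_mset m g Y" if i: "i \<in># act_mset m g X" for i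
  proof
    assume "i \<in># act_mset m g Y"
    then obtain y where y: "y \<in># Y" "i = act_cell m g y" by auto
    from i obtain x where x: "x \<in># X" "i = act_cell m g x" by auto
    have "x = y" using act_cell_inv(1)[OF g] x y X by (metis subsetD)
    then show False using d x y by (auto simp: disjunct_not_in)
  qed
  then show ?thesis by (auto simp: disjunct_not_in)
qed

lemma finite_level_perms: "finite (level_perms m I)"
  unfolding level_perms_def by (intro finite_PiE) (auto intro: finite_permutations)

lemma margins_diff: "margins m I \<D> (x - y) = margins m I \<D> x - margins m I \<D> y"
  by (auto simp: margins_def marginal_def fun_eq_iff sum_subtractf)

locale enumerated_model = decomposable_model +
  fixes \<Gamma> :: "marginals \<Rightarrow> nat \<Rightarrow> nat set"
  assumes enum: "\<forall>b\<in>Bnd0 m I \<D>.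
      bij_betw (\<Gamma> b) {1..num_comps m I \<D> b} (nd_components m I \<D> b)"
begin

lemma fixed_fiberI: "b \<in> Bnd0 m I \<D> \<Longrightarrow> fixed_fiber m I \<D> b (\<Gamma> b)"
  by unfold_locales (use enum in auto)

abbreviation "vecs b \<equiv> gf2_space (num_comps m I \<D> b)"
abbreviation "Zv b v \<equiv> up_to_sign (zv m I \<D> (\<Gamma> b) b v)"

definition Dirs :: "arr set set \<Rightarrow> marginals \<Rightarrow> (nat \<Rightarrow> bit) set"
  where "Dirs M b = {v \<in> vecs b. v \<noteq> 0 \<and> Zv b v \<in> M}"

lemma Dirs_sub: "Dirs M b \<subseteq> vecs b"
  by (auto simp: Dirs_def)

lemma connects_iff_span_Dirs:
  assumes inv: "invariant m I G M" and b: "b \<in> Bnd0 m I \<D>"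
  shows "connects M (fiber m I \<D> b) \<longleftrightarrow> gf2.span (Dirs M b) = vecs b"
proof -
  interpret fixed_fiber m I \<D> b "\<Gamma> b" by (rule fixed_fiberI[OF b])
  have "invariant m I H M" using inv H_sub unfolding invariant_def by blast
  moreover have "Dirs M b = dirs M" by (simp only: Dirs_def dirs_def zv_mv)
  ultimately show ?thesis using connects_iff_span by simp
qed

text \<open>For sufficiency, invariance spreads connectedness from \<open>Bnd0\<close> to
  \<open>Bnd\<close>, and chordality spreads it from there to all fibers.\<close>

lemma markov_basis_iff:
  assumes inv: "invariant m I G M" and "M \<subseteq> moves m I \<D>" "finite M"
  shows "markov_basis m I \<D> M \<longleftrightarrow> (\<forall>b\<in>Bnd0 m I \<D>. gf2.span (Dirs M b) = vecs b)"
proof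
  assume "markov_basis m I \<D> M"
  then show "\<forall>b\<in>Bnd0 m I \<D>. gf2.span (Dirs M b) = vecs b"
    using connects_iff_span_Dirs[OF inv] by (simp add: markov_basis_def)
next
  assume "\<forall>b\<in>Bnd0 m I \<D>. gf2.span (Dirs M b) = vecs b"
  then have "\<forall>b\<in>Bnd0 m I \<D>. connects M (fiber m I \<D> b)"
    using connects_iff_span_Dirs[OF inv] by simp
  then have "\<forall>b\<in>Bnd m I \<D>. connects M (fiber m I \<D> b)" using connects_Bnd[OF inv] by blast
  then show "markov_basis m I \<D> M" using connects_all assms by (simp add: markov_basis_def)
qed

text \<open>Disjoint supports split the equality of moves into equalities of tables, up to order.
  One table then identifies the fiber by \<open>Bnd0_orbit_unique\<close>; only after this can the
  vectors be compared, by \<open>orbit_zv_inject\<close> in that one fiber.\<close>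

lemma orbit_representative_unique:
  assumes b: "b \<in> Bnd0 m I \<D>" and v: "v \<in> vecs b" "v \<noteq> 0"
    and b': "b' \<in> Bnd0 m I \<D>" and v': "v' \<in> vecs b'" "v' \<noteq> 0"
    and orb: "Zv b' v' \<in> orbit m I G (Zv b v)"
  shows "b' = b \<and> v' = v"
proof -
  interpret A: fixed_fiber m I \<D> b "\<Gamma> b" by (rule fixed_fiberI[OF b])
  interpret B: fixed_fiber m I \<D> b' "\<Gamma> b'" by (rule fixed_fiberI[OF b'])
  obtain g where g: "g \<in> G" "Zv b' v' = act_move m I g (Zv b v)" using orb by (auto simp: orbit_def)
  let ?X = "act_mset m g (A.pr 0)" and ?Y = "act_mset m g (A.pr v)"
  have dA: "?X \<inter># ?Y = {#}"
    using A.pr_disjoint[OF gf2_space_zero v(1) v(2)[symmetric]]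
    by (rule act_mset_disjoint[OF g(1) A.pr_cells A.pr_cells])
  have dB: "B.pr 0 \<inter># B.pr v' = {#}" "B.pr v' \<inter># B.pr 0 = {#}"
    using B.pr_disjoint[OF gf2_space_zero v'(1) v'(2)[symmetric]]
      B.pr_disjoint[OF v'(1) gf2_space_zero v'(2)] by auto
  have "up_to_sign (freq ?X - freq ?Y) = up_to_sign (freq (B.pr 0) - freq (B.pr v'))"
    using g(2) act_move_freq[OF g(1) A.pr_cells A.pr_cells] by (simp only: A.zv_pr B.zv_pr)
  then consider "freq ?X - freq ?Y = freq (B.pr 0) - freq (B.pr v')"
    | "freq ?X - freq ?Y = freq (B.pr v') - freq (B.pr 0)"
    by (auto simp: up_to_sign_eq_iff)
  then have eq: "?X = B.pr 0 \<and> ?Y = B.pr v' \<or> ?X = B.pr v' \<and> ?Y = B.pr 0"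
    using freq_diff_inject[OF dA dB(1)] freq_diff_inject[OF dA dB(2)] by cases blast+
  then have "freq ?X \<in> fiber m I \<D> b'"
    using B.pr_in_fiber gf2_space_zero v'(1) by auto
  then have "b' = fib ?X" by (simp add: fiber_def)
  moreover have "size (A.pr 0) = 2" by (simp add: A.pr_def)
  ultimately have bb: "b = b'"
    using Bnd0_orbit_unique[OF b b' g(1) A.pr_cells A.b_fib] by blast
  have "v = v'"
    using A.orbit_zv_inject[OF v _ g(1), of v'] eq v'(1) unfolding bb[symmetric] by blast
  then show ?thesis using bb by simp
qed

lemma orbit_zv_invariant:
  assumes b: "b \<in> Bnd0 m I \<D>" and g: "g \<in> G" and Z: "Z \<in> orbit m I G (Zv b v)"
  shows "act_move m I g Z \<in> orbit m I G (Zv b v)"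
proof -
  interpret A: fixed_fiber m I \<D> b "\<Gamma> b" by (rule fixed_fiberI[OF b])
  obtain h where h: "h \<in> G" "Z = act_move m I h (Zv b v)" using Z by (auto simp: orbit_def)
  note gh = comp_perms_in[OF g h(1)]
  have "act_move m I g Z = act_move m I (comp_perms m g h) (Zv b v)"
    unfolding h(2) A.zv_pr act_move_freq[OF h(1) A.pr_cells A.pr_cells]
      act_move_freq[OF gh A.pr_cells A.pr_cells]
      act_move_freq[OF g act_mset_in_cells[OF h(1) A.pr_cells] act_mset_in_cells[OF h(1) A.pr_cells]]
      act_mset_comp ..
  then show ?thesis using gh by (simp add: orbit_def)
qed

lemma Zv_in_orbit:
  assumes b: "b \<in> Bnd0 m I \<D>"
  shows "Zv b v \<in> orbit m I G (Zv b v)"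
proof -
  interpret A: fixed_fiber m I \<D> b "\<Gamma> b" by (rule fixed_fiberI[OF b])
  let ?e = "\<lambda>\<delta>\<in>vars m. id"
  have e: "?e \<in> G" by (auto simp: level_perms_def intro: permutes_id)
  have "act_cell m ?e i = i" if "i \<in> CL" for i
    using that by (auto simp: act_cell_def cells_def PiE_iff extensional_def fun_eq_iff)
  then have "act_mset m ?e (A.pr u) = A.pr u" for u by (simp add: A.pr_def A.lo_hi_cells)
  then have "act_move m I ?e (Zv b v) = Zv b v"
    using act_move_freq[OF e A.pr_cells A.pr_cells] by (simp only: A.zv_pr)
  then show ?thesis using e unfolding orbit_def by (metis image_eqI)
qed

lemma orbit_zv_moves:
  assumes b: "b \<in> Bnd0 m I \<D>" and v: "v \<in> vecs b"
  shows "orbit m I G (Zv b v) \<subseteq> moves m I \<D>"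
proof
  interpret A: fixed_fiber m I \<D> b "\<Gamma> b" by (rule fixed_fiberI[OF b])
  fix Z assume "Z \<in> orbit m I G (Zv b v)"
  then obtain g where g: "g \<in> G" "Z = act_move m I g (Zv b v)" by (auto simp: orbit_def)
  let ?X = "act_mset m g (A.pr 0)" and ?Y = "act_mset m g (A.pr v)"
  have Z: "Z = up_to_sign (freq ?X - freq ?Y)"
    unfolding g(2) A.zv_pr by (rule act_move_freq[OF g(1) A.pr_cells A.pr_cells])
  have cells: "set_mset ?X \<subseteq> CL" "set_mset ?Y \<subseteq> CL"
    by (rule act_mset_in_cells[OF g(1) A.pr_cells])+
  have "freq (A.pr v) \<in> fiber m I \<D> (fib (A.pr 0))"
    using A.pr_in_fiber[OF v] by (simp only: A.b_fib[symmetric])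
  then have "same_margins \<D> (A.pr 0) (A.pr v)"
    using freq_in_fiber_iff[OF A.pr_cells A.pr_cells] by blast
  then have "fib ?X = fib ?Y" using fib_eq_iff[OF cells] same_margins_act by blast
  then have "margins m I \<D> (freq ?X - freq ?Y) = 0" by (simp add: margins_diff)
  moreover have "freq ?X - freq ?Y \<in> arrays m I"
  proof -
    have "freq ?X \<in> tables m I" "freq ?Y \<in> tables m I" using cells tables_iff_freq by blast+
    then show ?thesis by (simp add: tables_def arrays_def)
  qed
  ultimately show "Z \<in> moves m I \<D>" unfolding Z moves_def by blast
qed

section \<open>The Markov basis given by a choice of bases\<close>

context
  fixes B :: "marginals \<Rightarrow> (nat \<Rightarrow> bit) set"
  assumes B: "\<forall>b\<in>Bnd0 m I \<D>. gf2_basis (num_comps m I \<D> b) (B b)"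
begin

abbreviation "MB \<equiv> basis_moves m I \<D> \<Gamma> B"

lemma B_vecs: "b \<in> Bnd0 m I \<D> \<Longrightarrow> v \<in> B b \<Longrightarrow> v \<in> vecs b" "b \<in> Bnd0 m I \<D> \<Longrightarrow> v \<in> B b \<Longrightarrow> v \<noteq> 0"
  using B gf2_basis_nonzero by blast+

lemma basis_movesE:
  assumes "Z \<in> MB"
  obtains b v where "b \<in> Bnd0 m I \<D>" "v \<in> B b" "Z \<in> orbit m I G (Zv b v)"
  using assms unfolding basis_moves_def by (elim UN_E)

lemma basis_movesI: "b \<in> Bnd0 m I \<D> \<Longrightarrow> v \<in> B b \<Longrightarrow> Z \<in> orbit m I G (Zv b v) \<Longrightarrow> Z \<in> MB"
  unfolding basis_moves_def by (intro UN_I)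

lemma basis_moves_invariant: "invariant m I G MB"
  unfolding invariant_def
proof (intro ballI)
  fix g Z assume g: "g \<in> G" and "Z \<in> MB"
  from this(2) obtain b v where b: "b \<in> Bnd0 m I \<D>" "v \<in> B b" "Z \<in> orbit m I G (Zv b v)"
    by (rule basis_movesE)
  show "act_move m I g Z \<in> MB"
    by (rule basis_movesI[OF b(1,2) orbit_zv_invariant[OF b(1) g b(3)]])
qed

lemma basis_moves_moves: "MB \<subseteq> moves m I \<D>"
proof
  fix Z assume "Z \<in> MB"
  then obtain b v where b: "b \<in> Bnd0 m I \<D>" "v \<in> B b" "Z \<in> orbit m I G (Zv b v)"
    by (rule basis_movesE)
  show "Z \<in> moves m I \<D>" using orbit_zv_moves[OF b(1) B_vecs(1)[OF b(1,2)]] b(3) by (rule subsetD)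
qed

lemma basis_moves_finite: "finite MB"
proof -
  have "finite (B b)" if "b \<in> Bnd0 m I \<D>" for b
    using B_vecs(1)[OF that] finite_gf2_space by (meson finite_subset subsetI)
  moreover have "finite (orbit m I G Z)" for Z by (simp add: orbit_def finite_level_perms)
  ultimately show ?thesis
    unfolding basis_moves_def by (intro finite_UN_I finite_Bnd0)
qed

text \<open>By \<open>orbit_representative_unique\<close>, orbits coming from other fibers
  contribute no direction to \<open>b\<close>, and an orbit from \<open>b\<close> itself contributes
  only its own vector.\<close>

lemma Dirs_basis_moves:
  assumes b: "b \<in> Bnd0 m I \<D>"
  shows "Dirs MB b = B b"
proof (intro equalityI subsetI)
  fix v assume "v \<in> Dirs MB b"
  then have v: "v \<in> vecs b" "v \<noteq> 0" "Zv b v \<in> MB" by (simp_all add: Dirs_def)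
  from v(3) obtain b' v' where b': "b' \<in> Bnd0 m I \<D>" "v' \<in> B b'" "Zv b v \<in> orbit m I G (Zv b' v')"
    by (rule basis_movesE)
  have "b = b' \<and> v = v'"
    by (rule orbit_representative_unique[OF b'(1) B_vecs[OF b'(1,2)] b v(1,2) b'(3)])
  then show "v \<in> B b" using b'(2) by simp
next
  fix v assume v: "v \<in> B b"
  have "Zv b v \<in> MB" by (rule basis_movesI[OF b v Zv_in_orbit[OF b]])
  then show "v \<in> Dirs MB b" using B_vecs[OF b v] by (simp add: Dirs_def)
qed

lemma basis_moves_markov: "markov_basis m I \<D> MB"
  using markov_basis_iff[OF basis_moves_invariant basis_moves_moves basis_moves_finite]
    Dirs_basis_moves B by (simp add: gf2_basis_def)

theorem basis_moves_minimal: "minimal_invariant_markov_basis m I \<D> G MB"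
proof -
  have "\<not> markov_basis m I \<D> M'" if M': "M' \<subset> MB" "invariant m I G M'" for M'
  proof
    assume mk: "markov_basis m I \<D> M'"
    then have sp: "\<forall>b\<in>Bnd0 m I \<D>. gf2.span (Dirs M' b) = vecs b"
      using markov_basis_iff[OF M'(2)] by (simp add: markov_basis_def)
    have "MB \<subseteq> M'"
    proof
      fix Z assume "Z \<in> MB"
      then obtain b v where b: "b \<in> Bnd0 m I \<D>" "v \<in> B b" "Z \<in> orbit m I G (Zv b v)"
        by (rule basis_movesE)
      have "Dirs M' b \<subseteq> Dirs MB b" using M'(1) by (auto simp: Dirs_def)
      then have "Dirs M' b \<subseteq> B b" by (simp only: Dirs_basis_moves[OF b(1)])
      moreover have "gf2_basis (num_comps m I \<D> b) (B b)" using B b(1) by blast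
      \<comment> \<open>A spanning subset of a basis is the whole basis, so \<open>M'\<close>
        contains every representative and, being invariant, every orbit.\<close>
      ultimately have "Dirs M' b = B b"
        using gf2_basis_iff_minimal[of "B b" "num_comps m I \<D> b"] sp b(1) B_vecs(1)[OF b(1)] by blast
      then have "Zv b v \<in> M'" using b(2) by (auto simp: Dirs_def)
      then show "Z \<in> M'" using b(3) M'(2) by (auto simp: orbit_def invariant_def)
    qed
    then show False using M'(1) by blast
  qed
  then show ?thesis
    using basis_moves_invariant basis_moves_markov by (simp add: minimal_invariant_markov_basis_def)
qed

end

text \<open>Choose a basis inside the spanning set \<open>Dirs M b\<close> for each
  \<open>b\<close>. The resulting orbits lie in \<open>M\<close> by invariance and already form an
  invariant Markov basis, so minimality forces equality with \<open>M\<close>.\<close>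

theorem minimal_is_basis_moves:
  assumes min: "minimal_invariant_markov_basis m I \<D> G M"
  shows "\<exists>B. (\<forall>b\<in>Bnd0 m I \<D>. gf2_basis (num_comps m I \<D> b) (B b)) \<and> M = basis_moves m I \<D> \<Gamma> B"
proof -
  have inv: "invariant m I G M" and mk: "markov_basis m I \<D> M"
    using min by (auto simp: minimal_invariant_markov_basis_def)
  then have "\<forall>b\<in>Bnd0 m I \<D>. gf2.span (Dirs M b) = vecs b"
    using markov_basis_iff[OF inv] by (simp add: markov_basis_def)
  then have "\<forall>b\<in>Bnd0 m I \<D>. \<exists>B. B \<subseteq> Dirs M b \<and> gf2_basis (num_comps m I \<D> b) B"
    using gf2_basis_subset_exists[OF Dirs_sub] by metis
  then obtain B where B: "\<forall>b\<in>Bnd0 m I \<D>. B b \<subseteq> Dirs M b \<and> gf2_basis (num_comps m I \<D> b) (B b)"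
    by metis
  then have Bb: "\<forall>b\<in>Bnd0 m I \<D>. gf2_basis (num_comps m I \<D> b) (B b)" by blast
  have "basis_moves m I \<D> \<Gamma> B \<subseteq> M"
    using B inv unfolding basis_moves_def orbit_def invariant_def Dirs_def by blast
  then have "M = basis_moves m I \<D> \<Gamma> B"
    using min basis_moves_invariant[OF Bb] basis_moves_markov[OF Bb]
    unfolding minimal_invariant_markov_basis_def by blast
  then show ?thesis using Bb by blast
qed

end

theorem theorem6:
  fixes m :: nat
    and I :: "nat \<Rightarrow> nat"
    and \<D> :: "nat set set"
    and \<Gamma> :: "marginals \<Rightarrow> nat \<Rightarrow> nat set"
  assumes levels: "\<forall>\<delta>\<in>vars m. 2 \<le> I \<delta>"
    and gen: "generating_class m \<D>"
    and decomp: "decomposable m \<D>"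
    and enum: "\<forall>b\<in>Bnd0 m I \<D>.
      bij_betw (\<Gamma> b) {1..num_comps m I \<D> b} (nd_components m I \<D> b)"
  shows
    "(\<forall>b\<in>Bnd0 m I \<D>.
        let F = fiber m I \<D> b; c = num_comps m I \<D> b; H = Gb m I c (\<Gamma> b) in
        (\<forall>M. M \<subseteq> fiber_moves m I \<D> b \<and> invariant m I H M \<longrightarrow>
           (minimal_invariant_connecting m I H F M \<longleftrightarrow>
             (\<exists>B. gf2_basis c B \<and>
                bij_betw (\<lambda>v. orbit m I H (up_to_sign (zv m I \<D> (\<Gamma> b) b v))) B (orbits m I H M)))) \<and>
        (\<forall>M. M \<subseteq> fiber_moves m I \<D> b \<and> minimal_invariant_connecting m I H F M \<longrightarrow>
           card (orbits m I H M) + 1 = c))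
     \<and> (\<forall>B. (\<forall>b\<in>Bnd0 m I \<D>. gf2_basis (num_comps m I \<D> b) (B b)) \<longrightarrow>
          minimal_invariant_markov_basis m I \<D> (level_perms m I) (basis_moves m I \<D> \<Gamma> B))
     \<and> (\<forall>M. minimal_invariant_markov_basis m I \<D> (level_perms m I) M \<longrightarrow>
          (\<exists>B. (\<forall>b\<in>Bnd0 m I \<D>. gf2_basis (num_comps m I \<D> b) (B b)) \<and>
               M = basis_moves m I \<D> \<Gamma> B))"
proof -
  interpret enumerated_model m I \<D> \<Gamma> by unfold_locales fact+
  show ?thesis
    unfolding Let_def
  proof (intro conjI ballI allI impI; (elim conjE)?)
    fix b M assume b: "b \<in> Bnd0 m I \<D>" and M: "M \<subseteq> fiber_moves m I \<D> b"
    interpret A: fixed_fiber m I \<D> b "\<Gamma> b" by (rule fixed_fiberI[OF b])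
    show "minimal_invariant_connecting m I A.H A.F M \<longleftrightarrow>
        (\<exists>B. gf2_basis A.c B \<and>
          bij_betw (\<lambda>v. orbit m I A.H (up_to_sign (zv m I \<D> (\<Gamma> b) b v))) B (orbits m I A.H M))"
      if "invariant m I A.H M"
      using M that by (rule A.minimal_iff_basis)
    show "card (orbits m I A.H M) + 1 = A.c" if "minimal_invariant_connecting m I A.H A.F M"
      using M that by (rule A.card_orbits_minimal)
  qed (use basis_moves_minimal minimal_is_basis_moves in blast)+
qed

end
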